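(* Let $\lambda\in\mathbb R$ with $1+2\lambda\ne0$, let $g$ be an exchangeable probability distribution on $\mathcal T$, and let $\xi$ be a nondegenerate pseudo symmetric measure. Let $\ell=(1,\lambda,\lambda)'$, $\ell_3=(2,-1,-1)'$, $L_3=(\ell,\ell_3)$, $V_{\xi,3}=L_3'V_\xi L_3$, $Q_{\xi,3}=\ell_3'V_\xi\ell_3$, $V_{s,3}=L_3'V_sL_3$, $Q_{s,3}=\ell_3'V_s\ell_3$, and, when $\det(V_{\xi,3})>0$, $r_{s,3}=\operatorname{tr}(V_{s,3}V_{\xi,3}^{-1})-Q_{s,3}/Q_{\xi,3}$. For the total effect $\theta$ in the undirectional model: (i) If $Q_{\xi,3}=0$, then $\xi$ is universally optimal iff $\max_{s\in\mathcal S}c_{s00}/c_{\xi00}=1$. (ii) If $\det(V_{\xi,3})>0$, then: $\xi$ is $\mathcal A_g$-optimal iff $\max_{s\in\mathcal S}\frac{r_{s,3}Q_{\xi,3}/\det(V_{\xi,3})+(t-2)(\ell'V_\xi\ell)^{-2}\ell'V_s\ell}{Q_{\xi,3}/\det(V_{\xi,3})+(t-2)(\ell'V_\xi\ell)^{-1}}=1$; $\xi$ is $\mathcal D_g$-optimal iff $\max_{s\in\mathcal S}\Big(\frac{r_{s,3}}{t-1}+\frac{t-2}{t-1}\frac{\ell'V_s\ell}{\ell'V_\xi\ell}\Big)=1$; $\xi$ is $\mathcal E_g$-optimal iff $\max_{s\in\mathcal S}r_{s,3}=1$; $\xi$ is $\mathcal T_g$-optimal iff $\max_{s\in\mathcal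 S}\frac{r_{s,3}\det(V_{\xi,3})/Q_{\xi,3}+(t-2)\ell'V_s\ell}{\det(V_{\xi,3})/Q_{\xi,3}+(t-2)\ell'V_\xi\ell}=1$. Moreover, in each case, when the stated condition holds, every $s$ with $p_s>0$ attains the maximum.
   Context: Fix integers $k\ge 2$ and $t\ge 2$. Let $\mathcal S$ be the set of all $t^k$ sequences $s=(t_1,\dots,t_k)$ with entries $t_j\in\{1,\dots,t\}$. For $s\in\mathcal S$ let $T_s$ be the $k\times t$ matrix with $(j,i)$ entry equal to $1$ if $t_j=i$ and $0$ otherwise; let $H$ be the $k\times k$ matrix with $(i,j)$ entry $1$ if $i\equiv j+1\pmod k$ and $0$ otherwise; put $L_s=HT_s$, $R_s=H'T_s$ (a prime denotes transpose). Let $\Sigma$ be a fixed $k\times k$ positive definite matrix, $1_k$ the all-ones vector, and $\tilde B=\Sigma^{-1}-\Sigma^{-1}1_k1_k'\Sigma^{-1}/(1_k'\Sigma^{-1}1_k)$. With $G_0=T_s,G_1=L_s,G_2=R_s$ define for $0\le i,j\le 2$ the $t\times t$ matrices $C_{sij}=G_i'\tilde BG_j$, the numbers $c_{sij}=\operatorname{tr}(C_{sij})$, and $V_s=(c_{sij})_{0\le i,j\le2}$. A measure is a vector $\xi=(p_s)_{s\in\mathcal S}$ with $p_s\ge0$, $\sum_sp_s=1$; $\mathcal P$ is the set of all measures; $s$ is a supporting sequence of $\xi$ if $p_s>0$. Put $C_{\xi ij}=\sum_sp_sC_{sij}$, $c_{\xi ij}=\operatorname{tr}(C_{\xi ij})$,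 $V_\xi=(c_{\xi ij})_{0\le i,j\le2}$. The measure $\xi$ is pseudo symmetric if each $C_{\xi ij}$ is completely symmetric, i.e. of the form $aI_t+bJ_t$ with $J_t$ the all-ones matrix; it is nondegenerate if at least one supporting sequence contains two distinct treatments. $M^+$ denotes the Moore–Penrose inverse. For $u,w\in\mathbb R^3$ (coordinates indexed $0,1,2$) let $C_\xi[u,w]=\sum_{i,j=0}^2u_iw_jC_{\xi ij}$. Let $\mathcal T=\{x\in\mathbb R^t:1_t'x=0,\ x\ne0\}$. For $u\in\mathbb R^3$, vectors $w_1,\dots,w_m\in\mathbb R^3$ ($m\in\{1,2\}$) and $x\in\mathcal T$ define $\mathcal I_\xi(u;w_1,\dots,w_m;x)=C_\xi[u,u]-F'G^+F$, where $F$ is the $m\times t$ matrix whose $a$-th row is $(C_\xi[u,w_a]x)'$ and $G$ is the $m\times m$ matrix with entries $x'C_\xi[w_a,w_b]x$. Undirectional model: the information matrix of $\xi$ for the total treatment effect is $\tilde C_\xi(\theta)=(1+2\lambda)^{-2}\mathcal I_\xi(\ell;\ell_3;\theta)$, $\theta\in\mathcal T$, with $\ell=(1,\lambda,\lambda)'$, $\ell_3=(2,-1,-1)'$. A probability distribution $g$ on $\mathcal T$ is exchangeable if the law of $Px$ equals that of $x$ for every $t\times t$ permutation matrix $P$. For a $t\times t$ nonnegative definite matrix $C$ with $C1_t=0$ and eigenvalues $0=a_0\le a_1\le\cdots\le a_{t-1}$ let $\Phi_A(C)=(t-1)(\sum_{i=1}^{t-1}a_i^{-1})^{-1}$ (interpreted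 as $0$ if $a_1=0$), $\Phi_D(C)=(\prod_{i=1}^{t-1}a_i)^{1/(t-1)}$, $\Phi_E(C)=a_1$, $\Phi_T(C)=(t-1)^{-1}\sum_{i=1}^{t-1}a_i$. A measure is $\mathcal A_g$-optimal (for $\theta$ in the undirectional model) if it maximizes $\xi\mapsto\int\Phi_A(\tilde C_\xi(\theta))\,g(d\theta)$ over $\mathcal P$; $\mathcal D_g$-, $\mathcal E_g$-, $\mathcal T_g$-optimality are defined analogously. A measure is universally optimal if it maximizes $\xi\mapsto\int\Phi(\tilde C_\xi(\theta))\,g(d\theta)$ over $\mathcal P$ for every function $\Phi$ on $t\times t$ nonnegative definite matrices that is concave, satisfies $\Phi(S'CS)=\Phi(C)$ for all permutation matrices $S$, and has $b\mapsto\Phi(bC)$ nondecreasing for $b>0$. *)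

theory Defs
  imports "Jordan_Normal_Form.Char_Poly" "Jordan_Normal_Form.Gauss_Jordan_Elimination"
    "HOL-Probability.Probability"
begin

(* Conventions: treatments are 0..t-1 and periods are 0..k-1 (shift of the paper's 1-based labels).
   Matrices are Jordan_Normal_Form matrices with explicit dimensions. *)

definition mtrace :: "real Matrix.mat \<Rightarrow> real" where
  "mtrace A = (\<Sum>i<dim_row A. A $$ (i,i))"

definition minv :: "real Matrix.mat \<Rightarrow> real Matrix.mat" where
  "minv A = (case mat_inverse A of Some B \<Rightarrow> B | None \<Rightarrow> 0\<^sub>m (dim_row A) (dim_col A))"

definition ones_vec :: "nat \<Rightarrow> real Matrix.vec" where
  "ones_vec n = Matrix.vec n (\<lambda>_. 1)"

definition Jmat :: "nat \<Rightarrow> real Matrix.mat" where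
  "Jmat n = Matrix.mat n n (\<lambda>_. 1)"

definition outer :: "real Matrix.vec \<Rightarrow> real Matrix.vec \<Rightarrow> real Matrix.mat" where
  "outer u w = Matrix.mat (dim_vec u) (dim_vec w) (\<lambda>(i,j). u $ i * w $ j)"

definition pos_def :: "nat \<Rightarrow> real Matrix.mat \<Rightarrow> bool" where
  "pos_def n S \<longleftrightarrow> S \<in> carrier_mat n n \<and> transpose_mat S = S \<and>
     (\<forall>x \<in> carrier_vec n. x \<noteq> 0\<^sub>v n \<longrightarrow> scalar_prod x (S *\<^sub>v x) > 0)"

definition Seqs :: "nat \<Rightarrow> nat \<Rightarrow> nat list set" where
  "Seqs k t = {s. length s = k \<and> set s \<subseteq> {..<t}}"

definition Tmat :: "nat \<Rightarrow> nat \<Rightarrow> nat list \<Rightarrow> real Matrix.mat" where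
  "Tmat k t s = Matrix.mat k t (\<lambda>(j,i). if s ! j = i then 1 else 0)"

definition Hmat :: "nat \<Rightarrow> real Matrix.mat" where
  "Hmat k = Matrix.mat k k (\<lambda>(i,j). if i mod k = (j + 1) mod k then 1 else 0)"

definition Gmat :: "nat \<Rightarrow> nat \<Rightarrow> nat list \<Rightarrow> nat \<Rightarrow> real Matrix.mat" where
  "Gmat k t s i = (if i = 0 then Tmat k t s
                   else if i = 1 then Hmat k * Tmat k t s
                   else transpose_mat (Hmat k) * Tmat k t s)"

definition Btilde :: "nat \<Rightarrow> real Matrix.mat \<Rightarrow> real Matrix.mat" where
  "Btilde k Sig = (let Si = minv Sig in
      Si - (1 / (scalar_prod (ones_vec k) (Si *\<^sub>v ones_vec k))) \<cdot>\<^sub>m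
             (Si * outer (ones_vec k) (ones_vec k) * Si))"

definition Cs :: "nat \<Rightarrow> nat \<Rightarrow> real Matrix.mat \<Rightarrow> nat list \<Rightarrow> nat \<Rightarrow> nat \<Rightarrow> real Matrix.mat" where
  "Cs k t Sig s i j = transpose_mat (Gmat k t s i) * Btilde k Sig * Gmat k t s j"

definition Vs :: "nat \<Rightarrow> nat \<Rightarrow> real Matrix.mat \<Rightarrow> nat list \<Rightarrow> real Matrix.mat" where
  "Vs k t Sig s = Matrix.mat 3 3 (\<lambda>(i,j). mtrace (Cs k t Sig s i j))"

(* measures: xi = (p_s)_{s in S}, represented by p restricted to Seqs k t *)
definition measures :: "nat \<Rightarrow> nat \<Rightarrow> (nat list \<Rightarrow> real) set" where
  "measures k t = {p. (\<forall>s \<in> Seqs k t. p s \<ge> 0) \<and> (\<Sum>s \<in> Seqs k t. p s) = 1}"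

definition Cxi :: "nat \<Rightarrow> nat \<Rightarrow> real Matrix.mat \<Rightarrow> (nat list \<Rightarrow> real) \<Rightarrow> nat \<Rightarrow> nat \<Rightarrow> real Matrix.mat" where
  "Cxi k t Sig p i j = Matrix.mat t t (\<lambda>ab. \<Sum>s \<in> Seqs k t. p s * (Cs k t Sig s i j) $$ ab)"

definition Vxi :: "nat \<Rightarrow> nat \<Rightarrow> real Matrix.mat \<Rightarrow> (nat list \<Rightarrow> real) \<Rightarrow> real Matrix.mat" where
  "Vxi k t Sig p = Matrix.mat 3 3 (\<lambda>(i,j). mtrace (Cxi k t Sig p i j))"

definition compl_sym :: "nat \<Rightarrow> real Matrix.mat \<Rightarrow> bool" where
  "compl_sym t C \<longleftrightarrow> (\<exists>a b. C = a \<cdot>\<^sub>m 1\<^sub>m t + b \<cdot>\<^sub>m Jmat t)"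

definition pseudo_symmetric :: "nat \<Rightarrow> nat \<Rightarrow> real Matrix.mat \<Rightarrow> (nat list \<Rightarrow> real) \<Rightarrow> bool" where
  "pseudo_symmetric k t Sig p \<longleftrightarrow> (\<forall>i<3. \<forall>j<3. compl_sym t (Cxi k t Sig p i j))"

definition nondegenerate :: "nat \<Rightarrow> nat \<Rightarrow> (nat list \<Rightarrow> real) \<Rightarrow> bool" where
  "nondegenerate k t p \<longleftrightarrow> (\<exists>s \<in> Seqs k t. p s > 0 \<and> (\<exists>a<k. \<exists>b<k. s ! a \<noteq> s ! b))"

definition Cuw :: "nat \<Rightarrow> nat \<Rightarrow> real Matrix.mat \<Rightarrow> (nat list \<Rightarrow> real) \<Rightarrow> real Matrix.vec \<Rightarrow> real Matrix.vec \<Rightarrow> real Matrix.mat" where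
  "Cuw k t Sig p u w = Matrix.mat t t (\<lambda>ab. \<Sum>i<3. \<Sum>j<3. u $ i * w $ j * (Cxi k t Sig p i j) $$ ab)"

(* Moore-Penrose inverse of a 1x1 matrix (g): (1/g) if g \<noteq> 0, else 0; real "inverse" does exactly this *)
definition Iinfo1 :: "nat \<Rightarrow> nat \<Rightarrow> real Matrix.mat \<Rightarrow> (nat list \<Rightarrow> real) \<Rightarrow> real Matrix.vec \<Rightarrow> real Matrix.vec \<Rightarrow> real Matrix.vec \<Rightarrow> real Matrix.mat" where
  "Iinfo1 k t Sig p u w x = (let f = Cuw k t Sig p u w *\<^sub>v x;
                                    g = scalar_prod x (Cuw k t Sig p w w *\<^sub>v x) in
      Cuw k t Sig p u u - inverse g \<cdot>\<^sub>m outer f f)"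

definition ellv :: "real \<Rightarrow> real Matrix.vec" where
  "ellv lam = vec_of_list [1, lam, lam]"

definition ell3 :: "real Matrix.vec" where
  "ell3 = vec_of_list [2, -1, -1]"

definition Ctilde :: "nat \<Rightarrow> nat \<Rightarrow> real Matrix.mat \<Rightarrow> real \<Rightarrow> (nat list \<Rightarrow> real) \<Rightarrow> (nat \<Rightarrow> real) \<Rightarrow> real Matrix.mat" where
  "Ctilde k t Sig lam p theta =
     (1 / (1 + 2 * lam)^2) \<cdot>\<^sub>m Iinfo1 k t Sig p (ellv lam) ell3 (Matrix.vec t theta)"

(* treatment contrasts: vectors in R^t, represented as nat \<Rightarrow> real vanishing outside {..<t} *)
definition Tset :: "nat \<Rightarrow> (nat \<Rightarrow> real) set" where
  "Tset t = {x. (\<forall>i\<ge>t. x i = 0) \<and> (\<Sum>i<t. x i) = 0 \<and> (\<exists>i<t. x i \<noteq> 0)}"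

definition exchangeable :: "nat \<Rightarrow> (nat \<Rightarrow> real) measure \<Rightarrow> bool" where
  "exchangeable t g \<longleftrightarrow> prob_space g \<and> sets g = sets borel \<and> (AE x in g. x \<in> Tset t) \<and>
     (\<forall>\<sigma>. \<sigma> permutes {..<t} \<longrightarrow> distr g borel (\<lambda>x i. x (\<sigma> i)) = g)"

definition eigs :: "real Matrix.mat \<Rightarrow> real list" where
  "eigs C = sorted_list_of_multiset (proots (char_poly C))"

definition PhiA :: "nat \<Rightarrow> real Matrix.mat \<Rightarrow> real" where
  "PhiA t C = (let a = tl (eigs C) in
     if a ! 0 = 0 then 0 else (real t - 1) / (\<Sum>i<t-1. inverse (a ! i)))"

definition PhiD :: "nat \<Rightarrow> real Matrix.mat \<Rightarrow> real" where
  "PhiD t C = (let a = tl (eigs C) in (\<Prod>i<t-1. a ! i) powr (1 / (real t - 1)))"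

definition PhiE :: "nat \<Rightarrow> real Matrix.mat \<Rightarrow> real" where
  "PhiE t C = tl (eigs C) ! 0"

definition PhiT :: "nat \<Rightarrow> real Matrix.mat \<Rightarrow> real" where
  "PhiT t C = (let a = tl (eigs C) in (\<Sum>i<t-1. a ! i) / (real t - 1))"

definition crit :: "nat \<Rightarrow> nat \<Rightarrow> real Matrix.mat \<Rightarrow> real \<Rightarrow> (nat \<Rightarrow> real) measure \<Rightarrow>
    (real Matrix.mat \<Rightarrow> real) \<Rightarrow> (nat list \<Rightarrow> real) \<Rightarrow> real" where
  "crit k t Sig lam g Phi p = (\<integral>theta. Phi (Ctilde k t Sig lam p theta) \<partial>g)"

definition optimal_for :: "nat \<Rightarrow> nat \<Rightarrow> real Matrix.mat \<Rightarrow> real \<Rightarrow> (nat \<Rightarrow> real) measure \<Rightarrow>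
    (real Matrix.mat \<Rightarrow> real) \<Rightarrow> (nat list \<Rightarrow> real) \<Rightarrow> bool" where
  "optimal_for k t Sig lam g Phi p \<longleftrightarrow> p \<in> measures k t \<and>
     (\<forall>q \<in> measures k t. crit k t Sig lam g Phi q \<le> crit k t Sig lam g Phi p)"

definition nnd :: "nat \<Rightarrow> real Matrix.mat \<Rightarrow> bool" where
  "nnd n C \<longleftrightarrow> C \<in> carrier_mat n n \<and> transpose_mat C = C \<and>
     (\<forall>x \<in> carrier_vec n. scalar_prod x (C *\<^sub>v x) \<ge> 0)"

definition perm_mat :: "nat \<Rightarrow> real Matrix.mat \<Rightarrow> bool" where
  "perm_mat n S \<longleftrightarrow> (\<exists>\<sigma>. \<sigma> permutes {..<n} \<and> S = Matrix.mat n n (\<lambda>(i,j). if \<sigma> i = j then 1 else 0))"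

definition admissible_Phi :: "nat \<Rightarrow> (real Matrix.mat \<Rightarrow> real) \<Rightarrow> bool" where
  "admissible_Phi n Phi \<longleftrightarrow>
     (\<forall>A B a. nnd n A \<longrightarrow> nnd n B \<longrightarrow> 0 \<le> a \<longrightarrow> a \<le> 1 \<longrightarrow>
        Phi (a \<cdot>\<^sub>m A + (1 - a) \<cdot>\<^sub>m B) \<ge> a * Phi A + (1 - a) * Phi B) \<and>
     (\<forall>S C. perm_mat n S \<longrightarrow> nnd n C \<longrightarrow> Phi (transpose_mat S * C * S) = Phi C) \<and>
     (\<forall>C b b'. nnd n C \<longrightarrow> 0 < b \<longrightarrow> b \<le> b' \<longrightarrow> Phi (b \<cdot>\<^sub>m C) \<le> Phi (b' \<cdot>\<^sub>m C))"

definition universally_optimal :: "nat \<Rightarrow> nat \<Rightarrow> real Matrix.mat \<Rightarrow> real \<Rightarrow> (nat \<Rightarrow> real) measure \<Rightarrow>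
    (nat list \<Rightarrow> real) \<Rightarrow> bool" where
  "universally_optimal k t Sig lam g p \<longleftrightarrow>
     (\<forall>Phi. admissible_Phi t Phi \<longrightarrow> optimal_for k t Sig lam g Phi p)"

definition L3 :: "real \<Rightarrow> real Matrix.mat" where
  "L3 lam = Matrix.mat 3 2 (\<lambda>(i,j). if j = 0 then ellv lam $ i else ell3 $ i)"

definition quad :: "real Matrix.mat \<Rightarrow> real Matrix.vec \<Rightarrow> real" where
  "quad V u = scalar_prod u (V *\<^sub>v u)"

definition r3 :: "real \<Rightarrow> real Matrix.mat \<Rightarrow> real Matrix.mat \<Rightarrow> real" where
  "r3 lam Vsm Vx = (let L = L3 lam in
      mtrace ((transpose_mat L * Vsm * L) * minv (transpose_mat L * Vx * L))
      - quad Vsm ell3 / quad Vx ell3)"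

end

theory Submission
  imports Defs
begin

text \<open>
  For a measure all of whose information matrices are multiples of the centring matrix, the information
  matrix for the total effect at \<open>\<theta>\<close> has, besides the trivial eigenvalue \<open>0\<close>, the eigenvalue
  \<open>D = det V\<^sub>3 / Q\<^sub>3\<close> in the direction of \<open>\<theta>\<close> and \<open>A = \<ell>' V \<ell>\<close> with multiplicity \<open>t - 2\<close>
  (up to a common factor), so each criterion is an explicit function of \<open>D \<le> A\<close>.

  Sufficiency: a Schur complement lies below every one of the matrices obtained by replacing the optimal
  regression coefficient by a fixed one. With the coefficient of \<open>\<xi>\<close> this gives an upper bound that is
  linear in the competing measure, and each criterion lies below its tangent at the two-point spectrum
  of \<open>\<xi>\<close>. Exchangeability gives \<open>E[\<theta>\<theta>' / \<theta>'\<theta>] = (I - J / t) / (t - 1)\<close>, so averaging the bound over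
  \<open>g\<close> yields exactly the linear functional in the stated condition. If the criterion of a competitor is not
  integrable, the integral is \<open>0\<close> by convention and there is nothing to show.

  Necessity: moving from \<open>\<xi>\<close> towards the uniform measure on the relabellings of a sequence \<open>s\<close> keeps the
  explicit form of the spectrum, and the derivative along this segment is the stated functional at \<open>s\<close>.

  Part (i) is vacuous: \<open>Q\<^sub>3 = 0\<close> would make the cyclic Laplacian of every supporting sequence vanish,
  so that these sequences would be constant.
\<close>

section \<open>Spectral decomposition on contrasts\<close>

text \<open>A competing measure need not be centred, so the spectrum of its information matrix has
  no explicit form; only two functionals of that matrix are controlled, its quadratic form
  \<open>qf\<close> at the unit vector along \<theta> and its trace. Every criterion is therefore
  bounded by \<open>xd * qf + xa * (mtrace - qf)\<close> with \<open>0 \<le> xa \<le> xd\<close>: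
  written as \<open>(xd - xa) * qf + xa * mtrace\<close>, this only asks for upper bounds on the two
  functionals. As a function of \<delta> and \<alpha>, the criterion has partial derivatives
  \<open>xd\<close> and \<open>(t - 2) * xa\<close> at the spectrum of \<xi>. All four criteria are
  homogeneous of degree one, so the tangent has no constant term, and the test becomes a comparison
  of a ratio with 1. How eigenvalues depend measurably on \<theta> is never studied: for a centred
  measure the criterion takes one value on all nonconstant \<theta>. Vectors are functions on
  \<open>nat\<close> because \<open>g\<close> lives on that space; its product topology also
  supplies the compactness from which eigenvectors are obtained.\<close>

definition ip :: "nat \<Rightarrow> (nat \<Rightarrow> real) \<Rightarrow> (nat \<Rightarrow> real) \<Rightarrow> real" where
  "ip n x y = (\<Sum>i<n. x i * y i)"

definition mv :: "nat \<Rightarrow> (nat \<Rightarrow> nat \<Rightarrow> real) \<Rightarrow> (nat \<Rightarrow> real) \<Rightarrow> nat \<Rightarrow> real" where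
  "mv n C x = (\<lambda>r. \<Sum>c<n. C r c * x c)"

lemma ip_commute: "ip n x y = ip n y x"
  by (simp add: ip_def mult.commute)

lemma ip_add_left: "ip n (\<lambda>i. x i + y i) z = ip n x z + ip n y z"
  by (simp add: ip_def distrib_right sum.distrib)

lemma ip_diff_left: "ip n (\<lambda>i. x i - y i) z = ip n x z - ip n y z"
  by (simp add: ip_def left_diff_distrib sum_subtractf)

lemma ip_scale_left: "ip n (\<lambda>i. c * x i) z = c * ip n x z"
  by (simp add: ip_def sum_distrib_left mult.assoc)

lemma ip_sum_left: "ip n (\<lambda>i. \<Sum>j\<in>J. f j i) z = (\<Sum>j\<in>J. ip n (f j) z)"
  unfolding ip_def by (subst sum.swap) (simp add: sum_distrib_right)

lemma ip_add_right: "ip n z (\<lambda>i. x i + y i) = ip n z x + ip n z y"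
  by (simp add: ip_def distrib_left sum.distrib)

lemma ip_diff_right: "ip n z (\<lambda>i. x i - y i) = ip n z x - ip n z y"
  by (simp add: ip_def right_diff_distrib sum_subtractf)

lemma ip_scale_right: "ip n z (\<lambda>i. c * x i) = c * ip n z x"
  by (simp add: ip_def sum_distrib_left algebra_simps)

lemma ip_sum_right: "ip n z (\<lambda>i. \<Sum>j\<in>J. f j i) = (\<Sum>j\<in>J. ip n z (f j))"
  using ip_sum_left[of n f J z] by (simp add: ip_commute)

lemmas ip_linear = ip_add_left ip_add_right ip_diff_left ip_diff_right ip_scale_left
  ip_scale_right ip_sum_left ip_sum_right

lemma ip_cong: "(\<And>i. i < n \<Longrightarrow> x i = x' i) \<Longrightarrow> (\<And>i. i < n \<Longrightarrow> y i = y' i) \<Longrightarrow> ip n x y = ip n x' y'"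
  by (simp add: ip_def)

lemma ip_delta: "c < n \<Longrightarrow> ip n x (\<lambda>d. of_bool (d = c)) = x c"
  by (simp add: ip_def)

lemma ip_self_nonneg: "ip n x x \<ge> 0"
  by (simp add: ip_def sum_nonneg)

lemma ip_self_eq_0_iff: "ip n x x = 0 \<longleftrightarrow> (\<forall>i<n. x i = 0)"
  by (auto simp: ip_def sum_nonneg_eq_0_iff)

lemma mv_add: "mv n C (\<lambda>i. x i + y i) = (\<lambda>r. mv n C x r + mv n C y r)"
  by (simp add: mv_def distrib_left sum.distrib)

lemma mv_scale: "mv n C (\<lambda>i. c * x i) = (\<lambda>r. c * mv n C x r)"
  by (simp add: mv_def sum_distrib_left algebra_simps)

lemma mv_symmetric:
  assumes "\<And>r c. r < n \<Longrightarrow> c < n \<Longrightarrow> C r c = C c r"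
  shows "ip n x (mv n C y) = ip n (mv n C x) y"
proof -
  have "ip n x (mv n C y) = (\<Sum>r<n. \<Sum>c<n. x r * C r c * y c)"
    by (simp add: ip_def mv_def sum_distrib_left mult.assoc)
  also have "\<dots> = (\<Sum>c<n. \<Sum>r<n. x r * C r c * y c)" by (rule sum.swap)
  also have "\<dots> = (\<Sum>c<n. \<Sum>r<n. x r * C c r * y c)"
    using assms by simp
  also have "\<dots> = ip n (mv n C x) y"
    by (simp add: ip_def mv_def sum_distrib_right sum_distrib_left algebra_simps)
  finally show ?thesis .
qed

section \<open>Eigenvectors by constrained minimisation\<close>

lemma linear_coeff_zero_of_quadratic_nonneg:
  fixes b c :: real
  assumes "\<And>s. 2 * s * b + s\<^sup>2 * c \<ge> 0"
  shows "b = 0"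
proof (rule ccontr)
  assume b: "b \<noteq> 0"
  \<comment> \<open>The \<open>+ 1\<close> keeps the denominator positive and larger than
    \<open>c\<close>, so the linear term dominates for either sign of \<open>c\<close>.\<close>
  define s where "s = - b / (\<bar>c\<bar> + 1)"
  have "2 * s * b + s\<^sup>2 * c = b\<^sup>2 / (\<bar>c\<bar> + 1) * (c / (\<bar>c\<bar> + 1) - 2)"
  proof -
    define d where "d = \<bar>c\<bar> + 1"
    have "d \<noteq> 0" by (simp add: d_def add_nonneg_eq_0_iff)
    then show ?thesis unfolding s_def d_def[symmetric]
      by (simp add: power2_eq_square field_simps)
  qed
  moreover have "c / (\<bar>c\<bar> + 1) - 2 < 0"
    by (simp add: field_simps)
  moreover have "b\<^sup>2 / (\<bar>c\<bar> + 1) > 0" using b by (simp add: add_nonneg_pos)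
  ultimately have "2 * s * b + s\<^sup>2 * c < 0" by (metis mult_pos_neg)
  then show False using assms[of s] by linarith
qed

definition orthonormal :: "nat \<Rightarrow> nat \<Rightarrow> (nat \<Rightarrow> nat \<Rightarrow> real) \<Rightarrow> bool" where
  "orthonormal n m v \<longleftrightarrow> (\<forall>i<m. \<forall>j<m. ip n (v i) (v j) = of_bool (i = j))"

text \<open>The squared lengths of the projections of the \<open>n\<close> coordinate vectors onto
  the span of the \<open>v i\<close> add up to \<open>m < n\<close>. Some coordinate vector
  therefore has a projection shorter than 1, and its residual, normalised, is the required
  vector.\<close>

lemma exists_unit_orthogonal:
  assumes o: "orthonormal n m v" and "m < n"
  shows "\<exists>x. (\<forall>i\<ge>n. x i = 0) \<and> ip n x x = 1 \<and> (\<forall>i<m. ip n x (v i) = 0)"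
proof -
  have "(\<Sum>r<n. \<Sum>i<m. (v i r)\<^sup>2) = (\<Sum>i<m. ip n (v i) (v i))"
    unfolding ip_def by (subst sum.swap) (simp add: power2_eq_square)
  also have "\<dots> = real m" using o by (simp add: orthonormal_def)
  finally have "(\<Sum>r<n. \<Sum>i<m. (v i r)\<^sup>2) < (\<Sum>r<n. 1)" using \<open>m < n\<close> by simp
  then obtain r where r: "r < n" "(\<Sum>i<m. (v i r)\<^sup>2) < 1"
    by (meson lessThan_iff not_less sum_mono)
  define d where "d = (\<lambda>i. of_bool (i = r) :: real)"
  define x where "x = (\<lambda>i. d i - (\<Sum>j<m. v j r * v j i))"
  have d: "ip n d y = y r" for y
    using r by (simp add: ip_def d_def of_bool_def if_distribR if_distrib[of "\<lambda>x. x * _"] cong: if_cong)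
  have xv: "ip n x (v i) = 0" if "i < m" for i
  proof -
    have "(\<Sum>j<m. v j r * ip n (v j) (v i)) = (\<Sum>j<m. v j r * of_bool (j = i))"
      using o that by (intro sum.cong) (auto simp: orthonormal_def)
    also have "\<dots> = v i r" using that by simp
    finally show ?thesis by (simp add: x_def ip_linear d)
  qed
  have "ip n x x = ip n d x - (\<Sum>j<m. v j r * ip n (v j) x)"
    by (subst (1) x_def) (simp add: ip_linear)
  also have "\<dots> = x r" using xv d[of x] by (simp add: ip_commute[of n _ x])
  also have "\<dots> = 1 - (\<Sum>j<m. (v j r)\<^sup>2)" by (simp add: x_def d_def power2_eq_square)
  finally have pos: "ip n x x > 0" using r by simp
  define z where "z = (\<lambda>i. if i < n then (1 / sqrt (ip n x x)) * x i else 0)"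
  have z: "ip n z y = (1 / sqrt (ip n x x)) * ip n x y" for y
    unfolding ip_scale_left[symmetric] by (rule ip_cong) (auto simp: z_def)
  have "ip n z z = 1"
    unfolding z ip_commute[of n x z] using pos by simp
  moreover have "\<forall>i\<ge>n. z i = 0" by (simp add: z_def)
  moreover have "\<forall>i<m. ip n z (v i) = 0" using xv by (simp add: z)
  ultimately show ?thesis by blast
qed

lemma continuous_on_ip [continuous_intros]:
  fixes f h :: "(nat \<Rightarrow> real) \<Rightarrow> nat \<Rightarrow> real"
  assumes "\<And>i. continuous_on S (\<lambda>x. f x i)" "\<And>i. continuous_on S (\<lambda>x. h x i)"
  shows "continuous_on S (\<lambda>x. ip n (f x) (h x))"
  unfolding ip_def by (rule continuous_on_sum, rule continuous_on_mult) (rule assms)+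

lemma continuous_on_coord [continuous_intros]: "continuous_on S (\<lambda>x::nat \<Rightarrow> real. x i)"
  by (rule continuous_on_subset[OF continuous_on_product_coordinates]) simp

text \<open>Fixing the coordinates beyond \<open>n\<close> at 0 puts the section inside a product of
  compact intervals, so Tychonoff applies in the product topology; the remaining conditions are
  closed.\<close>

lemma compact_sphere_section:
  "compact {x. (\<forall>i\<ge>n. x i = 0) \<and> ip n x x = 1 \<and> (\<forall>i<m. ip n x (v i) = 0)}" (is "compact ?S")
proof -
  define K where "K = (\<lambda>i. if i < n then {-1..1::real} else {0})"
  have "compactin (product_topology (\<lambda>i. euclidean) UNIV) (PiE UNIV K)"
    by (subst compactin_PiE) (auto simp: K_def)
  then have K: "compact (PiE UNIV K)" by (simp add: euclidean_product_topology)
  have S_eq: "?S = {x. \<forall>i\<ge>n. x i = 0} \<inter> {x. ip n x x = 1} \<inter> {x. \<forall>i<m. ip n x (v i) = 0}" by auto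
  have "closed {x::nat\<Rightarrow>real. \<forall>i\<ge>n. x i = 0}"
    by (intro closed_Collect_all closed_Collect_imp closed_Collect_eq continuous_intros) auto
  moreover have "closed {x. ip n x x = 1}"
    by (intro closed_Collect_eq continuous_intros)
  moreover have "closed {x. \<forall>i<m. ip n x (v i) = 0}"
    by (intro closed_Collect_all closed_Collect_imp closed_Collect_eq continuous_intros) auto
  ultimately have cl: "closed ?S" unfolding S_eq by (intro closed_Int)
  have "?S \<subseteq> PiE UNIV K"
  proof
    fix x assume x: "x \<in> ?S"
    have "\<bar>x i\<bar> \<le> 1" if "i < n" for i
    proof -
      have "(x i)\<^sup>2 \<le> ip n x x"
        unfolding ip_def power2_eq_square using that by (intro member_le_sum) auto
      then show ?thesis using x by (simp add: abs_square_le_1)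
    qed
    then show "x \<in> PiE UNIV K" using x by (auto simp: K_def abs_le_iff)
  qed
  then show ?thesis using compact_Int_closed[OF K cl] by (simp add: Int_absorb1)
qed

text \<open>The eigenvector is a minimiser of the quadratic form on the unit sphere of the orthogonal
  complement of the known ones.\<close>

lemma exists_next_eigenvector:
  assumes sym: "\<And>r c. r < n \<Longrightarrow> c < n \<Longrightarrow> C r c = C c r"
    and o: "orthonormal n m v" and "m < n"
    and eig: "\<And>i r. i < m \<Longrightarrow> r < n \<Longrightarrow> mv n C (v i) r = a i * v i r"
  shows "\<exists>x \<mu>. ip n x x = 1 \<and> (\<forall>i<m. ip n x (v i) = 0) \<and> (\<forall>r<n. mv n C x r = \<mu> * x r) \<and>
    (\<forall>y. (\<forall>i<m. ip n y (v i) = 0) \<longrightarrow> ip n y (mv n C y) \<ge> \<mu> * ip n y y)"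
proof -
  let ?S = "{x. (\<forall>i\<ge>n. x i = 0) \<and> ip n x x = 1 \<and> (\<forall>i<m. ip n x (v i) = 0)}"
  have cont: "continuous_on ?S (\<lambda>x. ip n x (mv n C x))"
    unfolding mv_def by (intro continuous_intros)
  have ne: "?S \<noteq> {}" using exists_unit_orthogonal[OF o \<open>m < n\<close>] by blast
  obtain x where x: "x \<in> ?S" and min: "\<And>y. y \<in> ?S \<Longrightarrow> ip n x (mv n C x) \<le> ip n y (mv n C y)"
    using continuous_attains_inf[OF compact_sphere_section ne cont] by blast
  define \<mu> where "\<mu> = ip n x (mv n C x)"
  have ge: "ip n y (mv n C y) \<ge> \<mu> * ip n y y" if y: "\<And>i. i < m \<Longrightarrow> ip n y (v i) = 0" for y
  proof (cases "ip n y y = 0")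
    case True
    then have "ip n y (mv n C y) = ip n (\<lambda>_. 0) (mv n C y)"
      by (intro ip_cong) (auto simp: ip_self_eq_0_iff)
    then show ?thesis using True by (simp add: ip_def)
  next
    case False
    then have pos: "ip n y y > 0" using ip_self_nonneg[of n y] by simp
    define c where "c = 1 / sqrt (ip n y y)"
    have c: "c * c = 1 / ip n y y" using pos by (simp add: c_def)
    define z where "z = (\<lambda>i. if i < n then c * y i else 0)"
    have z: "ip n z w = c * ip n y w" for w
      unfolding ip_scale_left[symmetric] by (rule ip_cong) (auto simp: z_def)
    have mz: "mv n C z = (\<lambda>r. c * mv n C y r)"
      unfolding mv_scale[symmetric] by (auto simp: mv_def z_def)
    have "ip n z z = c * c * ip n y y" unfolding z by (simp add: ip_commute[of n y z] z)
    then have "z \<in> ?S" using y c pos by (auto simp: z) (auto simp: z_def)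
    from min[OF this] have "\<mu> \<le> c * c * ip n y (mv n C y)"
      by (simp add: \<mu>_def z mz ip_linear mult.assoc)
    then show ?thesis using pos by (simp add: c field_simps)
  qed
  \<comment> \<open>The residual of the eigenvalue equation is orthogonal to the known eigenvectors,
    hence an admissible direction of variation. The first-order condition at the minimiser along
    this direction says exactly that its squared norm is 0.\<close>
  define z where "z = (\<lambda>r. mv n C x r - \<mu> * x r)"
  have zv: "ip n z (v i) = 0" if "i < m" for i
  proof -
    have "ip n (mv n C x) (v i) = ip n x (mv n C (v i))" by (simp add: mv_symmetric[OF sym])
    also have "\<dots> = ip n x (\<lambda>r. a i * v i r)" using eig that by (intro ip_cong) auto
    finally show ?thesis using x that by (simp add: z_def ip_linear)
  qed
  have "ip n z (mv n C x) - \<mu> * ip n z x = 0"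
  proof (rule linear_coeff_zero_of_quadratic_nonneg)
    fix s :: real
    let ?y = "\<lambda>i. x i + s * z i"
    have "ip n ?y (v i) = 0" if "i < m" for i using that x zv by (simp add: ip_linear)
    then have "0 \<le> ip n ?y (mv n C ?y) - \<mu> * ip n ?y ?y" using ge by fastforce
    also have "\<dots> = (ip n x (mv n C x) - \<mu> * ip n x x) + s * (ip n x (mv n C z) + ip n z (mv n C x))
        - 2 * s * \<mu> * ip n z x + s\<^sup>2 * (ip n z (mv n C z) - \<mu> * ip n z z)"
      by (simp add: ip_linear mv_add mv_scale ip_commute[of n x z] power2_eq_square algebra_simps)
    also have "ip n x (mv n C x) - \<mu> * ip n x x = 0" using x by (simp add: \<mu>_def)
    also have "ip n x (mv n C z) = ip n z (mv n C x)"
      by (subst mv_symmetric[where C=C, OF sym]) (auto intro: ip_commute)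
    finally show "0 \<le> 2 * s * (ip n z (mv n C x) - \<mu> * ip n z x) + s\<^sup>2 * (ip n z (mv n C z) - \<mu> * ip n z z)"
      by (simp add: algebra_simps)
  qed
  moreover have "ip n z z = ip n z (mv n C x) - \<mu> * ip n z x"
    by (subst (2) z_def) (simp add: ip_linear)
  ultimately have "\<forall>r<n. mv n C x r = \<mu> * x r"
    by (simp add: ip_self_eq_0_iff) (simp add: z_def)
  then show ?thesis using x ge by blast
qed

definition eigensystem ::
    "nat \<Rightarrow> (nat \<Rightarrow> nat \<Rightarrow> real) \<Rightarrow> nat \<Rightarrow> (nat \<Rightarrow> nat \<Rightarrow> real) \<Rightarrow> (nat \<Rightarrow> real) \<Rightarrow> bool" where
  "eigensystem n C m v a \<longleftrightarrow> orthonormal n m v \<and> (\<forall>i<m. \<forall>r<n. mv n C (v i) r = a i * v i r) \<and>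
    v 0 = (\<lambda>_. 1 / sqrt n) \<and> a 0 = 0 \<and> (\<forall>i j. i \<le> j \<longrightarrow> j < m \<longrightarrow> a i \<le> a j)"

text \<open>Starting the construction from the constant vector keeps the trivial eigenvalue \<open>0\<close>
  separate even when \<open>0\<close> is a multiple eigenvalue.\<close>

lemma exists_eigensystem:
  assumes sym: "\<And>r c. r < n \<Longrightarrow> c < n \<Longrightarrow> C r c = C c r"
    and nonneg: "\<And>y. ip n y (mv n C y) \<ge> 0"
    and null: "\<And>r. r < n \<Longrightarrow> mv n C (\<lambda>_. 1) r = 0"
  shows "Suc m \<le> n \<Longrightarrow> \<exists>v a. eigensystem n C (Suc m) v a \<and>
    (\<forall>y. (\<forall>i<m. ip n y (v i) = 0) \<longrightarrow> ip n y (mv n C y) \<ge> a m * ip n y y)"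
proof (induction m)
  case 0
  have "ip n (\<lambda>_. 1 / sqrt n) (\<lambda>_. 1 / sqrt n) = 1" using 0 by (simp add: ip_def)
  moreover have "mv n C (\<lambda>_. 1 / sqrt n) r = 0" if "r < n" for r
    using mv_scale[of n C "1 / sqrt n" "\<lambda>_. 1"] null[OF that] by simp
  ultimately show ?case using nonneg
    by (intro exI[of _ "\<lambda>_ _. 1 / sqrt n"] exI[of _ "\<lambda>_. 0"]) (simp add: eigensystem_def orthonormal_def)
next
  case (Suc m)
  from Suc.IH[OF Suc_leD[OF Suc.prems]] obtain v a where es: "eigensystem n C (Suc m) v a"
    and min: "\<forall>y. (\<forall>i<m. ip n y (v i) = 0) \<longrightarrow> ip n y (mv n C y) \<ge> a m * ip n y y"
    by (elim exE conjE)
  have IH: "orthonormal n (Suc m) v" "\<And>i r. i < Suc m \<Longrightarrow> r < n \<Longrightarrow> mv n C (v i) r = a i * v i r"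
    "v 0 = (\<lambda>_. 1 / sqrt n)" "a 0 = 0" "\<And>i j. i \<le> j \<Longrightarrow> j < Suc m \<Longrightarrow> a i \<le> a j"
    using es by (simp_all add: eigensystem_def)
  have "\<exists>x \<mu>. ip n x x = 1 \<and> (\<forall>i<Suc m. ip n x (v i) = 0) \<and> (\<forall>r<n. mv n C x r = \<mu> * x r) \<and>
      (\<forall>y. (\<forall>i<Suc m. ip n y (v i) = 0) \<longrightarrow> ip n y (mv n C y) \<ge> \<mu> * ip n y y)"
    by (rule exists_next_eigenvector[OF sym IH(1) _ IH(2)]) (use Suc.prems in simp_all)
  then obtain x \<mu> where x: "ip n x x = 1" "\<forall>i<Suc m. ip n x (v i) = 0"
    "\<forall>r<n. mv n C x r = \<mu> * x r"
    "\<forall>y. (\<forall>i<Suc m. ip n y (v i) = 0) \<longrightarrow> ip n y (mv n C y) \<ge> \<mu> * ip n y y"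
    by (elim exE conjE)
  \<comment> \<open>The new minimiser was already admissible in the previous, larger minimisation,
    so the eigenvalues are produced in increasing order.\<close>
  have "ip n x (mv n C x) = ip n x (\<lambda>r. \<mu> * x r)" using x(3) by (intro ip_cong) auto
  then have a\<mu>: "a m \<le> \<mu>" using min[rule_format, of x] x(1,2) by (simp add: ip_linear)
  let ?v = "v(Suc m := x)" and ?a = "a(Suc m := \<mu>)"
  have "ip n (v i) x = 0" if "i < Suc m" for i
    using x(2) that by (simp add: ip_commute[of n "v i" x])
  then have "orthonormal n (Suc (Suc m)) ?v"
    using IH(1) x(1,2) by (auto simp: orthonormal_def less_Suc_eq)
  moreover have "\<forall>i<Suc (Suc m). \<forall>r<n. mv n C (?v i) r = ?a i * ?v i r"
    using IH(2) x(3) by (auto simp: less_Suc_eq)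
  moreover have "?a i \<le> ?a j" if "i \<le> j" "j < Suc (Suc m)" for i j
    using that IH(5)[of i m] IH(5)[of i j] a\<mu> by (auto simp: less_Suc_eq)
  ultimately have "eigensystem n C (Suc (Suc m)) ?v ?a" using IH(3,4) by (simp add: eigensystem_def)
  moreover have "\<forall>y. (\<forall>i<Suc m. ip n y (?v i) = 0) \<longrightarrow> ip n y (mv n C y) \<ge> ?a (Suc m) * ip n y y"
    using x(4) by auto
  ultimately show ?case by blast
qed

lemma proots_linear_factors: "proots (\<Prod>a\<leftarrow>xs. [:- a, 1:]) = mset (xs :: real list)"
proof (induction xs)
  case (Cons x xs)
  have "(\<Prod>a\<leftarrow>xs. [:- a, 1:]) \<noteq> 0" by (auto simp: prod_list_zero_iff)
  then have "proots ([:- x, 1:] * (\<Prod>a\<leftarrow>xs. [:- a, 1:])) = {#x#} + mset xs"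
    by (subst proots_mult) (auto simp: Cons)
  then show ?case by (simp del: mult_pCons_left)
qed simp

text \<open>Connects the constructed eigenvectors with \<open>eigs\<close>, which is defined through
  the roots of the characteristic polynomial: the orthogonal matrix \<open>V\<close> makes
  \<open>C\<close> similar to a diagonal matrix, and sorting its diagonal changes nothing because
  the eigenvalues already increase.\<close>

lemma spectral_decomposition:
  assumes n: "n > 0" and C: "C \<in> carrier_mat n n"
    and sym: "\<And>r c. r < n \<Longrightarrow> c < n \<Longrightarrow> C $$ (r,c) = C $$ (c,r)"
    and nonneg: "\<And>y. ip n y (mv n (\<lambda>r c. C $$ (r,c)) y) \<ge> 0"
    and null: "\<And>r. r < n \<Longrightarrow> (\<Sum>c<n. C $$ (r,c)) = 0"
  obtains v a where "orthonormal n n v" "v 0 = (\<lambda>_. 1 / sqrt n)" "a 0 = 0"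
    "\<And>i j. i \<le> j \<Longrightarrow> j < n \<Longrightarrow> a i \<le> a j"
    "\<And>x y. (\<Sum>i<n. ip n (v i) x * ip n (v i) y) = ip n x y"
    "\<And>r c. r < n \<Longrightarrow> c < n \<Longrightarrow> C $$ (r,c) = (\<Sum>i<n. a i * v i r * v i c)"
    "eigs C = map a [0..<n]"
proof -
  let ?C = "\<lambda>r c. C $$ (r,c)"
  from n obtain m where m: "n = Suc m" by (cases n) auto
  have null': "mv n ?C (\<lambda>_. 1) r = 0" if "r < n" for r
    using null[OF that] by (simp add: mv_def)
  have "\<exists>v a. eigensystem n ?C (Suc m) v a \<and>
      (\<forall>y. (\<forall>i<m. ip n y (v i) = 0) \<longrightarrow> ip n y (mv n ?C y) \<ge> a m * ip n y y)"
    by (rule exists_eigensystem[OF sym nonneg null']) (simp_all add: m)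
  then obtain v a where "eigensystem n ?C n v a" using m by auto
  then have o: "orthonormal n n v" and v0: "v 0 = (\<lambda>_. 1 / sqrt n)" "a 0 = 0"
    and eig: "\<And>i r. i < n \<Longrightarrow> r < n \<Longrightarrow> mv n ?C (v i) r = a i * v i r"
    and mono: "\<And>i j. i \<le> j \<Longrightarrow> j < n \<Longrightarrow> a i \<le> a j"
    by (simp_all add: eigensystem_def)
  define V where "V = Matrix.mat n n (\<lambda>(r,i). v i r)"
  define A where "A = Matrix.mat n n (\<lambda>(i,j). if i = j then a i else 0)"
  have cV: "V \<in> carrier_mat n n" "transpose_mat V \<in> carrier_mat n n" and cA: "A \<in> carrier_mat n n"
    by (auto simp: V_def A_def)
  have VV: "transpose_mat V * V = 1\<^sub>m n"
    using o by (intro eq_matI) (auto simp: V_def scalar_prod_def orthonormal_def ip_def atLeast0LessThan)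
  \<comment> \<open>For a square matrix orthonormal columns force orthonormal rows; this is the
    completeness relation behind Parseval's identity.\<close>
  then have VV': "V * transpose_mat V = 1\<^sub>m n"
    using mat_mult_left_right_inverse cV by blast
  have compl: "(\<Sum>i<n. v i r * v i c) = of_bool (r = c)" if "r < n" "c < n" for r c
  proof -
    have "(V * transpose_mat V) $$ (r,c) = (\<Sum>i<n. v i r * v i c)"
      using that by (simp add: V_def scalar_prod_def atLeast0LessThan)
    then show ?thesis using that by (cases "r = c") (simp_all add: VV')
  qed
  have parseval: "(\<Sum>i<n. ip n (v i) x * ip n (v i) y) = ip n x y" for x y
  proof -
    have "(\<Sum>i<n. ip n (v i) x * ip n (v i) y) = (\<Sum>i<n. \<Sum>r<n. \<Sum>c<n. (v i r * x r) * (v i c * y c))"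
      by (simp add: ip_def sum_product)
    also have "\<dots> = (\<Sum>r<n. \<Sum>i<n. \<Sum>c<n. (v i r * x r) * (v i c * y c))" by (rule sum.swap)
    also have "\<dots> = (\<Sum>r<n. \<Sum>c<n. \<Sum>i<n. (v i r * x r) * (v i c * y c))"
      by (rule sum.cong[OF refl], rule sum.swap)
    also have "\<dots> = (\<Sum>r<n. \<Sum>c<n. of_bool (r = c) * (x r * y c))"
    proof (intro sum.cong refl)
      fix r c assume "r \<in> {..<n}" "c \<in> {..<n}"
      have "(\<Sum>i<n. (v i r * x r) * (v i c * y c)) = (\<Sum>i<n. v i r * v i c) * (x r * y c)"
        unfolding sum_distrib_right by (intro sum.cong refl) (simp add: mult_ac)
      then show "(\<Sum>i<n. (v i r * x r) * (v i c * y c)) = of_bool (r = c) * (x r * y c)"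
        using compl \<open>r \<in> {..<n}\<close> \<open>c \<in> {..<n}\<close> by simp
    qed
    also have "\<dots> = (\<Sum>r<n. x r * y r)"
      by (intro sum.cong refl) (simp add: of_bool_def if_distrib[of "\<lambda>u. u * _"] cong: if_cong)
    finally show ?thesis by (simp add: ip_def)
  qed
  have entry: "C $$ (r,c) = (\<Sum>i<n. a i * v i r * v i c)" if "r < n" "c < n" for r c
  proof -
    have "C $$ (r,c) = ip n (?C r) (\<lambda>d. of_bool (d = c))"
      using that by (simp add: ip_delta)
    also have "\<dots> = (\<Sum>i<n. ip n (v i) (?C r) * ip n (v i) (\<lambda>d. of_bool (d = c)))"
      by (simp add: parseval)
    also have "\<dots> = (\<Sum>i<n. mv n ?C (v i) r * v i c)"
      using that by (intro sum.cong refl)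
        (simp add: ip_delta, simp add: ip_def mv_def mult.commute)
    also have "\<dots> = (\<Sum>i<n. a i * v i r * v i c)" using eig that by simp
    finally show ?thesis .
  qed
  have "C = V * A * transpose_mat V"
  proof (rule eq_matI)
    fix r c assume "r < dim_row (V * A * transpose_mat V)" "c < dim_col (V * A * transpose_mat V)"
    then have rc: "r < n" "c < n" by (auto simp: V_def)
    have "(V * A) $$ (r,i) = a i * v i r" if "i < n" for i
      using rc that by (simp add: V_def A_def scalar_prod_def if_distrib cong: if_cong)
    then have "(V * A * transpose_mat V) $$ (r,c) = (\<Sum>i<n. a i * v i r * v i c)"
      using rc cV cA by (simp add: scalar_prod_def atLeast0LessThan V_def del: index_mult_mat(1))
        (subst index_mult_mat(1), auto simp: scalar_prod_def V_def atLeast0LessThan)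
    then show "C $$ (r,c) = (V * A * transpose_mat V) $$ (r,c)" using entry rc by simp
  qed (use C in \<open>auto simp: V_def\<close>)
  then have sim: "similar_mat C A"
    unfolding similar_mat_def using similar_mat_witI[OF VV' VV _ C cA cV] by blast
  have ut: "upper_triangular A" by (simp add: A_def upper_triangular_def)
  have "char_poly C = (\<Prod>a\<leftarrow>diag_mat A. [:- a, 1:])"
    unfolding char_poly_similar[OF sim] by (rule char_poly_upper_triangular[OF cA ut])
  also have "diag_mat A = map a [0..<n]" by (simp add: diag_mat_def A_def)
  finally have "eigs C = sort (map a [0..<n])"
    unfolding eigs_def by (simp only: proots_linear_factors sorted_list_of_multiset_mset)
  also have "\<dots> = map a [0..<n]"
    using mono by (intro sorted_sort_id) (auto simp: sorted_iff_nth_mono)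
  finally have ev: "eigs C = map a [0..<n]" .
  show ?thesis by (rule that[of v a]) (fact o v0 mono parseval entry ev)+
qed

section \<open>Matrices with zero row sums and their spectrum on contrasts\<close>

definition qf :: "nat \<Rightarrow> real Matrix.mat \<Rightarrow> (nat \<Rightarrow> real) \<Rightarrow> real" where
  "qf n C x = ip n x (mv n (\<lambda>r c. C $$ (r,c)) x)"

definition info_like :: "nat \<Rightarrow> real Matrix.mat \<Rightarrow> bool" where
  "info_like n C \<longleftrightarrow> C \<in> carrier_mat n n \<and> (\<forall>r<n. \<forall>c<n. C $$ (r,c) = C $$ (c,r)) \<and>
     (\<forall>y. qf n C y \<ge> 0) \<and> (\<forall>r<n. (\<Sum>c<n. C $$ (r,c)) = 0)"

text \<open>The matrix \<open>\<alpha> (I - J / n) - (\<alpha> - \<delta>) e e'\<close>. For a unit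
  contrast \<open>e\<close> it has eigenvalue \<delta> at \<open>e\<close>, \<alpha> on the
  contrasts orthogonal to \<open>e\<close>, and 0 on constant vectors.\<close>

definition two_point :: "nat \<Rightarrow> real \<Rightarrow> real \<Rightarrow> (nat \<Rightarrow> real) \<Rightarrow> real Matrix.mat \<Rightarrow> bool" where
  "two_point n \<alpha> \<delta> e C \<longleftrightarrow> (\<forall>r<n. \<forall>c<n.
     C $$ (r,c) = \<alpha> * (of_bool (r = c) - 1 / n) - (\<alpha> - \<delta>) * e r * e c)"

text \<open>The constant eigenvector carries the first entry of the sorted spectrum, so
  \<open>tl (eigs C)\<close> lists the eigenvalues on contrasts. A contrast has no component along
  it, and Parseval survives with \<open>n - 1\<close> terms.\<close>

lemma contrast_spectrum:
  assumes n: "n \<ge> 2" and C: "info_like n C"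
  obtains w b where
    "\<And>i. i < n - 1 \<Longrightarrow> ip n (w i) (w i) = 1"
    "\<And>i. i < n - 1 \<Longrightarrow> ip n (w i) (\<lambda>_. 1) = 0"
    "\<And>x. ip n x (\<lambda>_. 1) = 0 \<Longrightarrow> (\<Sum>i<n-1. (ip n (w i) x)\<^sup>2) = ip n x x"
    "\<And>i. i < n - 1 \<Longrightarrow> 0 \<le> b i" "\<And>i. i < n - 1 \<Longrightarrow> b 0 \<le> b i"
    "tl (eigs C) = map b [0..<n-1]"
    "mtrace C = (\<Sum>i<n-1. b i)"
    "\<And>x. qf n C x = (\<Sum>i<n-1. b i * (ip n (w i) x)\<^sup>2)"
    "\<And>i r. i < n - 1 \<Longrightarrow> r < n \<Longrightarrow> mv n (\<lambda>r c. C $$ (r,c)) (w i) r = b i * w i r"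
proof -
  from n obtain N where N: "n = Suc N" by (cases n) auto
  obtain v a where v: "orthonormal n n v" "v 0 = (\<lambda>_. 1 / sqrt n)" "a 0 = 0"
    and mono: "\<And>i j. i \<le> j \<Longrightarrow> j < n \<Longrightarrow> a i \<le> a j"
    and parseval: "\<And>x y. (\<Sum>i<n. ip n (v i) x * ip n (v i) y) = ip n x y"
    and entry: "\<And>r c. r < n \<Longrightarrow> c < n \<Longrightarrow> C $$ (r,c) = (\<Sum>i<n. a i * v i r * v i c)"
    and ev: "eigs C = map a [0..<n]"
    by (rule spectral_decomposition[of n C]) (use C n in \<open>auto simp: info_like_def qf_def\<close>)
  let ?w = "\<lambda>i. v (Suc i)" and ?b = "\<lambda>i. a (Suc i)"
  have one: "ip n x (\<lambda>_. 1) = sqrt n * ip n x (v 0)" for x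
    using n by (simp add: v(2) ip_def sum_distrib_left)
  have w1: "ip n (?w i) (\<lambda>_. 1) = 0" if "i < n - 1" for i
    using v(1) that by (simp add: one orthonormal_def)
  have pars: "(\<Sum>i<n-1. (ip n (?w i) x)\<^sup>2) = ip n x x" if "ip n x (\<lambda>_. 1) = 0" for x
  proof -
    have "ip n (v 0) x = 0" using that n by (simp add: one ip_commute[of n "v 0" x])
    then show ?thesis
      using parseval[of x x] unfolding N sum.lessThan_Suc_shift by (simp add: power2_eq_square)
  qed
  have mvw: "mv n (\<lambda>r c. C $$ (r,c)) x r = (\<Sum>i<n-1. ?b i * v (Suc i) r * ip n (?w i) x)" if "r < n" for x r
  proof -
    have "mv n (\<lambda>r c. C $$ (r,c)) x r = (\<Sum>c<n. \<Sum>i<n. a i * v i r * (v i c * x c))"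
      unfolding mv_def using that by (intro sum.cong) (simp_all add: entry sum_distrib_right mult.assoc)
    also have "\<dots> = (\<Sum>i<n. a i * v i r * ip n (v i) x)"
      by (subst sum.swap) (simp add: ip_def sum_distrib_left)
    also have "\<dots> = (\<Sum>i<n-1. ?b i * v (Suc i) r * ip n (?w i) x)"
      using v(3) unfolding N sum.lessThan_Suc_shift by simp
    finally show ?thesis .
  qed
  have qfw: "qf n C x = (\<Sum>i<n-1. ?b i * (ip n (?w i) x)\<^sup>2)" for x
  proof -
    have "qf n C x = ip n x (\<lambda>r. \<Sum>i<n-1. ?b i * ip n (?w i) x * v (Suc i) r)"
      unfolding qf_def by (intro ip_cong) (auto simp: mvw mult_ac)
    also have "\<dots> = (\<Sum>i<n-1. ?b i * (ip n (?w i) x)\<^sup>2)"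
      by (simp add: ip_linear ip_commute[of n x] power2_eq_square mult.assoc)
    finally show ?thesis .
  qed
  have eig: "mv n (\<lambda>r c. C $$ (r,c)) (?w j) r = ?b j * ?w j r" if "j < n - 1" "r < n" for j r
  proof -
    have "(\<Sum>i<n-1. ?b i * v (Suc i) r * ip n (?w i) (?w j)) = (\<Sum>i<n-1. ?b i * v (Suc i) r * of_bool (i = j))"
      using v(1) that by (intro sum.cong) (auto simp: orthonormal_def)
    then show ?thesis using that by (simp add: mvw)
  qed
  have "mtrace C = (\<Sum>r<n. \<Sum>i<n. a i * (v i r * v i r))"
    unfolding mtrace_def using C entry by (intro sum.cong) (auto simp: info_like_def mult.assoc)
  also have "\<dots> = (\<Sum>i<n. a i * ip n (v i) (v i))"
    by (subst sum.swap) (simp add: ip_def sum_distrib_left)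
  also have "\<dots> = (\<Sum>i<n. a i)" using v(1) by (simp add: orthonormal_def)
  also have "\<dots> = (\<Sum>i<n-1. ?b i)"
    using v(3) unfolding N sum.lessThan_Suc_shift by simp
  finally have tr: "mtrace C = (\<Sum>i<n-1. ?b i)" .
  have "tl (eigs C) = map ?b [0..<n-1]"
    unfolding ev N by (simp add: upt_conv_Cons map_Suc_upt[symmetric] del: upt_Suc)
  then show ?thesis
    using v(1) w1 pars mono[of 0] mono[of "Suc 0"] v(3) tr qfw eig n
    by (intro that[of ?w ?b]) (auto simp: orthonormal_def)
qed

text \<open>For \<open>b\<^sub>0, \<dots>\<close> the eigenvalues on contrasts, \<open>h\<^sub>i\<close> is the squared cosine between the
  \<open>i\<close>-th eigenvector and the fixed direction \<open>e\<close>.\<close>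

lemma contrast_weights:
  assumes n: "n \<ge> 2" and C: "info_like n C" and e: "ip n e e = 1" "ip n e (\<lambda>_. 1) = 0"
  obtains h b where
    "\<And>i. i < n - 1 \<Longrightarrow> 0 \<le> h i" "\<And>i. i < n - 1 \<Longrightarrow> h i \<le> 1" "(\<Sum>i<n-1. h i) = (1::real)"
    "\<And>i. i < n - 1 \<Longrightarrow> (0::real) \<le> b i" "\<And>i. i < n - 1 \<Longrightarrow> b 0 \<le> b i"
    "tl (eigs C) = map b [0..<n-1]"
    "mtrace C = (\<Sum>i<n-1. b i)" "qf n C e = (\<Sum>i<n-1. h i * b i)"
    "\<And>\<alpha> \<delta> i. two_point n \<alpha> \<delta> e C \<Longrightarrow> i < n - 1 \<Longrightarrow>
       h i = 0 \<and> b i = \<alpha> \<or> b i = \<delta> \<and> (h i = 1 \<or> \<alpha> = \<delta>)"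
proof (rule contrast_spectrum[OF n C])
  fix w b
  assume w: "\<And>i. i < n - 1 \<Longrightarrow> ip n (w i) (w i) = 1"
    "\<And>i. i < n - 1 \<Longrightarrow> ip n (w i) (\<lambda>_. 1) = 0"
    "\<And>x. ip n x (\<lambda>_. 1) = 0 \<Longrightarrow> (\<Sum>i<n-1. (ip n (w i) x)\<^sup>2) = ip n x x"
    and b: "\<And>i. i < n - 1 \<Longrightarrow> 0 \<le> b i" "\<And>i. i < n - 1 \<Longrightarrow> b 0 \<le> b i"
    "tl (eigs C) = map b [0..<n-1]" "mtrace C = (\<Sum>i<n-1. b i)"
    and qf: "\<And>x. qf n C x = (\<Sum>i<n-1. b i * (ip n (w i) x)\<^sup>2)"
    and eig: "\<And>i r. i < n - 1 \<Longrightarrow> r < n \<Longrightarrow> mv n (\<lambda>r c. C $$ (r,c)) (w i) r = b i * w i r"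
  define h where "h i = (ip n (w i) e)\<^sup>2" for i
  have sum_h: "(\<Sum>i<n-1. h i) = 1" unfolding h_def using w(3)[OF e(2)] e(1) by simp
  have le1: "h i \<le> 1" if "i < n - 1" for i
    unfolding sum_h[symmetric] using that by (intro member_le_sum) (auto simp: h_def)
  \<comment> \<open>If \<open>\<alpha> = \<delta>\<close>, the matrix does not determine its
    eigenvectors and \<open>h i\<close> may be fractional; hence the last alternative.\<close>
  have two: "h i = 0 \<and> b i = \<alpha> \<or> b i = \<delta> \<and> (h i = 1 \<or> \<alpha> = \<delta>)"
    if tp: "two_point n \<alpha> \<delta> e C" and i: "i < n - 1" for \<alpha> \<delta> i
  proof -
    have ent: "C $$ (r,c) = \<alpha> * (of_bool (r = c) - 1 / n) - (\<alpha> - \<delta>) * e r * e c" if "r < n" "c < n" for r c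
      using tp that by (simp add: two_point_def)
    let ?p = "ip n (w i) e"
    \<comment> \<open>The eigenvalue equation for the explicit matrix. Pairing it with
      \<open>w i\<close> and with \<open>e\<close> gives the two scalar relations
      \<open>b_eq\<close> and \<open>p_eq\<close>, which leave only the listed alternatives.\<close>
    have eq: "\<alpha> * w i r - (\<alpha> - \<delta>) * ?p * e r = b i * w i r" if r: "r < n" for r
    proof -
      have "mv n (\<lambda>r c. C $$ (r,c)) (w i) r = (\<Sum>c<n. \<alpha> * (w i c * of_bool (c = r))
          - \<alpha> / n * (w i c * 1) - (\<alpha> - \<delta>) * e r * (w i c * e c))"
        unfolding mv_def using r by (intro sum.cong) (auto simp: ent algebra_simps)
      also have "\<dots> = \<alpha> * w i r - \<alpha> / n * ip n (w i) (\<lambda>_. 1) - (\<alpha> - \<delta>) * e r * ?p"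
        using r by (simp add: sum_subtractf sum_distrib_left[symmetric] sum_divide_distrib[symmetric] ip_def)
      finally show ?thesis using eig[OF i r] w(2)[OF i] by (simp add: algebra_simps)
    qed
    have "ip n (\<lambda>r. \<alpha> * w i r - (\<alpha> - \<delta>) * ?p * e r) y = ip n (\<lambda>r. b i * w i r) y" for y
      using eq by (intro ip_cong) auto
    then have eq': "\<alpha> * ip n (w i) y - (\<alpha> - \<delta>) * ?p * ip n e y = b i * ip n (w i) y" for y
      by (simp add: ip_linear)
    have b_eq: "\<alpha> - (\<alpha> - \<delta>) * h i = b i"
      using eq'[of "w i"] w(1)[OF i] by (simp add: h_def power2_eq_square ip_commute[of n e])
    have p_eq: "\<delta> * ?p = b i * ?p"
      using eq'[of e] e(1) by (simp add: algebra_simps)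
    show ?thesis
    proof (cases "?p = 0")
      case True
      then show ?thesis using b_eq by (simp add: h_def)
    next
      case False
      then have "\<delta> = b i" using p_eq by simp
      then have "(\<alpha> - \<delta>) * (1 - h i) = 0" using b_eq by (simp add: algebra_simps)
      then show ?thesis using \<open>\<delta> = b i\<close> by auto
    qed
  qed
  show thesis
    by (rule that[of h b]) (use sum_h le1 b two in \<open>simp_all add: qf h_def mult.commute\<close>)
qed

section \<open>Criteria and their tangent bounds\<close>

text \<open>Concavity of the logarithm, obtained from its tangent \<open>ln z \<le> z - 1\<close> at
  the ratios to the weighted mean.\<close>

lemma ln_weighted_mean_ge:
  fixes h x y :: real
  assumes h: "0 \<le> h" "h \<le> 1" and pos: "0 < x" "0 < y"
  shows "ln (h * x + (1 - h) * y) \<ge> h * ln x + (1 - h) * ln y"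
proof -
  let ?m = "h * x + (1 - h) * y"
  have m: "?m > 0"
    using h pos by (cases "h = 0") (auto intro!: add_pos_nonneg)
  have "h * ln (x / ?m) + (1 - h) * ln (y / ?m) \<le> h * (x / ?m - 1) + (1 - h) * (y / ?m - 1)"
    using h m pos by (intro add_mono mult_left_mono ln_le_minus_one) auto
  also have "\<dots> = ?m / ?m - 1" using m by (simp add: divide_simps) (simp add: algebra_simps)
  also have "\<dots> = 0" using m by simp
  finally show ?thesis using m pos by (simp add: ln_div algebra_simps)
qed

text \<open>The arithmetic-geometric mean inequality in logarithmic form, again from the tangent of
  \<open>ln\<close> at the mean.\<close>

lemma sum_ln_le_ln_mean:
  fixes u :: "'a \<Rightarrow> real"
  assumes "finite I" "I \<noteq> {}" and pos: "\<And>i. i \<in> I \<Longrightarrow> 0 < u i"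
  shows "(\<Sum>i\<in>I. ln (u i)) \<le> card I * ln ((\<Sum>i\<in>I. u i) / card I)"
proof -
  define X where "X = (\<Sum>i\<in>I. u i) / card I"
  have N: "real (card I) > 0" using assms by (simp add: card_gt_0_iff)
  have X: "X > 0" unfolding X_def using assms N by (intro divide_pos_pos sum_pos) auto
  have "(\<Sum>i\<in>I. ln (u i)) \<le> (\<Sum>i\<in>I. ln X + (u i / X - 1))"
  proof (rule sum_mono)
    fix i assume "i \<in> I"
    then have "ln (u i / X) \<le> u i / X - 1" using pos X by (intro ln_le_minus_one) auto
    then show "ln (u i) \<le> ln X + (u i / X - 1)" using pos[OF \<open>i \<in> I\<close>] X by (simp add: ln_div)
  qed
  also have "\<dots> = card I * ln X + ((\<Sum>i\<in>I. u i) / X - card I)"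
    by (simp add: sum.distrib sum_subtractf sum_divide_distrib)
  also have "(\<Sum>i\<in>I. u i) / X = card I" using X N by (simp add: X_def field_simps)
  finally show ?thesis by (simp add: X_def)
qed

lemma weighted_sum_split:
  fixes h b :: "nat \<Rightarrow> real"
  shows "(\<Sum>i<N. b i * (h i * x + (1 - h i) * y)) = x * (\<Sum>i<N. h i * b i) + y * ((\<Sum>i<N. b i) - (\<Sum>i<N. h i * b i))"
  by (simp add: algebra_simps sum.distrib sum_subtractf sum_distrib_left)

section \<open>Upper bounds for the four criteria at a general information matrix\<close>

context
  fixes n :: nat and C :: "real Matrix.mat" and e :: "nat \<Rightarrow> real" and \<alpha> \<delta> :: real
  assumes n: "n \<ge> 2" and C: "info_like n C" and e: "ip n e e = 1" "ip n e (\<lambda>_. 1) = 0"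
begin

lemma PhiT_eq: "PhiT n C = mtrace C / (real n - 1)"
proof (rule contrast_spectrum[OF n C], goal_cases)
  case (1 w b)
  then show ?case by (simp add: PhiT_def)
qed

text \<open>The quadratic form at \<open>e\<close> is the \<open>h\<close>-average of the
  eigenvalues, hence at least the smallest of them.\<close>

lemma PhiE_le: "PhiE n C \<le> qf n C e"
proof (rule contrast_weights[OF n C e], goal_cases)
  case (1 h b)
  have "PhiE n C = (\<Sum>i<n-1. h i * b 0)"
    using 1(3,6) n by (simp add: PhiE_def sum_distrib_right[symmetric])
  also have "\<dots> \<le> (\<Sum>i<n-1. h i * b i)" using 1 by (intro sum_mono mult_left_mono) auto
  finally show ?case using 1(8) by simp
qed

lemma qf_le_mtrace: "qf n C e \<le> mtrace C"
proof (rule contrast_weights[OF n C e], goal_cases)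
  case (1 h b)
  have "(\<Sum>i<n-1. h i * b i) \<le> (\<Sum>i<n-1. b i)"
    using 1 by (intro sum_mono mult_left_le_one_le) auto
  then show ?case using 1 by simp
qed

lemma qf_e_nonneg: "0 \<le> qf n C e"
  using C by (simp add: info_like_def)

text \<open>Cauchy--Schwarz: the harmonic mean lies below its tangent at the spectrum
  \<open>\<delta>, \<alpha>, \<dots>, \<alpha>\<close>; convexity of the square passes to the weights \<open>h\<close>.\<close>

lemma PhiA_le:
  assumes pos: "0 < \<delta>" "0 < \<alpha>"
  shows "PhiA n C \<le> (real n - 1) * (qf n C e / \<delta>\<^sup>2 + (mtrace C - qf n C e) / \<alpha>\<^sup>2) / (1 / \<delta> + (real n - 2) / \<alpha>)\<^sup>2"
    (is "_ \<le> ?R")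
proof (rule contrast_weights[OF n C e], goal_cases)
  case (1 h b)
  define W where "W = 1 / \<delta> + (real n - 2) / \<alpha>"
  have W: "W > 0" unfolding W_def using pos n by (intro add_pos_nonneg) auto
  show ?case
  proof (cases "b 0 = 0")
    case True
    \<comment> \<open>By its convention \<open>PhiA\<close> vanishes on a matrix singular on
      contrasts, so here the bound only has to be nonnegative.\<close>
    then have "PhiA n C = 0" using 1(6) n by (simp add: PhiA_def)
    moreover have "?R \<ge> 0"
      using pos n qf_le_mtrace qf_e_nonneg
      by (intro divide_nonneg_nonneg mult_nonneg_nonneg add_nonneg_nonneg) auto
    ultimately show ?thesis by simp
  next
    case False
    have b: "b i > 0" if "i < n - 1" for i
      using 1(4)[of 0] 1(5)[OF that] False n by auto
    define S where "S = (\<Sum>i<n-1. inverse (b i))"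
    have S: "S > 0" unfolding S_def using b n by (intro sum_pos) (auto simp: lessThan_empty_iff)
    have PhiA: "PhiA n C = (real n - 1) / S"
      using 1(6) n False by (simp add: PhiA_def S_def)
    \<comment> \<open>The Cauchy-Schwarz multipliers. The reciprocals of \<delta> and \<alpha> are
      interpolated with weight \<open>h i\<close>; since the \<open>h i\<close> sum to 1, the
      multipliers sum to the reciprocal sum \<open>W\<close> of the reference spectrum.\<close>
    define v where "v i = h i * (1 / \<delta>) + (1 - h i) * (1 / \<alpha>)" for i
    have "W = (\<Sum>i<n-1. v i)"
      using 1(3) n by (simp add: W_def v_def sum.distrib sum_subtractf sum_divide_distrib[symmetric] diff_divide_distrib algebra_simps)
    also have "\<dots> = (\<Sum>i<n-1. (sqrt (b i) * v i) * sqrt (inverse (b i)))"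
    proof (intro sum.cong refl)
      fix i assume "i \<in> {..<n-1}"
      then have "sqrt (b i) * sqrt (inverse (b i)) = 1"
        using b[of i] by (simp add: real_sqrt_mult[symmetric])
      then show "v i = (sqrt (b i) * v i) * sqrt (inverse (b i))"
        by (metis mult.assoc mult.commute mult.right_neutral)
    qed
    finally have "W\<^sup>2 \<le> (\<Sum>i<n-1. (sqrt (b i) * v i)\<^sup>2) * (\<Sum>i<n-1. (sqrt (inverse (b i)))\<^sup>2)"
      using Cauchy_Schwarz_ineq_sum by metis
    also have "(\<Sum>i<n-1. (sqrt (inverse (b i)))\<^sup>2) = S"
      unfolding S_def using b by (intro sum.cong) (auto simp: less_imp_le)
    also have "(\<Sum>i<n-1. (sqrt (b i) * v i)\<^sup>2) \<le> (\<Sum>i<n-1. b i * (h i * (1 / \<delta>\<^sup>2) + (1 - h i) * (1 / \<alpha>\<^sup>2)))"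
    proof (intro sum_mono)
      fix i assume i: "i \<in> {..<n-1}"
      have variance: "c * x\<^sup>2 + (1 - c) * y\<^sup>2 - (c * x + (1 - c) * y)\<^sup>2 = c * (1 - c) * (x - y)\<^sup>2" for c x y :: real
        by (simp add: power2_eq_square algebra_simps)
      have "h i * (1 / \<delta>\<^sup>2) + (1 - h i) * (1 / \<alpha>\<^sup>2) - (v i)\<^sup>2 = h i * (1 - h i) * (1 / \<delta> - 1 / \<alpha>)\<^sup>2"
        unfolding v_def by (simp only: variance power_one_over[symmetric])
      moreover have "\<dots> \<ge> 0" using 1(1,2) i by simp
      ultimately have "(v i)\<^sup>2 \<le> h i * (1 / \<delta>\<^sup>2) + (1 - h i) * (1 / \<alpha>\<^sup>2)" by linarith
      then show "(sqrt (b i) * v i)\<^sup>2 \<le> b i * (h i * (1 / \<delta>\<^sup>2) + (1 - h i) * (1 / \<alpha>\<^sup>2))"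
        using b i by (simp add: power_mult_distrib less_imp_le)
    qed
    also have "\<dots> = qf n C e / \<delta>\<^sup>2 + (mtrace C - qf n C e) / \<alpha>\<^sup>2"
      unfolding weighted_sum_split by (simp add: 1(7,8))
    finally have "W\<^sup>2 \<le> (qf n C e / \<delta>\<^sup>2 + (mtrace C - qf n C e) / \<alpha>\<^sup>2) * S"
      using S by (simp add: mult_right_mono)
    then have "1 / S \<le> (qf n C e / \<delta>\<^sup>2 + (mtrace C - qf n C e) / \<alpha>\<^sup>2) / W\<^sup>2"
      using S W by (simp add: field_simps)
    from mult_left_mono[OF this, of "real n - 1"] show ?thesis
      using n by (simp add: PhiA W_def)
  qed
qed

text \<open>The eigenvalues \<open>b i\<close> are rescaled by \<open>v i\<close>, an interpolation
  of \<open>1 / \<delta>\<close> and \<open>1 / \<alpha>\<close> with weight \<open>h i\<close>. The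
  arithmetic-geometric mean inequality for \<open>b i * v i\<close> produces the linear factor, and
  concavity of \<open>ln\<close> bounds the product of the \<open>1 / v i\<close> by
  \<open>\<delta> * \<alpha> ^ (n - 2)\<close>.\<close>

lemma PhiD_le:
  assumes pos: "0 < \<delta>" "0 < \<alpha>"
  shows "PhiD n C \<le> (qf n C e / \<delta> + (mtrace C - qf n C e) / \<alpha>) / (real n - 1) * (\<delta> * \<alpha> ^ (n - 2)) powr (1 / (real n - 1))"
    (is "_ \<le> ?R")
proof (rule contrast_weights[OF n C e], goal_cases)
  case (1 h b)
  let ?N = "real n - 1"
  have N: "?N > 0" "card {..<n-1} = n - 1" "real (n - 1) = ?N" "{..<n-1} \<noteq> {}"
    using n by (auto simp: lessThan_empty_iff)
  have PhiD: "PhiD n C = (\<Prod>i<n-1. b i) powr (1 / ?N)"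
    using 1(6) n by (simp add: PhiD_def)
  show ?case
  proof (cases "\<exists>i<n-1. b i = 0")
    case True
    then have "(\<Prod>i<n-1. b i) = 0" by auto
    then have "PhiD n C = 0" by (simp only: PhiD) simp
    moreover have "?R \<ge> 0"
      using pos n qf_le_mtrace qf_e_nonneg
      by (intro divide_nonneg_nonneg mult_nonneg_nonneg add_nonneg_nonneg) auto
    ultimately show ?thesis by (simp only:)
  next
    case False
    then have b: "b i > 0" if "i < n - 1" for i
      using 1(4)[OF that] that by (metis order_le_less)
    define v where "v i = h i * (1 / \<delta>) + (1 - h i) * (1 / \<alpha>)" for i
    define X where "X = (qf n C e / \<delta> + (mtrace C - qf n C e) / \<alpha>) / ?N"
    have v: "v i > 0" if "i < n - 1" for i
      unfolding v_def using 1(1)[OF that] 1(2)[OF that] pos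
      by (cases "h i = 0") (auto intro!: add_pos_nonneg)
    have lnv: "- ln (v i) \<le> h i * ln \<delta> + (1 - h i) * ln \<alpha>" if "i < n - 1" for i
      using ln_weighted_mean_ge[of "h i" "1 / \<delta>" "1 / \<alpha>"] 1(1)[OF that] 1(2)[OF that] pos
      by (simp add: v_def ln_div)
    have sumX: "(\<Sum>i<n-1. b i * v i) / card {..<n-1} = X"
      unfolding v_def weighted_sum_split unfolding X_def N(2,3) 1(7,8) by simp
    have "(\<Sum>i<n-1. b i * v i) > 0"
      using b v N by (intro sum_pos) auto
    then have X: "X > 0" using sumX N n by (metis divide_pos_pos of_nat_0_less_iff card_gt_0_iff finite_lessThan)
    have "ln (\<Prod>i<n-1. b i) = (\<Sum>i<n-1. ln (b i))"
      using b by (intro ln_prod finite_lessThan) (metis lessThan_iff less_irrefl)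
    also have "\<dots> = (\<Sum>i<n-1. ln (b i * v i) + - ln (v i))"
      using b v by (intro sum.cong) (auto simp: ln_mult_pos)
    also have "\<dots> \<le> (\<Sum>i<n-1. ln (b i * v i)) + (\<Sum>i<n-1. h i * ln \<delta> + (1 - h i) * ln \<alpha>)"
      unfolding sum.distrib[of "\<lambda>i. ln (b i * v i)"] using lnv by (intro add_mono sum_mono) auto
    also have "(\<Sum>i<n-1. ln (b i * v i)) \<le> ?N * ln X"
      using sum_ln_le_ln_mean[of "{..<n-1}" "\<lambda>i. b i * v i"] b v N unfolding sumX by auto
    also have "(\<Sum>i<n-1. h i * ln \<delta> + (1 - h i) * ln \<alpha>) = ln \<delta> + (real n - 2) * ln \<alpha>"
      using 1(3) n by (simp add: sum.distrib sum_subtractf sum_distrib_right[symmetric] of_nat_diff)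
    also have "\<dots> = ln (\<delta> * \<alpha> ^ (n - 2))"
      using pos n by (simp add: ln_mult_pos ln_realpow)
    finally have le: "ln (\<Prod>i<n-1. b i) \<le> ?N * ln X + ln (\<delta> * \<alpha> ^ (n - 2))" by simp
    have "1 / ?N * ln (\<Prod>i<n-1. b i) \<le> 1 / ?N * (?N * ln X + ln (\<delta> * \<alpha> ^ (n - 2)))"
      using le N(1) by (intro mult_left_mono) auto
    also have "\<dots> = ln X + 1 / ?N * ln (\<delta> * \<alpha> ^ (n - 2))"
      using N(1) by (simp add: distrib_left)
    finally have "1 / ?N * ln (\<Prod>i<n-1. b i) \<le> ln X + 1 / ?N * ln (\<delta> * \<alpha> ^ (n - 2))" .
    then have "exp (1 / ?N * ln (\<Prod>i<n-1. b i)) \<le> exp (ln X) * exp (1 / ?N * ln (\<delta> * \<alpha> ^ (n - 2)))"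
      by (simp add: exp_add[symmetric])
    moreover have "(\<Prod>i<n-1. b i) > 0" using b by (intro prod_pos) auto
    moreover have "\<delta> * \<alpha> ^ (n - 2) > 0" using pos by simp
    moreover have "x powr y = exp (y * ln x)" if "x > 0" for x y :: real
      using that by (simp add: powr_def)
    ultimately show ?thesis using exp_ln[OF X] unfolding PhiD X_def[symmetric] by (simp only:)
  qed
qed

section \<open>Exact values of the criteria at a two-point spectrum\<close>

context
  assumes pos: "0 < \<delta>" "\<delta> \<le> \<alpha>"
    and tp: "two_point n \<alpha> \<delta> e C"
begin

text \<open>In each alternative of \<open>contrast_weights\<close> one has
  \<open>F (b i) = h i * F \<delta> + (1 - h i) * F \<alpha>\<close>. Summation gives the
  multiplicities 1 and \<open>n - 2\<close> without deciding which index carries \<delta>, also when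
  \<open>\<alpha> = \<delta>\<close>.\<close>

lemma two_point_spectrum:
  obtains b where "tl (eigs C) = map b [0..<n-1]" "b 0 = \<delta>" "\<And>i. i < n - 1 \<Longrightarrow> b i > 0"
    "\<And>F :: real \<Rightarrow> real. (\<Sum>i<n-1. F (b i)) = F \<delta> + (real n - 2) * F \<alpha>"
proof (rule contrast_weights[OF n C e], goal_cases)
  case (1 h b)
  have cases: "h i = 0 \<and> b i = \<alpha> \<or> b i = \<delta> \<and> (h i = 1 \<or> \<alpha> = \<delta>)" if "i < n - 1" for i
    using 1(10)[OF tp that] by simp
  have F: "(\<Sum>i<n-1. F (b i)) = F \<delta> + (real n - 2) * F \<alpha>" for F :: "real \<Rightarrow> real"
  proof -
    have "(\<Sum>i<n-1. F (b i)) = (\<Sum>i<n-1. h i * F \<delta> + (1 - h i) * F \<alpha>)"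
    proof (intro sum.cong refl)
      fix i assume "i \<in> {..<n-1}"
      then show "F (b i) = h i * F \<delta> + (1 - h i) * F \<alpha>"
        using cases[of i] by (auto simp: algebra_simps)
    qed
    also have "\<dots> = F \<delta> + (real n - 2) * F \<alpha>"
      using 1(4) n by (simp add: sum.distrib sum_subtractf sum_distrib_right[symmetric] of_nat_diff)
    finally show ?thesis .
  qed
  have ge: "b i \<ge> \<delta>" if "i < n - 1" for i using cases[OF that] pos by auto
  \<comment> \<open>The weights are supported where \<open>b i = \<delta>\<close>, so the
    \<open>h\<close>-average of the spectrum is \<delta>. The smallest eigenvalue is at most this
    average, and no eigenvalue is below \<delta>.\<close>
  have "b 0 = (\<Sum>i<n-1. h i * b 0)" using 1(4) by (simp add: sum_distrib_right[symmetric])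
  also have "\<dots> \<le> (\<Sum>i<n-1. h i * b i)" using 1(2,6) by (intro sum_mono mult_left_mono) auto
  also have "\<dots> = (\<Sum>i<n-1. h i * \<delta>)" using cases by (intro sum.cong refl) auto
  also have "\<dots> = \<delta>" using 1(4) by (simp add: sum_distrib_right[symmetric])
  finally have "b 0 = \<delta>" using ge[of 0] n by simp
  then show ?case using 1(1)[of b] 1(7) F ge pos by (simp add: less_le_trans)
qed

lemma PhiE_eq: "PhiE n C = \<delta>"
proof (rule two_point_spectrum, goal_cases)
  case (1 b)
  then show ?case using n by (simp add: PhiE_def)
qed

lemma PhiA_eq: "PhiA n C = (real n - 1) / (1 / \<delta> + (real n - 2) / \<alpha>)"
proof (rule two_point_spectrum, goal_cases)
  case (1 b)
  then show ?case using n pos 1(4)[of inverse] by (simp add: PhiA_def divide_inverse)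
qed

lemma PhiT_two_point: "PhiT n C = (\<delta> + (real n - 2) * \<alpha>) / (real n - 1)"
proof (rule two_point_spectrum, goal_cases)
  case (1 b)
  then show ?case using n 1(4)[of id] by (simp add: PhiT_def)
qed

lemma PhiD_eq: "PhiD n C = (\<delta> * \<alpha> ^ (n - 2)) powr (1 / (real n - 1))"
proof (rule two_point_spectrum, goal_cases)
  case (1 b)
  have "(\<Prod>i<n-1. b i) = exp (\<Sum>i<n-1. ln (b i))"
    using 1(3) by (simp add: exp_sum)
  also have "\<dots> = exp (ln (\<delta> * \<alpha> ^ (n - 2)))"
    unfolding 1(4)[of ln] using pos n by (simp add: ln_mult_pos ln_realpow)
  also have "\<dots> = \<delta> * \<alpha> ^ (n - 2)" using pos by simp
  finally show ?case using n 1(1) by (simp add: PhiD_def)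
qed

end

end

section \<open>Permutation invariance\<close>

text \<open>Invariance under transpositions leaves one diagonal and one off-diagonal value. The zero
  row sums tie the second to the first, so the trace determines the matrix.\<close>

lemma permutation_invariant_centred:
  fixes M :: "nat \<Rightarrow> nat \<Rightarrow> real"
  assumes n: "n \<ge> 2"
    and inv: "\<And>\<tau> a b. \<tau> permutes {..<n} \<Longrightarrow> a < n \<Longrightarrow> b < n \<Longrightarrow> M (\<tau> a) (\<tau> b) = M a b"
    and rows: "\<And>a. a < n \<Longrightarrow> (\<Sum>b<n. M a b) = 0"
    and ab: "a < n" "b < n"
  shows "M a b = (\<Sum>c<n. M c c) / (real n - 1) * (of_bool (a = b) - 1 / n)"
proof -
  have diag: "M c c = M a a" if "c < n" for c
    using inv[of "Transposition.transpose a c" a a] ab that by (simp add: permutes_swap_id)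
  have off: "M a c = M a d" if "c < n" "d < n" "c \<noteq> a" "d \<noteq> a" for c d
    using inv[of "Transposition.transpose c d" a c] ab that by (simp add: permutes_swap_id transpose_eq_iff)
  have tr: "(\<Sum>c<n. M c c) = n * M a a" using diag by simp
  show ?thesis
  proof (cases "a = b")
    case True
    then show ?thesis using n unfolding tr by (simp add: field_simps)
  next
    case False
    have "0 = M a a + (\<Sum>c\<in>{..<n} - {a}. M a c)"
      using rows[OF ab(1)] sum.remove[of "{..<n}" a "M a"] ab by simp
    also have "(\<Sum>c\<in>{..<n} - {a}. M a c) = (\<Sum>c\<in>{..<n} - {a}. M a b)"
    proof (rule sum.cong[OF refl])
      fix c assume "c \<in> {..<n} - {a}"
      then show "M a c = M a b" using off[of c b] ab False by blast
    qed
    also have "\<dots> = (real n - 1) * M a b"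
      using ab n by (simp add: of_nat_diff)
    finally show ?thesis using n False unfolding tr by (simp add: field_simps)
  qed
qed

lemma Tset_ip: "x \<in> Tset t \<Longrightarrow> ip t x x > 0 \<and> ip t x (\<lambda>_. 1) = 0"
  using ip_self_nonneg[of t x] ip_self_eq_0_iff[of t x]
  by (auto simp: Tset_def order_less_le) (simp add: ip_def)

lemma coord_borel_measurable:
  assumes "sets g = sets (borel :: (nat \<Rightarrow> real) measure)"
  shows "(\<lambda>x. x i) \<in> borel_measurable g"
  unfolding measurable_cong_sets[OF assms refl]
  by (rule borel_measurable_continuous_onI[OF continuous_on_coord])

section \<open>Second moments of the direction of an exchangeable contrast\<close>

context
  fixes t :: nat and g :: "(nat \<Rightarrow> real) measure"
  assumes t: "t \<ge> 2" and g: "exchangeable t g"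
begin

interpretation prob_space g using g by (simp add: exchangeable_def)

lemma g_measurable [measurable]: "(\<lambda>x. x i) \<in> borel_measurable g"
  using g by (intro coord_borel_measurable) (simp add: exchangeable_def)

lemma g_Tset: "AE x in g. ip t x x > 0 \<and> ip t x (\<lambda>_. 1) = 0"
  using g by (auto simp: exchangeable_def Tset_ip elim!: eventually_mono)

lemma ip_g_measurable [measurable]: "(\<lambda>x. ip t x x) \<in> borel_measurable g"
  unfolding ip_def by measurable

text \<open>The quotient is bounded by 1, because \<open>2 * \<bar>x a * x b\<bar> \<le> (x
  a)\<^sup>2 + (x b)\<^sup>2\<close>; at a zero denominator it is 0.\<close>

lemma integrable_direction:
  assumes "a < t" "b < t"
  shows "integrable g (\<lambda>x. x a * x b / ip t x x)"
proof (rule integrable_const_bound[where B=1])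
  have "norm (x a * x b / ip t x x) \<le> 1" for x
  proof -
    have sq: "(x c)\<^sup>2 \<le> ip t x x" if "c < t" for c
      unfolding ip_def power2_eq_square using that by (intro member_le_sum) auto
    have "2 * \<bar>x a * x b\<bar> \<le> (x a)\<^sup>2 + (x b)\<^sup>2"
      using sum_squares_bound[of "\<bar>x a\<bar>" "\<bar>x b\<bar>"] by (simp add: abs_mult)
    then have "\<bar>x a * x b\<bar> \<le> ip t x x" using sq[OF assms(1)] sq[OF assms(2)] by linarith
    then show ?thesis using ip_self_nonneg[of t x] by (auto simp: divide_le_eq_1)
  qed
  then show "AE x in g. norm (x a * x b / ip t x x) \<le> 1" by simp
qed measurable

text \<open>The second-moment matrix of the normalised vector inherits permutation invariance from
  exchangeability, zero row sums from the contrast condition, and trace 1 from the normalisation.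
  These three facts determine it.\<close>

lemma integral_direction:
  assumes ab: "a < t" "b < t"
  shows "(\<integral>x. x a * x b / ip t x x \<partial>g) = 1 / (real t - 1) * (of_bool (a = b) - 1 / t)"
proof -
  define M where "M a b = (\<integral>x. x a * x b / ip t x x \<partial>g)" for a b
  have inv: "M (\<tau> a) (\<tau> b) = M a b" if \<tau>: "\<tau> permutes {..<t}" for \<tau> a b
  proof -
    have sets: "sets g = sets borel" and dist: "distr g borel (\<lambda>x i. x (\<tau> i)) = g"
      using g \<tau> by (auto simp: exchangeable_def)
    have ipt: "ip t (\<lambda>i. x (\<tau> i)) (\<lambda>i. x (\<tau> i)) = ip t x x" for x
      unfolding ip_def using sum.permute[OF \<tau>, of "\<lambda>i. x i * x i"] by (simp add: comp_def)
    have "continuous_on UNIV (\<lambda>x::nat \<Rightarrow> real. \<lambda>i. x (\<tau> i))"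
      by (intro continuous_on_coordinatewise_then_product continuous_on_coord)
    then have meas: "(\<lambda>x i. x (\<tau> i)) \<in> g \<rightarrow>\<^sub>M borel"
      unfolding measurable_cong_sets[OF sets refl] by (rule borel_measurable_continuous_onI)
    have "(\<lambda>x. x a * x b / ip t x x) \<in> borel_measurable g" by measurable
    then have fm: "(\<lambda>x. x a * x b / ip t x x) \<in> borel_measurable borel"
      unfolding measurable_cong_sets[OF sets refl] .
    have "M a b = (\<integral>x. x a * x b / ip t x x \<partial>distr g borel (\<lambda>x i. x (\<tau> i)))"
      unfolding dist M_def ..
    also have "\<dots> = M (\<tau> a) (\<tau> b)"
      by (subst integral_distr[OF meas fm]) (simp add: ipt M_def)
    finally show ?thesis ..
  qed
  have rows: "(\<Sum>b<t. M a b) = 0" if a: "a < t" for a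
  proof -
    have "(\<Sum>b<t. M a b) = (\<integral>x. (\<Sum>b<t. x a * x b / ip t x x) \<partial>g)"
      unfolding M_def by (subst Bochner_Integration.integral_sum) (use a integrable_direction in auto)
    also have "\<dots> = (\<integral>x. 0 \<partial>g)"
    proof (rule integral_cong_AE)
      show "AE x in g. (\<Sum>b<t. x a * x b / ip t x x) = 0"
        using g_Tset
      proof eventually_elim
        case (elim x)
        have "(\<Sum>b<t. x a * x b / ip t x x) = x a / ip t x x * ip t x (\<lambda>_. 1)"
          by (simp add: ip_def sum_distrib_left)
        then show ?case using elim by simp
      qed
    qed measurable
    finally show ?thesis by simp
  qed
  have "(\<Sum>c<t. M c c) = (\<integral>x. (\<Sum>c<t. x c * x c / ip t x x) \<partial>g)"
    unfolding M_def by (subst Bochner_Integration.integral_sum) (use integrable_direction in auto)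
  also have "\<dots> = (\<integral>x. 1 \<partial>g)"
  proof (rule integral_cong_AE)
    show "AE x in g. (\<Sum>c<t. x c * x c / ip t x x) = 1"
      using g_Tset
    proof eventually_elim
      case (elim x)
      have "(\<Sum>c<t. x c * x c / ip t x x) = ip t x x / ip t x x"
        unfolding sum_divide_distrib[symmetric] by (simp add: ip_def)
      then show ?case using elim by simp
    qed
  qed measurable
  finally have tr: "(\<Sum>c<t. M c c) = 1" by (simp add: prob_space)
  show ?thesis
    using permutation_invariant_centred[OF t, of M a b, OF inv rows ab] unfolding tr by (simp add: M_def)
qed

text \<open>Only the trace of \<open>M\<close> survives the expectation: the part of the
  second-moment matrix proportional to \<open>J\<close> is annihilated by the zero row sums.\<close>

lemma quadratic_form_direction:
  assumes rows: "\<And>a. a < t \<Longrightarrow> (\<Sum>b<t. M a b) = 0"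
  shows "integrable g (\<lambda>x. ip t x (mv t M x) / ip t x x)"
    and "(\<integral>x. ip t x (mv t M x) / ip t x x \<partial>g) = (\<Sum>a<t. M a a) / (real t - 1)"
proof -
  have eq: "ip t x (mv t M x) / ip t x x = (\<Sum>a<t. \<Sum>b<t. M a b * (x a * x b / ip t x x))" for x
    by (subst (1) ip_def) (simp add: mv_def sum_distrib_left sum_divide_distrib algebra_simps)
  show "integrable g (\<lambda>x. ip t x (mv t M x) / ip t x x)"
    unfolding eq
    by (intro Bochner_Integration.integrable_sum integrable_mult_right integrable_direction) auto
  have "(\<integral>x. ip t x (mv t M x) / ip t x x \<partial>g) = (\<Sum>a<t. \<Sum>b<t. M a b * (\<integral>x. x a * x b / ip t x x \<partial>g))"
  proof -
    have int: "integrable g (\<lambda>x. M a b * (x a * x b / ip t x x))" if "a < t" "b < t" for a b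
      using integrable_direction[OF that] by (rule integrable_mult_right)
    have "(\<integral>x. ip t x (mv t M x) / ip t x x \<partial>g) = (\<Sum>a<t. \<integral>x. (\<Sum>b<t. M a b * (x a * x b / ip t x x)) \<partial>g)"
      unfolding eq by (rule Bochner_Integration.integral_sum) (intro Bochner_Integration.integrable_sum int; simp)
    also have "\<dots> = (\<Sum>a<t. \<Sum>b<t. \<integral>x. M a b * (x a * x b / ip t x x) \<partial>g)"
      by (intro sum.cong refl Bochner_Integration.integral_sum int) auto
    finally show ?thesis by (simp del: times_divide_eq_right)
  qed
  also have "\<dots> = (\<Sum>a<t. \<Sum>b<t. 1 / (real t - 1) * (M a b * of_bool (b = a)) - 1 / ((real t - 1) * t) * M a b)"
    by (intro sum.cong refl) (auto simp: integral_direction algebra_simps)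
  also have "\<dots> = (\<Sum>a<t. M a a) / (real t - 1)"
    using rows by (simp add: sum_subtractf sum_distrib_left[symmetric] sum_divide_distrib[symmetric])
  finally show "(\<integral>x. ip t x (mv t M x) / ip t x x \<partial>g) = (\<Sum>a<t. M a a) / (real t - 1)" .
qed

end

section \<open>Quadratic forms of a design\<close>

lemma scalar_prod_mult_mat_vec:
  assumes "A \<in> carrier_mat n n"
  shows "scalar_prod (Matrix.vec n f) (A *\<^sub>v Matrix.vec n h) = ip n f (mv n (\<lambda>r c. A $$ (r,c)) h)"
  using assms by (simp add: scalar_prod_def ip_def mv_def atLeast0LessThan row_def)

lemma mat_inverse_exists:
  assumes A: "A \<in> carrier_mat n n" and det: "Determinant.det A \<noteq> (0::real)"
  obtains B where "mat_inverse A = Some B" "B \<in> carrier_mat n n" "A * B = 1\<^sub>m n" "B * A = 1\<^sub>m n"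
proof -
  have "A \<in> Units (ring_mat TYPE(real) n ())" using det_non_zero_imp_unit[OF A det] .
  then obtain B where "mat_inverse A = Some B" using mat_inverse(1)[OF A, of "()"] by (cases "mat_inverse A") auto
  then show ?thesis using mat_inverse(2)[OF A] that by auto
qed

text \<open>A positive definite matrix has trivial kernel, so the default branch of
  \<open>minv\<close> is not taken. Positivity transfers through \<open>y = S\<inverse> x\<close>,
  for which \<open>x' S\<inverse> x = y' S y\<close>.\<close>

lemma minv_pos_def:
  assumes "pos_def k S"
  defines "R \<equiv> minv S"
  shows "R \<in> carrier_mat k k" "\<And>i j. i < k \<Longrightarrow> j < k \<Longrightarrow> R $$ (i,j) = R $$ (j,i)"
    "\<And>f. (\<exists>i<k. f i \<noteq> 0) \<Longrightarrow> ip k f (mv k (\<lambda>r c. R $$ (r,c)) f) > 0"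
proof -
  have S: "S \<in> carrier_mat k k" "transpose_mat S = S"
    and pos: "\<And>x. x \<in> carrier_vec k \<Longrightarrow> x \<noteq> 0\<^sub>v k \<Longrightarrow> scalar_prod x (S *\<^sub>v x) > 0"
    using assms by (auto simp: pos_def_def)
  have "Determinant.det S \<noteq> 0"
  proof
    assume "Determinant.det S = 0"
    then obtain x where x: "x \<in> carrier_vec k" "x \<noteq> 0\<^sub>v k" "S *\<^sub>v x = 0\<^sub>v k"
      using det_0_iff_vec_prod_zero_field[OF S(1)] by blast
    then show False using pos[OF x(1,2)] by simp
  qed
  then obtain B where "mat_inverse S = Some B" and B: "B \<in> carrier_mat k k" "S * B = 1\<^sub>m k" "B * S = 1\<^sub>m k"
    using mat_inverse_exists[OF S(1)] by blast
  then have R: "R = B" by (simp add: R_def minv_def)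
  show "R \<in> carrier_mat k k" using B R by simp
  have BT: "transpose_mat B \<in> carrier_mat k k" using B by simp
  have "transpose_mat B * S = transpose_mat (S * B)"
    using transpose_mult[OF S(1) B(1)] S(2) by simp
  also have "\<dots> = 1\<^sub>m k" using B(2) by simp
  finally have "transpose_mat B * S = 1\<^sub>m k" .
  then have "transpose_mat B * S * B = B" using B by simp
  moreover have "transpose_mat B * S * B = transpose_mat B"
    using assoc_mult_mat[OF BT S(1) B(1)] B(2) BT by simp
  ultimately have "transpose_mat B = B" by simp
  then show "R $$ (i,j) = R $$ (j,i)" if "i < k" "j < k" for i j
    using that B(1) R by (metis carrier_matD index_transpose_mat(1))
  show "ip k f (mv k (\<lambda>r c. R $$ (r,c)) f) > 0" if f: "\<exists>i<k. f i \<noteq> 0" for f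
  proof -
    define x where "x = Matrix.vec k f"
    define y where "y = B *\<^sub>v x"
    obtain i where "i < k" "x $ i \<noteq> 0\<^sub>v k $ i" using f by (auto simp: x_def)
    then have "x \<noteq> 0\<^sub>v k" by blast
    then have x: "x \<in> carrier_vec k" "x \<noteq> 0\<^sub>v k" by (simp_all add: x_def)
    have y: "y \<in> carrier_vec k" using x B by (auto simp: y_def)
    have Sy: "S *\<^sub>v y = x"
      unfolding y_def using assoc_mult_mat_vec[OF S(1) B(1) x(1)] B(2) x by simp
    have "S *\<^sub>v 0\<^sub>v k = 0\<^sub>v k" using S(1) by auto
    then have "y \<noteq> 0\<^sub>v k" using Sy x(2) by auto
    then have "scalar_prod y x > 0" using pos[OF y] Sy by simp
    then have "scalar_prod x (B *\<^sub>v x) > 0" using comm_scalar_prod[OF y x(1)] by (simp add: y_def)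
    then show ?thesis unfolding x_def scalar_prod_mult_mat_vec[OF B(1)] R .
  qed
qed

definition bform :: "nat \<Rightarrow> real Matrix.mat \<Rightarrow> (nat \<Rightarrow> real) \<Rightarrow> (nat \<Rightarrow> real) \<Rightarrow> real" where
  "bform k B f h = ip k f (mv k (\<lambda>r c. B $$ (r,c)) h)"

lemma bform_add_left: "bform k B (\<lambda>i. x i + y i) z = bform k B x z + bform k B y z"
  by (simp add: bform_def ip_linear)

lemma bform_scale_left: "bform k B (\<lambda>i. c * x i) z = c * bform k B x z"
  by (simp add: bform_def ip_linear)

lemma bform_add_right: "bform k B z (\<lambda>i. x i + y i) = bform k B z x + bform k B z y"
  by (simp add: bform_def ip_linear mv_add)

lemma bform_scale_right: "bform k B z (\<lambda>i. c * x i) = c * bform k B z x"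
  by (simp add: bform_def ip_linear mv_scale)

lemma bform_zero_left: "bform k B (\<lambda>_. 0) z = 0" and bform_zero_right: "bform k B z (\<lambda>_. 0) = 0"
  by (simp_all add: bform_def ip_def mv_def)

lemma bform_sum_left: "bform k B (\<lambda>i. \<Sum>j\<in>J. f j i) z = (\<Sum>j\<in>J. bform k B (f j) z)"
  by (simp add: bform_def ip_linear)

lemma bform_sum_right: "bform k B z (\<lambda>i. \<Sum>j\<in>J. f j i) = (\<Sum>j\<in>J. bform k B z (f j))"
  by (induction J rule: infinite_finite_induct) (simp_all add: bform_zero_right bform_add_right)

lemmas bform_linear = bform_add_left bform_add_right bform_scale_left bform_scale_right
  bform_sum_left bform_sum_right

lemma bform_cong: "(\<And>i. i < k \<Longrightarrow> x i = x' i) \<Longrightarrow> (\<And>i. i < k \<Longrightarrow> y i = y' i) \<Longrightarrow> bform k B x y = bform k B x' y'"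
  unfolding bform_def by (intro ip_cong) (auto simp: mv_def)

lemma Btilde_carrier:
  assumes "pos_def k S"
  shows "Btilde k S \<in> carrier_mat k k"
  using minv_pos_def(1)[OF assms] by (auto simp: Btilde_def Let_def outer_def ones_vec_def)

text \<open>\<open>Btilde\<close> is the \<open>Sig\<inverse>\<close>-form of the residuals after projecting out the constant vector.\<close>

lemma bform_Btilde:
  assumes S: "pos_def k S"
  shows "bform k (Btilde k S) x y = bform k (minv S) x y
    - bform k (minv S) x (\<lambda>_. 1) * bform k (minv S) (\<lambda>_. 1) y / bform k (minv S) (\<lambda>_. 1) (\<lambda>_. 1)"
proof -
  let ?R = "minv S"
  note R = minv_pos_def[OF S]
  let ?d = "bform k ?R (\<lambda>_. 1) (\<lambda>_. 1)"
  have d: "scalar_prod (ones_vec k) (?R *\<^sub>v ones_vec k) = ?d"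
    unfolding ones_vec_def scalar_prod_mult_mat_vec[OF R(1)] bform_def ..
  have entry: "Btilde k S $$ (l,m) = ?R $$ (l,m) - (\<Sum>c<k. ?R $$ (l,c)) * (\<Sum>c<k. ?R $$ (c,m)) / ?d"
    if lm: "l < k" "m < k" for l m
  proof -
    let ?O = "outer (ones_vec k) (ones_vec k)"
    have O: "?O \<in> carrier_mat k k" "\<And>i j. i < k \<Longrightarrow> j < k \<Longrightarrow> ?O $$ (i,j) = 1"
      by (auto simp: outer_def ones_vec_def)
    have "(?R * ?O) $$ (l,c) = (\<Sum>j<k. ?R $$ (l,j))" if "c < k" for c
      using that lm R(1) O by (simp add: scalar_prod_def atLeast0LessThan)
    then have "(?R * ?O * ?R) $$ (l,m) = (\<Sum>j<k. ?R $$ (l,j)) * (\<Sum>c<k. ?R $$ (c,m))"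
      using lm R(1) O(1)
      by (subst index_mult_mat(1)) (auto simp: scalar_prod_def atLeast0LessThan sum_distrib_left)
    then show ?thesis
      unfolding Btilde_def Let_def d using lm R(1) O by simp
  qed
  have split_product: "(\<Sum>l<k. \<Sum>m<k. f l m - u l * v m / d) = (\<Sum>l<k. \<Sum>m<k. f l m) - (\<Sum>l<k. u l) * (\<Sum>m<k. v m) / d"
    for f :: "nat \<Rightarrow> nat \<Rightarrow> real" and u v d
    by (simp add: sum_subtractf sum_product sum_divide_distrib)
  have "bform k (Btilde k S) x y = (\<Sum>l<k. \<Sum>m<k. x l * (Btilde k S $$ (l,m) * y m))"
    by (simp add: bform_def[of _ "Btilde k S"] ip_def mv_def sum_distrib_left)
  also have "\<dots> = (\<Sum>l<k. \<Sum>m<k. x l * (?R $$ (l,m) * y m)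
      - (x l * (\<Sum>c<k. ?R $$ (l,c))) * ((\<Sum>c<k. ?R $$ (c,m)) * y m) / ?d)"
    by (intro sum.cong refl) (simp add: entry algebra_simps)
  also have "\<dots> = bform k ?R x y - (\<Sum>l<k. x l * (\<Sum>c<k. ?R $$ (l,c))) * (\<Sum>m<k. (\<Sum>c<k. ?R $$ (c,m)) * y m) / ?d"
    unfolding split_product by (simp add: bform_def[of _ ?R x y] ip_def mv_def sum_distrib_left)
  also have "(\<Sum>l<k. x l * (\<Sum>c<k. ?R $$ (l,c))) = bform k ?R x (\<lambda>_. 1)"
    by (simp add: bform_def ip_def mv_def)
  also have "(\<Sum>m<k. (\<Sum>c<k. ?R $$ (c,m)) * y m) = bform k ?R (\<lambda>_. 1) y"
    unfolding bform_def ip_def mv_def sum_distrib_right by (subst sum.swap) simp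
  finally show ?thesis .
qed

context
  fixes k :: nat and S :: "real Matrix.mat"
  assumes k: "k > 0" and S: "pos_def k S"
begin

lemma bform_minv_commute: "bform k (minv S) x y = bform k (minv S) y x"
  unfolding bform_def by (subst mv_symmetric) (auto simp: minv_pos_def[OF S] ip_commute)

lemma bform_minv_one_pos: "bform k (minv S) (\<lambda>_. 1) (\<lambda>_. 1) > 0"
  unfolding bform_def using k by (intro minv_pos_def(3)[OF S]) auto

lemma bform_Btilde_commute: "bform k (Btilde k S) x y = bform k (Btilde k S) y x"
  unfolding bform_Btilde[OF S] by (simp add: bform_minv_commute mult.commute)

lemma bform_Btilde_one: "bform k (Btilde k S) x (\<lambda>_. 1) = 0"
  unfolding bform_Btilde[OF S] using bform_minv_one_pos by simp

text \<open>Here \<open>c\<close> is the generalised least squares mean of \<open>x\<close>. As a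
  square of the residual, the form is visibly nonnegative and vanishes only on constant
  vectors.\<close>

lemma bform_Btilde_self:
  "bform k (Btilde k S) x x = (let c = bform k (minv S) x (\<lambda>_. 1) / bform k (minv S) (\<lambda>_. 1) (\<lambda>_. 1)
     in bform k (minv S) (\<lambda>i. x i + (- c) * 1) (\<lambda>i. x i + (- c) * 1))"
  unfolding bform_Btilde[OF S] Let_def bform_linear
  using bform_minv_one_pos
  by (simp add: bform_minv_commute[of "\<lambda>_. 1" x] field_simps)

lemma bform_Btilde_nonneg: "bform k (Btilde k S) x x \<ge> 0"
proof -
  have "bform k (minv S) f f \<ge> 0" for f
  proof (cases "\<exists>i<k. f i \<noteq> 0")
    case True
    then show ?thesis using minv_pos_def(3)[OF S] by (simp add: bform_def less_imp_le)
  next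
    case False
    then have "bform k (minv S) f f = bform k (minv S) (\<lambda>_. 0) f" by (intro bform_cong) auto
    then show ?thesis by (simp add: bform_zero_left)
  qed
  then show ?thesis unfolding bform_Btilde_self Let_def .
qed

lemma bform_Btilde_eq_0_imp_const:
  assumes "bform k (Btilde k S) x x = 0"
  obtains c where "\<And>i. i < k \<Longrightarrow> x i = c"
proof -
  define c where "c = bform k (minv S) x (\<lambda>_. 1) / bform k (minv S) (\<lambda>_. 1) (\<lambda>_. 1)"
  have "ip k (\<lambda>i. x i + (- c) * 1) (mv k (\<lambda>r c. minv S $$ (r,c)) (\<lambda>i. x i + (- c) * 1)) = 0"
    using assms unfolding bform_Btilde_self Let_def c_def[symmetric] unfolding bform_def .
  then have "\<not> (\<exists>i<k. x i + (- c) * 1 \<noteq> 0)"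
    using minv_pos_def(3)[OF S, of "\<lambda>i. x i + (- c) * 1"] by auto
  then show ?thesis using that[of c] by auto
qed

end

text \<open>Row \<open>l\<close> of \<open>T\<^sub>s, L\<^sub>s, R\<^sub>s\<close> (\<open>i = 0, 1, 2\<close>) is the unit row of the treatment \<open>s ! nbr k i l\<close>.
  Below, \<open>Cform k t Sig q u w y x\<close> is \<open>y' C\<^sub>q[u,w] x\<close>, and \<open>vform V u w\<close> is \<open>u' V w\<close>.\<close>

definition nbr :: "nat \<Rightarrow> nat \<Rightarrow> nat \<Rightarrow> nat" where
  "nbr k i j = (if i = 0 then j else if i = 1 then (j + k - 1) mod k else (j + 1) mod k)"

abbreviation dlt :: "nat \<Rightarrow> nat \<Rightarrow> real" where
  "dlt a \<equiv> \<lambda>c. of_bool (c = a)"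

text \<open>Component \<open>l\<close> of \<open>(u0 T + u1 L + u2 R) y\<close> for the design
  matrices of \<open>s\<close>. With these vectors of length \<open>k\<close> the nine matrices
  \<open>Cs\<close> are handled as one bilinear form, without matrix products.\<close>

definition obs :: "nat \<Rightarrow> nat list \<Rightarrow> real Matrix.vec \<Rightarrow> (nat \<Rightarrow> real) \<Rightarrow> nat \<Rightarrow> real" where
  "obs k s u y l = (\<Sum>i<3. u $ i * y (s ! nbr k i l))"

definition cross :: "nat \<Rightarrow> real Matrix.mat \<Rightarrow> nat list \<Rightarrow> real Matrix.vec \<Rightarrow> real Matrix.vec \<Rightarrow>
    (nat \<Rightarrow> real) \<Rightarrow> (nat \<Rightarrow> real) \<Rightarrow> real" where
  "cross k Sig s u w y x = bform k (Btilde k Sig) (obs k s u y) (obs k s w x)"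

definition Cform :: "nat \<Rightarrow> nat \<Rightarrow> real Matrix.mat \<Rightarrow> (nat list \<Rightarrow> real) \<Rightarrow> real Matrix.vec \<Rightarrow> real Matrix.vec \<Rightarrow>
    (nat \<Rightarrow> real) \<Rightarrow> (nat \<Rightarrow> real) \<Rightarrow> real" where
  "Cform k t Sig q u w y x = (\<Sum>s\<in>Seqs k t. q s * cross k Sig s u w y x)"

definition vform :: "real Matrix.mat \<Rightarrow> real Matrix.vec \<Rightarrow> real Matrix.vec \<Rightarrow> real" where
  "vform V u w = (\<Sum>i<3. \<Sum>j<3. u $ i * w $ j * V $$ (i,j))"

lemma nbr_less: "l < k \<Longrightarrow> nbr k i l < k"
  by (simp add: nbr_def)

lemma Seqs_nth: "s \<in> Seqs k t \<Longrightarrow> l < k \<Longrightarrow> s ! nbr k i l < t"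
  using nbr_less[of l k i] nth_mem[of "nbr k i l" s]
  by (auto simp: Seqs_def simp del: nth_mem)

lemma finite_Seqs: "finite (Seqs k t)"
  using finite_lists_length_eq[of "{..<t}" k] by (simp add: Seqs_def conj_commute)

lemma Gmat_carrier: "Gmat k t s i \<in> carrier_mat k t"
  by (auto simp: Gmat_def Tmat_def Hmat_def)

lemma Gmat_entry:
  assumes l: "l < k" and a: "a < t"
  shows "Gmat k t s i $$ (l,a) = of_bool (s ! nbr k i l = a)"
proof -
  \<comment> \<open>Row \<open>l\<close> of \<open>H\<close> has its single 1 in the cyclically
    preceding column. Adding \<open>k\<close> before subtracting 1 avoids truncated subtraction at
    \<open>l = 0\<close>.\<close>
  have pred: "(l mod k = (m + 1) mod k) = (m = (l + k - 1) mod k)" if "m < k" for m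
  proof (cases "m + 1 = k")
    case True
    then show ?thesis using l that by (cases "l = 0") (auto simp: mod_if)
  next
    case False
    then show ?thesis using l that by (cases "l = 0") (auto simp: mod_if)
  qed
  have H: "Hmat k $$ (l,m) = of_bool (m = (l + k - 1) mod k)" if "m < k" for m
    unfolding pred[OF that, symmetric] using l that by (simp add: Hmat_def)
  have T: "Tmat k t s $$ (m,a) = of_bool (s ! m = a)" if "m < k" for m
    using a that by (simp add: Tmat_def)
  have pick: "(\<Sum>m<k. of_bool (m = c) * of_bool (s ! m = a)) = (of_bool (s ! c = a) :: real)" if "c < k" for c
    using that by (subst sum.remove[of _ c]) (auto intro!: sum.neutral)
  have L: "(Hmat k * Tmat k t s) $$ (l,a) = of_bool (s ! ((l + k - 1) mod k) = a)"
  proof -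
    have "(Hmat k * Tmat k t s) $$ (l,a) = (\<Sum>m<k. Hmat k $$ (l,m) * Tmat k t s $$ (m,a))"
      using l a by (simp add: Hmat_def Tmat_def scalar_prod_def atLeast0LessThan)
    also have "\<dots> = (\<Sum>m<k. of_bool (m = (l + k - 1) mod k) * of_bool (s ! m = a))"
      using l by (intro sum.cong) (simp_all add: T H)
    also have "\<dots> = of_bool (s ! ((l + k - 1) mod k) = a)" using l by (intro pick) simp
    finally show ?thesis .
  qed
  have R: "(transpose_mat (Hmat k) * Tmat k t s) $$ (l,a) = of_bool (s ! ((l + 1) mod k) = a)"
  proof -
    have "(transpose_mat (Hmat k) * Tmat k t s) $$ (l,a) = (\<Sum>m<k. Hmat k $$ (m,l) * Tmat k t s $$ (m,a))"
      using l a by (simp add: Hmat_def Tmat_def scalar_prod_def atLeast0LessThan)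
    also have "\<dots> = (\<Sum>m<k. of_bool (m = (l + 1) mod k) * of_bool (s ! m = a))"
      using l by (intro sum.cong) (auto simp: T Hmat_def)
    also have "\<dots> = of_bool (s ! ((l + 1) mod k) = a)" using l by (intro pick) simp
    finally show ?thesis .
  qed
  show ?thesis using T[OF l] L R by (simp add: Gmat_def nbr_def)
qed

lemma obs_scale: "obs k s u (\<lambda>i. c * x i) = (\<lambda>l. c * obs k s u x l)"
  by (rule ext) (simp add: obs_def sum_distrib_left algebra_simps)

lemma obs_sum: "obs k s u (\<lambda>i. \<Sum>j\<in>J. f j i) = (\<lambda>l. \<Sum>j\<in>J. obs k s u (f j) l)"
  by (rule ext) (unfold obs_def sum_distrib_left, rule sum.swap)

lemma obs_expand:
  assumes "s \<in> Seqs k t" "l < k"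
  shows "obs k s u y l = (\<Sum>a<t. y a * obs k s u (dlt a) l)"
proof -
  have "obs k s u y l = obs k s u (\<lambda>i. \<Sum>a<t. y a * dlt a i) l"
    unfolding obs_def using Seqs_nth[OF assms] by (intro sum.cong) auto
  then show ?thesis by (simp only: obs_sum obs_scale)
qed

lemma cross_expand:
  assumes "s \<in> Seqs k t"
  shows "cross k Sig s u w y x = (\<Sum>a<t. y a * cross k Sig s u w (dlt a) x)"
    "cross k Sig s u w y x = (\<Sum>a<t. x a * cross k Sig s u w y (dlt a))"
proof -
  show "cross k Sig s u w y x = (\<Sum>a<t. y a * cross k Sig s u w (dlt a) x)"
    unfolding cross_def bform_scale_left[symmetric] bform_sum_left[symmetric]
    by (rule bform_cong[OF obs_expand[OF assms] refl])
  show "cross k Sig s u w y x = (\<Sum>a<t. x a * cross k Sig s u w y (dlt a))"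
    unfolding cross_def bform_scale_right[symmetric] bform_sum_right[symmetric]
    by (rule bform_cong[OF refl obs_expand[OF assms]])
qed

lemma Cform_expand:
  "Cform k t Sig q u w y x = (\<Sum>a<t. y a * Cform k t Sig q u w (dlt a) x)"
  "Cform k t Sig q u w y x = (\<Sum>a<t. x a * Cform k t Sig q u w y (dlt a))"
  unfolding Cform_def sum_distrib_left
  by (subst sum.swap, intro sum.cong refl, subst cross_expand, assumption,
      simp add: sum_distrib_left mult.left_commute)+

lemma Cform_scale_left: "Cform k t Sig q u w (\<lambda>i. c * y i) x = c * Cform k t Sig q u w y x"
  by (simp add: Cform_def cross_def obs_scale bform_linear sum_distrib_left mult.left_commute)

lemma Cform_scale_right: "Cform k t Sig q u w y (\<lambda>i. c * x i) = c * Cform k t Sig q u w y x"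
  by (simp add: Cform_def cross_def obs_scale bform_linear sum_distrib_left mult.left_commute)

section \<open>Averaged bilinear forms of a measure and their Schur complements\<close>

context
  fixes k t :: nat and Sig :: "real Matrix.mat"
  assumes k: "k > 0" and Sig: "pos_def k Sig"
begin

lemma Cs_entry:
  assumes ab: "a < t" "b < t"
  shows "Cs k t Sig s i j $$ (a,b) =
    bform k (Btilde k Sig) (\<lambda>l. dlt a (s ! nbr k i l)) (\<lambda>l. dlt b (s ! nbr k j l))"
proof -
  let ?B = "Btilde k Sig"
  have B: "?B \<in> carrier_mat k k" by (rule Btilde_carrier[OF Sig])
  note G = Gmat_carrier[of k t s]
  have "(transpose_mat (Gmat k t s i) * ?B) $$ (a,m) = (\<Sum>l<k. Gmat k t s i $$ (l,a) * ?B $$ (l,m))"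
    if "m < k" for m
    using that ab B G[of i] by (simp add: scalar_prod_def atLeast0LessThan)
  then have "Cs k t Sig s i j $$ (a,b) = (\<Sum>m<k. (\<Sum>l<k. Gmat k t s i $$ (l,a) * ?B $$ (l,m)) * Gmat k t s j $$ (m,b))"
    unfolding Cs_def using ab B G[of i] G[of j]
    by (subst index_mult_mat(1)) (auto simp: scalar_prod_def atLeast0LessThan)
  also have "\<dots> = (\<Sum>l<k. \<Sum>m<k. Gmat k t s i $$ (l,a) * ?B $$ (l,m) * Gmat k t s j $$ (m,b))"
    unfolding sum_distrib_right by (rule sum.swap)
  also have "\<dots> = bform k ?B (\<lambda>l. dlt a (s ! nbr k i l)) (\<lambda>l. dlt b (s ! nbr k j l))"
    using ab unfolding bform_def ip_def mv_def sum_distrib_left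
    by (intro sum.cong refl) (simp add: Gmat_entry mult.assoc)
  finally show ?thesis .
qed

lemma Cs_dim: "dim_row (Cs k t Sig s i j) = t"
  using Gmat_carrier[of k t s i] by (simp add: Cs_def)

lemma sum_Cs_entry:
  assumes ab: "a < t" "b < t"
  shows "(\<Sum>i<3. \<Sum>j<3. u $ i * w $ j * Cs k t Sig s i j $$ (a,b)) = cross k Sig s u w (dlt a) (dlt b)"
proof -
  have obs: "obs k s u y = (\<lambda>l. \<Sum>i<3. u $ i * y (s ! nbr k i l))" for u y
    by (rule ext) (simp add: obs_def)
  show ?thesis
    unfolding cross_def obs bform_sum_left bform_scale_left
    unfolding bform_sum_right bform_scale_right sum_distrib_left
    by (intro sum.cong refl) (simp add: Cs_entry[OF ab] mult.assoc)
qed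

lemma Cuw_entry:
  assumes ab: "a < t" "b < t"
  shows "Cuw k t Sig q u w $$ (a,b) = Cform k t Sig q u w (dlt a) (dlt b)"
proof -
  have "Cuw k t Sig q u w $$ (a,b) =
      (\<Sum>i<3. \<Sum>j<3. \<Sum>s\<in>Seqs k t. q s * (u $ i * w $ j * Cs k t Sig s i j $$ (a,b)))"
    using ab by (simp add: Cuw_def Cxi_def sum_distrib_left mult.assoc mult.left_commute)
  also have "\<dots> = (\<Sum>i<3. \<Sum>s\<in>Seqs k t. \<Sum>j<3. q s * (u $ i * w $ j * Cs k t Sig s i j $$ (a,b)))"
    by (rule sum.cong[OF refl], rule sum.swap)
  also have "\<dots> = (\<Sum>s\<in>Seqs k t. \<Sum>i<3. \<Sum>j<3. q s * (u $ i * w $ j * Cs k t Sig s i j $$ (a,b)))"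
    by (rule sum.swap)
  also have "\<dots> = Cform k t Sig q u w (dlt a) (dlt b)"
    unfolding Cform_def sum_distrib_left[symmetric] sum_Cs_entry[OF ab] ..
  finally show ?thesis .
qed

lemma vform_Vs: "vform (Vs k t Sig s) u w = (\<Sum>a<t. cross k Sig s u w (dlt a) (dlt a))"
proof -
  have "vform (Vs k t Sig s) u w = (\<Sum>i<3. \<Sum>j<3. \<Sum>a<t. u $ i * w $ j * Cs k t Sig s i j $$ (a,a))"
    by (simp add: vform_def Vs_def mtrace_def Cs_dim sum_distrib_left)
  also have "\<dots> = (\<Sum>i<3. \<Sum>a<t. \<Sum>j<3. u $ i * w $ j * Cs k t Sig s i j $$ (a,a))"
    by (rule sum.cong[OF refl], rule sum.swap)
  also have "\<dots> = (\<Sum>a<t. \<Sum>i<3. \<Sum>j<3. u $ i * w $ j * Cs k t Sig s i j $$ (a,a))"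
    by (rule sum.swap)
  also have "\<dots> = (\<Sum>a<t. cross k Sig s u w (dlt a) (dlt a))"
    by (intro sum.cong refl sum_Cs_entry) auto
  finally show ?thesis .
qed

lemma vform_Vxi: "vform (Vxi k t Sig q) u w = (\<Sum>s\<in>Seqs k t. q s * vform (Vs k t Sig s) u w)"
proof -
  have "vform (Vxi k t Sig q) u w = (\<Sum>i<3. \<Sum>j<3. \<Sum>s\<in>Seqs k t. q s * (u $ i * w $ j * Vs k t Sig s $$ (i,j)))"
  proof (unfold vform_def, intro sum.cong refl)
    fix i j :: nat assume ij: "i \<in> {..<3}" "j \<in> {..<3}"
    have "Vxi k t Sig q $$ (i,j) = (\<Sum>s\<in>Seqs k t. q s * Vs k t Sig s $$ (i,j))"
      using ij unfolding sum_distrib_left[of "q _"] Vxi_def Vs_def mtrace_def Cxi_def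
      by (simp add: Cs_dim sum_distrib_left sum.swap[of _ _ "{..<t}"])
    then show "u $ i * w $ j * Vxi k t Sig q $$ (i,j) = (\<Sum>s\<in>Seqs k t. q s * (u $ i * w $ j * Vs k t Sig s $$ (i,j)))"
      by (simp add: sum_distrib_left mult.left_commute)
  qed
  also have "\<dots> = (\<Sum>i<3. \<Sum>s\<in>Seqs k t. \<Sum>j<3. q s * (u $ i * w $ j * Vs k t Sig s $$ (i,j)))"
    by (rule sum.cong[OF refl], rule sum.swap)
  also have "\<dots> = (\<Sum>s\<in>Seqs k t. \<Sum>i<3. \<Sum>j<3. q s * (u $ i * w $ j * Vs k t Sig s $$ (i,j)))"
    by (rule sum.swap)
  also have "\<dots> = (\<Sum>s\<in>Seqs k t. q s * vform (Vs k t Sig s) u w)"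
    by (simp add: vform_def sum_distrib_left)
  finally show ?thesis .
qed

lemma vform_Vxi_trace: "vform (Vxi k t Sig q) u w = (\<Sum>a<t. Cform k t Sig q u w (dlt a) (dlt a))"
  unfolding vform_Vxi vform_Vs Cform_def sum_distrib_left by (rule sum.swap)

lemma Cform_commute: "Cform k t Sig q u w y x = Cform k t Sig q w u x y"
  unfolding Cform_def cross_def using bform_Btilde_commute[OF k Sig] by metis

text \<open>Equal effects for all treatments give a constant vector of observations, and
  \<open>Btilde\<close> annihilates constants.\<close>

lemma Cform_one_right: "Cform k t Sig q u w y (\<lambda>_. 1) = 0"
proof -
  have "obs k s w (\<lambda>_. 1) = (\<lambda>l. (\<Sum>i<3. w $ i) * (\<lambda>_. 1) l)" for s
    by (rule ext) (simp add: obs_def)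
  then show ?thesis
    unfolding Cform_def cross_def by (simp only: bform_scale_right bform_Btilde_one[OF k Sig]) simp
qed

lemma Cform_one_left: "Cform k t Sig q u w (\<lambda>_. 1) y = 0"
  unfolding Cform_commute[of q u w] by (rule Cform_one_right)

text \<open>The right-hand side is the \<open>q\<close>-average of the \<open>Btilde\<close>-squares
  of \<open>obs k s u y - c * obs k s w x\<close>. Both Schur inequalities are obtained from it by a
  choice of \<open>c\<close>.\<close>

lemma Cform_quadratic_nonneg:
  assumes q: "q \<in> measures k t"
  shows "0 \<le> Cform k t Sig q u u y y - 2 * c * Cform k t Sig q u w y x + c\<^sup>2 * Cform k t Sig q w w x x"
proof -
  let ?f = "\<lambda>s i. obs k s u y i + (- c) * obs k s w x i"
  have eq: "bform k (Btilde k Sig) (?f s) (?f s) = cross k Sig s u u y y - 2 * c * cross k Sig s u w y x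
      + c\<^sup>2 * cross k Sig s w w x x" for s
    unfolding bform_linear cross_def power2_eq_square
    using bform_Btilde_commute[OF k Sig, of "obs k s w x" "obs k s u y"] by (simp add: algebra_simps)
  have "0 \<le> (\<Sum>s\<in>Seqs k t. q s * bform k (Btilde k Sig) (?f s) (?f s))"
    using q by (intro sum_nonneg mult_nonneg_nonneg bform_Btilde_nonneg[OF k Sig]) (auto simp: measures_def)
  also have "\<dots> = Cform k t Sig q u u y y - 2 * c * Cform k t Sig q u w y x + c\<^sup>2 * Cform k t Sig q w w x x"
    unfolding eq Cform_def by (simp add: algebra_simps sum.distrib sum_subtractf sum_distrib_left)
  finally show ?thesis .
qed

lemma Cform_nonneg: "q \<in> measures k t \<Longrightarrow> 0 \<le> Cform k t Sig q u u y y"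
  using Cform_quadratic_nonneg[of q u y 0 u y] by simp

text \<open>The junk value \<open>inverse 0 = 0\<close> is harmless: a vanishing denominator forces the numerator to vanish.\<close>

lemma Cform_Schur_ge:
  assumes q: "q \<in> measures k t"
  shows "2 * c * Cform k t Sig q u w y x - c\<^sup>2 * Cform k t Sig q w w x x
    \<le> inverse (Cform k t Sig q w w x x) * (Cform k t Sig q u w y x)\<^sup>2"
proof (cases "Cform k t Sig q w w x x = 0")
  case True
  have "Cform k t Sig q u w y x = 0"
  proof (rule ccontr)
    let ?f = "Cform k t Sig q u w y x" and ?a = "Cform k t Sig q u u y y"
    assume "?f \<noteq> 0"
    \<comment> \<open>With the quadratic coefficient equal to 0, this value of \<open>c\<close>
      makes the expression equal to \<open>?a - (?a + 1) = -1\<close>.\<close>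
    then show False
      using Cform_quadratic_nonneg[OF q, of u y "(?a + 1) / (2 * ?f)" w x] True by simp
  qed
  then show ?thesis using True by simp
next
  case False
  then have g: "Cform k t Sig q w w x x > 0" (is "?g > 0") using Cform_nonneg[OF q, of w x] by simp
  have "inverse ?g * (Cform k t Sig q u w y x)\<^sup>2 - (2 * c * Cform k t Sig q u w y x - c\<^sup>2 * ?g)
      = inverse ?g * (Cform k t Sig q u w y x - c * ?g)\<^sup>2"
    using g by (simp add: power2_eq_square field_simps)
  also have "\<dots> \<ge> 0" using g by simp
  finally show ?thesis by simp
qed

text \<open>The nonnegative quadratic in \<open>c\<close>, evaluated at its minimiser. This is what
  makes information matrices nonnegative definite.\<close>

lemma Cform_Schur_le:
  assumes q: "q \<in> measures k t"
  shows "inverse (Cform k t Sig q w w x x) * (Cform k t Sig q u w y x)\<^sup>2 \<le> Cform k t Sig q u u y y"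
proof (cases "Cform k t Sig q w w x x = 0")
  case True
  then show ?thesis using Cform_nonneg[OF q] by simp
next
  case False
  then have g: "Cform k t Sig q w w x x > 0" (is "?g > 0") using Cform_nonneg[OF q, of w x] by simp
  have "Cform k t Sig q u u y y - 2 * (Cform k t Sig q u w y x / ?g) * Cform k t Sig q u w y x
      + (Cform k t Sig q u w y x / ?g)\<^sup>2 * ?g = Cform k t Sig q u u y y - inverse ?g * (Cform k t Sig q u w y x)\<^sup>2"
    using g by (simp add: power2_eq_square field_simps)
  then show ?thesis using Cform_quadratic_nonneg[OF q, of u y "Cform k t Sig q u w y x / ?g" w x] by simp
qed

lemma mv_Cuw: "a < t \<Longrightarrow> mv t (\<lambda>r c. Cuw k t Sig q u w $$ (r,c)) x a = Cform k t Sig q u w (dlt a) x"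
  unfolding mv_def Cform_expand(2)[of k t Sig q u w "dlt a" x] by (intro sum.cong) (auto simp: Cuw_entry)

lemma ip_mv_Cuw: "ip t y (mv t (\<lambda>r c. Cuw k t Sig q u w $$ (r,c)) x) = Cform k t Sig q u w y x"
  unfolding ip_def Cform_expand(1)[of k t Sig q u w y x] by (intro sum.cong) (auto simp: mv_Cuw)

lemma Cuw_carrier: "Cuw k t Sig q u w \<in> carrier_mat t t"
  by (simp add: Cuw_def)

lemma Ctilde_carrier: "Ctilde k t Sig lam q \<theta> \<in> carrier_mat t t"
  unfolding Ctilde_def Iinfo1_def Let_def
  by (intro smult_carrier_mat minus_carrier_mat) (simp add: outer_def Cuw_def)

lemma Ctilde_entry:
  assumes ab: "a < t" "b < t"
  shows "Ctilde k t Sig lam q \<theta> $$ (a,b) = 1 / (1 + 2 * lam)\<^sup>2 *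
    (Cform k t Sig q (ellv lam) (ellv lam) (dlt a) (dlt b)
     - inverse (Cform k t Sig q ell3 ell3 \<theta> \<theta>)
       * Cform k t Sig q (ellv lam) ell3 (dlt a) \<theta> * Cform k t Sig q (ellv lam) ell3 (dlt b) \<theta>)"
proof -
  have f: "(Cuw k t Sig q u w *\<^sub>v Matrix.vec t \<theta>) $ c = Cform k t Sig q u w (dlt c) \<theta>" if "c < t" for u w c
    using mv_Cuw[OF that, of q u w \<theta>] that Cuw_carrier[of q u w]
    by (simp add: mv_def scalar_prod_def atLeast0LessThan)
  have dim: "dim_row (Cuw k t Sig q u w) = t" "dim_col (Cuw k t Sig q u w) = t" for u w
    by (simp_all add: Cuw_def)
  show ?thesis
    using ab unfolding Ctilde_def Iinfo1_def Let_def scalar_prod_mult_mat_vec[OF Cuw_carrier] ip_mv_Cuw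
    by (simp add: outer_def f Cuw_entry dim mult.assoc del: index_mult_mat_vec)
qed

end

section \<open>Centred measures, relabelling orbits and mixtures\<close>

definition centred :: "nat \<Rightarrow> nat \<Rightarrow> real Matrix.mat \<Rightarrow> (nat list \<Rightarrow> real) \<Rightarrow> bool" where
  "centred k t Sig q \<longleftrightarrow> (\<forall>u w a b. a < t \<longrightarrow> b < t \<longrightarrow>
     Cform k t Sig q u w (dlt a) (dlt b) = vform (Vxi k t Sig q) u w / (real t - 1) * (of_bool (a = b) - 1 / t))"

text \<open>For symmetric \<open>V\<close> this is the quadratic form at
  \<open>ellv lam - \<beta> * ell3\<close>: the Schur complement with its regression coefficient
  frozen at \<beta>, hence linear in \<open>V\<close>.\<close>

definition linform :: "real \<Rightarrow> real \<Rightarrow> real Matrix.mat \<Rightarrow> real" where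
  "linform lam \<beta> V = vform V (ellv lam) (ellv lam) - 2 * \<beta> * vform V (ellv lam) ell3 + \<beta>\<^sup>2 * vform V ell3 ell3"

text \<open>Summing over permutations instead of over the distinct relabellings accounts for
  stabilisers automatically and keeps the denominator at \<open>fact t\<close>.\<close>

definition orbit_measure :: "nat \<Rightarrow> nat list \<Rightarrow> nat list \<Rightarrow> real" where
  "orbit_measure t s s' = (\<Sum>\<sigma> | \<sigma> permutes {..<t}. of_bool (map \<sigma> s = s')) / fact t"

definition mix :: "real \<Rightarrow> ('a \<Rightarrow> real) \<Rightarrow> ('a \<Rightarrow> real) \<Rightarrow> 'a \<Rightarrow> real" where
  "mix \<epsilon> p q s = (1 - \<epsilon>) * p s + \<epsilon> * q s"

lemma ell3_nth: "ell3 $ 0 = 2" "ell3 $ 1 = -1" "ell3 $ 2 = -1"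
  by (simp_all add: ell3_def vec_of_list_index numeral_2_eq_2)

lemma dim_ellv [simp]: "dim_vec (ellv lam) = 3" and dim_ell3 [simp]: "dim_vec ell3 = 3"
  by (simp_all add: ellv_def ell3_def)

lemma sum_lessThan_3: "(\<Sum>i<3. f i) = f 0 + f 1 + f (2::nat)"
  by (simp add: eval_nat_numeral)

lemma sum_mix: "(\<Sum>s\<in>S. mix \<epsilon> p q s * f s) = (1 - \<epsilon>) * (\<Sum>s\<in>S. p s * f s) + \<epsilon> * (\<Sum>s\<in>S. q s * f s)"
  by (simp add: mix_def algebra_simps sum.distrib sum_subtractf sum_distrib_left)

lemma mix_measures: "p \<in> measures k t \<Longrightarrow> q \<in> measures k t \<Longrightarrow> 0 \<le> \<epsilon> \<Longrightarrow> \<epsilon> \<le> 1 \<Longrightarrow> mix \<epsilon> p q \<in> measures k t"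
  using sum_mix[of \<epsilon> p q "\<lambda>_. 1" "Seqs k t"] by (auto simp: measures_def mix_def)

lemma map_permutes_Seqs: "\<sigma> permutes {..<t} \<Longrightarrow> s \<in> Seqs k t \<Longrightarrow> map \<sigma> s \<in> Seqs k t"
  using permutes_in_image[of \<sigma> "{..<t}"] by (auto simp: Seqs_def)

lemma sum_orbit_measure:
  assumes "s \<in> Seqs k t"
  shows "(\<Sum>s'\<in>Seqs k t. orbit_measure t s s' * f s') = (\<Sum>\<sigma> | \<sigma> permutes {..<t}. f (map \<sigma> s)) / fact t"
proof -
  have "(\<Sum>s'\<in>Seqs k t. orbit_measure t s s' * f s')
      = (\<Sum>s'\<in>Seqs k t. \<Sum>\<sigma> | \<sigma> permutes {..<t}. of_bool (map \<sigma> s = s') * f s') / fact t"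
    by (simp add: orbit_measure_def sum_distrib_right sum_divide_distrib)
  also have "(\<Sum>s'\<in>Seqs k t. \<Sum>\<sigma> | \<sigma> permutes {..<t}. of_bool (map \<sigma> s = s') * f s')
      = (\<Sum>\<sigma> | \<sigma> permutes {..<t}. \<Sum>s'\<in>Seqs k t. of_bool (map \<sigma> s = s') * f s')"
    by (rule sum.swap)
  also have "\<dots> = (\<Sum>\<sigma> | \<sigma> permutes {..<t}. f (map \<sigma> s))"
  proof (intro sum.cong refl)
    fix \<sigma> assume "\<sigma> \<in> {\<sigma>. \<sigma> permutes {..<t}}"
    then have "map \<sigma> s \<in> Seqs k t" using map_permutes_Seqs[OF _ assms] by simp
    then show "(\<Sum>s'\<in>Seqs k t. of_bool (map \<sigma> s = s') * f s') = f (map \<sigma> s)"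
      by (subst sum.remove[OF finite_Seqs]) (auto intro!: sum.neutral)
  qed
  finally show ?thesis .
qed

lemma card_perms: "card {\<sigma>. \<sigma> permutes {..<t}} = fact (t::nat)"
  using card_permutations[of "{..<t}" t] by simp

lemma orbit_measure_measures:
  assumes "s \<in> Seqs k t"
  shows "orbit_measure t s \<in> measures k t"
  using sum_orbit_measure[OF assms, of "\<lambda>_. 1"]
  by (simp add: measures_def card_perms orbit_measure_def sum_nonneg)

lemma cross_map:
  assumes s: "s \<in> Seqs k t"
  shows "cross k Sig (map \<sigma> s) u w y x = cross k Sig s u w (y \<circ> \<sigma>) (x \<circ> \<sigma>)"
proof -
  have "obs k (map \<sigma> s) u y l = obs k s u (y \<circ> \<sigma>) l" if "l < k" for u y l
    using nbr_less[OF that] s by (simp add: obs_def Seqs_def)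
  then show ?thesis unfolding cross_def by (intro bform_cong)
qed

lemma Cform_mix: "Cform k t Sig (mix \<epsilon> p q) u w y x = (1 - \<epsilon>) * Cform k t Sig p u w y x + \<epsilon> * Cform k t Sig q u w y x"
  unfolding Cform_def by (rule sum_mix)

context
  fixes k t :: nat and Sig :: "real Matrix.mat" and lam :: real
  assumes k: "k > 0" and t: "t \<ge> 2" and Sig: "pos_def k Sig"
begin

lemma vform_Vxi_mix: "vform (Vxi k t Sig (mix \<epsilon> p q)) u w
    = (1 - \<epsilon>) * vform (Vxi k t Sig p) u w + \<epsilon> * vform (Vxi k t Sig q) u w"
  unfolding vform_Vxi[OF k Sig] by (rule sum_mix)

text \<open>A relabelling only permutes the coordinate vectors over which the trace is taken, so
  \<open>Vs\<close> is constant on orbits and the orbit measure of \<open>s\<close> has the same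
  traces as \<open>s\<close> itself.\<close>

lemma vform_Vs_map:
  assumes s: "s \<in> Seqs k t" and \<sigma>: "\<sigma> permutes {..<t}"
  shows "vform (Vs k t Sig (map \<sigma> s)) u w = vform (Vs k t Sig s) u w"
proof -
  have dlt: "dlt (\<sigma> a) \<circ> \<sigma> = dlt a" for a
    using permutes_inj[OF \<sigma>] by (auto simp: fun_eq_iff inj_eq)
  have "vform (Vs k t Sig (map \<sigma> s)) u w = (\<Sum>a<t. cross k Sig (map \<sigma> s) u w (dlt (\<sigma> a)) (dlt (\<sigma> a)))"
    unfolding vform_Vs[OF k Sig]
    using sum.permute[OF \<sigma>, of "\<lambda>a. cross k Sig (map \<sigma> s) u w (dlt a) (dlt a)"] by (simp only: comp_def)
  then show ?thesis unfolding cross_map[OF s] dlt vform_Vs[OF k Sig] .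
qed

lemma vform_orbit_measure:
  assumes s: "s \<in> Seqs k t"
  shows "vform (Vxi k t Sig (orbit_measure t s)) u w = vform (Vs k t Sig s) u w"
  unfolding vform_Vxi[OF k Sig] sum_orbit_measure[OF s]
  by (simp add: vform_Vs_map[OF s] card_perms)

lemma Cform_row_sum: "(\<Sum>b<t. Cform k t Sig q u w y (dlt b)) = 0"
  using Cform_expand(2)[of k t Sig q u w y "\<lambda>_. 1"] Cform_one_right[OF k Sig] by simp

lemma centredI:
  assumes "\<And>u w \<tau> a b. \<tau> permutes {..<t} \<Longrightarrow> a < t \<Longrightarrow> b < t \<Longrightarrow>
    Cform k t Sig q u w (dlt (\<tau> a)) (dlt (\<tau> b)) = Cform k t Sig q u w (dlt a) (dlt b)"
  shows "centred k t Sig q"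
  unfolding centred_def
proof (intro allI impI)
  fix u w a b assume ab: "a < t" "b < t"
  show "Cform k t Sig q u w (dlt a) (dlt b) = vform (Vxi k t Sig q) u w / (real t - 1) * (of_bool (a = b) - 1 / t)"
    unfolding vform_Vxi_trace[OF k Sig]
    by (rule permutation_invariant_centred[OF t, where M = "\<lambda>a b. Cform k t Sig q u w (dlt a) (dlt b)"])
      (use assms ab Cform_row_sum in auto)
qed

text \<open>The average runs over the whole symmetric group, so \<tau> is absorbed by the reindexing
  \<open>\<sigma> \<mapsto> \<tau> \<circ> \<sigma>\<close>.\<close>

lemma centred_orbit_measure:
  assumes s: "s \<in> Seqs k t"
  shows "centred k t Sig (orbit_measure t s)"
proof (rule centredI)
  fix u w \<tau> and a b :: nat assume \<tau>: "\<tau> permutes {..<t}"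
  have dlt: "dlt (\<tau> a) \<circ> (\<tau> \<circ> \<sigma>) = dlt a \<circ> \<sigma>" for a \<sigma>
    using permutes_inj[OF \<tau>] by (auto simp: fun_eq_iff inj_eq)
  have form: "Cform k t Sig (orbit_measure t s) u w y x
      = (\<Sum>\<sigma> | \<sigma> permutes {..<t}. cross k Sig s u w (y \<circ> \<sigma>) (x \<circ> \<sigma>)) / fact t" for y x
    unfolding Cform_def sum_orbit_measure[OF s] cross_map[OF s] ..
  have "(\<Sum>\<sigma> | \<sigma> permutes {..<t}. cross k Sig s u w (dlt (\<tau> a) \<circ> \<sigma>) (dlt (\<tau> b) \<circ> \<sigma>))
      = (\<Sum>\<sigma> | \<sigma> permutes {..<t}. cross k Sig s u w (dlt (\<tau> a) \<circ> (\<tau> \<circ> \<sigma>)) (dlt (\<tau> b) \<circ> (\<tau> \<circ> \<sigma>)))"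
    by (rule setum_permutations_compose_left[OF \<tau>])
  then show "Cform k t Sig (orbit_measure t s) u w (dlt (\<tau> a)) (dlt (\<tau> b))
      = Cform k t Sig (orbit_measure t s) u w (dlt a) (dlt b)"
    unfolding form dlt by simp
qed

text \<open>Both sides of the defining equation are affine along the segment. Hence moving from the
  given measure towards an orbit measure never leaves the class with an explicit spectrum.\<close>

lemma centred_mix:
  assumes "centred k t Sig p" "centred k t Sig q"
  shows "centred k t Sig (mix \<epsilon> p q)"
  using assms unfolding centred_def Cform_mix vform_Vxi_mix
  by (simp add: add_divide_distrib distrib_right)

lemma centred_pseudo_symmetric:
  assumes "pseudo_symmetric k t Sig q"
  shows "centred k t Sig q"
proof (rule centredI)
  fix u w \<tau> and a b :: nat assume \<tau>: "\<tau> permutes {..<t}" and ab: "a < t" "b < t"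
  have \<tau>ab: "\<tau> a < t" "\<tau> b < t" using permutes_in_image[OF \<tau>] ab by auto
  have "Cxi k t Sig q i j $$ (\<tau> a, \<tau> b) = Cxi k t Sig q i j $$ (a,b)" if ij: "i < 3" "j < 3" for i j
  proof -
    obtain c d where "Cxi k t Sig q i j = c \<cdot>\<^sub>m 1\<^sub>m t + d \<cdot>\<^sub>m Jmat t"
      using assms ij unfolding pseudo_symmetric_def compl_sym_def by blast
    then show ?thesis using ab \<tau>ab permutes_inj[OF \<tau>] by (simp add: Jmat_def inj_eq)
  qed
  then show "Cform k t Sig q u w (dlt (\<tau> a)) (dlt (\<tau> b)) = Cform k t Sig q u w (dlt a) (dlt b)"
    unfolding Cuw_entry[OF k Sig ab, symmetric] Cuw_entry[OF k Sig \<tau>ab, symmetric]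
    using ab \<tau>ab by (simp add: Cuw_def)
qed

lemma vform_Vs_self_nonneg: "0 \<le> vform (Vs k t Sig s) u u"
  unfolding vform_Vs[OF k Sig] cross_def by (intro sum_nonneg bform_Btilde_nonneg[OF k Sig])

text \<open>A \<open>0/1\<close> sequence on the cycle whose discrete Laplacian is constant is itself constant.\<close>

lemma constant_sequence_of_vform_ell3_eq_0:
  assumes s: "s \<in> Seqs k t" and zero: "vform (Vs k t Sig s) ell3 ell3 = 0" and l: "l < k"
  shows "s ! l = s ! 0"
proof (rule ccontr)
  assume neq: "s ! l \<noteq> s ! 0"
  define y where "y l = (of_bool (s ! l = s ! 0) :: real)" for l
  have "s ! 0 < t" using s k by (auto simp: Seqs_def subset_eq)
  moreover have "\<forall>a\<in>{..<t}. cross k Sig s ell3 ell3 (dlt a) (dlt a) = 0"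
    using zero unfolding vform_Vs[OF k Sig] cross_def
    by (subst (asm) sum_nonneg_eq_0_iff) (auto intro: bform_Btilde_nonneg[OF k Sig])
  ultimately have "cross k Sig s ell3 ell3 (dlt (s ! 0)) (dlt (s ! 0)) = 0" by simp
  then obtain c where c: "\<And>i. i < k \<Longrightarrow> obs k s ell3 (dlt (s ! 0)) i = c"
    unfolding cross_def using bform_Btilde_eq_0_imp_const[OF k Sig] by metis
  have obs: "c = 2 * y i - y (nbr k 1 i) - y ((i + 1) mod k)" if "i < k" for i
    unfolding c[OF that, symmetric] obs_def sum_lessThan_3 ell3_nth by (simp add: y_def nbr_def)
  have y01: "0 \<le> y i" "y i \<le> 1" for i by (simp_all add: y_def)
  have "y 0 = 1" "y l = 0" using neq by (simp_all add: y_def)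
  \<comment> \<open>The sequence \<open>y\<close> takes values in \<open>{0, 1}\<close>: at position
    0 it attains the maximum 1, so \<open>c \<ge> 0\<close>, and at position \<open>l\<close> the
    minimum 0, so \<open>c \<le> 0\<close>.\<close>
  then have "c = 0"
    using obs[OF k] obs[OF l] y01[of "nbr k 1 0"] y01[of "(0+1) mod k"] y01[of "nbr k 1 l"] y01[of "(l+1) mod k"]
    by linarith
  \<comment> \<open>With zero Laplacian, a position of value 1 has neighbours averaging to 1;
    neither exceeds 1, so both equal 1 and the value spreads along the cycle.\<close>
  have "i < k \<Longrightarrow> y i = 1" for i
  proof (induction i)
    case 0
    show ?case by fact
  next
    case (Suc i)
    then show ?case using obs[of i] \<open>c = 0\<close> y01[of "nbr k 1 i"] y01[of "Suc i"] by simp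
  qed
  then show False using l \<open>y l = 0\<close> by fastforce
qed

text \<open>A nonconstant supporting sequence contributes a positive summand and no summand is
  negative. All later divisions by \<open>Q\<close> rest on this.\<close>

lemma vform_ell3_pos:
  assumes p: "p \<in> measures k t" and nd: "nondegenerate k t p"
  shows "0 < vform (Vxi k t Sig p) ell3 ell3"
proof -
  obtain s a b where s: "s \<in> Seqs k t" "p s > 0" and ab: "a < k" "b < k" "s ! a \<noteq> s ! b"
    using nd by (auto simp: nondegenerate_def)
  then have "vform (Vs k t Sig s) ell3 ell3 \<noteq> 0"
    using constant_sequence_of_vform_ell3_eq_0[OF s(1)] by metis
  then have "0 < p s * vform (Vs k t Sig s) ell3 ell3"
    using s(2) vform_Vs_self_nonneg[of s ell3] by simp
  also have "\<dots> \<le> vform (Vxi k t Sig p) ell3 ell3"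
    unfolding vform_Vxi[OF k Sig] using p s(1) vform_Vs_self_nonneg finite_Seqs
    by (intro member_le_sum) (auto simp: measures_def)
  finally show ?thesis .
qed

section \<open>The information matrix for the total effect in terms of the bilinear forms\<close>

lemma mv_Ctilde:
  assumes a: "a < t"
  shows "mv t (\<lambda>r c. Ctilde k t Sig lam q \<theta> $$ (r,c)) y a = 1 / (1 + 2 * lam)\<^sup>2 *
    (Cform k t Sig q (ellv lam) (ellv lam) (dlt a) y
     - inverse (Cform k t Sig q ell3 ell3 \<theta> \<theta>)
       * Cform k t Sig q (ellv lam) ell3 (dlt a) \<theta> * Cform k t Sig q (ellv lam) ell3 y \<theta>)"
proof -
  have "mv t (\<lambda>r c. Ctilde k t Sig lam q \<theta> $$ (r,c)) y a = (\<Sum>b<t. 1 / (1 + 2 * lam)\<^sup>2 *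
    (y b * Cform k t Sig q (ellv lam) (ellv lam) (dlt a) (dlt b)
     - inverse (Cform k t Sig q ell3 ell3 \<theta> \<theta>)
       * Cform k t Sig q (ellv lam) ell3 (dlt a) \<theta> * (y b * Cform k t Sig q (ellv lam) ell3 (dlt b) \<theta>)))"
    unfolding mv_def using a by (intro sum.cong refl) (simp add: Ctilde_entry[OF k Sig] algebra_simps)
  then show ?thesis
    by (simp only: sum_distrib_left[symmetric] sum_subtractf
        Cform_expand(2)[of k t Sig q _ _ "dlt a" y] Cform_expand(1)[of k t Sig q _ _ y \<theta>])
qed

lemma qf_Ctilde:
  "qf t (Ctilde k t Sig lam q \<theta>) y = 1 / (1 + 2 * lam)\<^sup>2 *
    (Cform k t Sig q (ellv lam) (ellv lam) y y
     - inverse (Cform k t Sig q ell3 ell3 \<theta> \<theta>) * (Cform k t Sig q (ellv lam) ell3 y \<theta>)\<^sup>2)"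
proof -
  have "qf t (Ctilde k t Sig lam q \<theta>) y = (\<Sum>a<t. 1 / (1 + 2 * lam)\<^sup>2 *
    (y a * Cform k t Sig q (ellv lam) (ellv lam) (dlt a) y
     - inverse (Cform k t Sig q ell3 ell3 \<theta> \<theta>)
       * Cform k t Sig q (ellv lam) ell3 y \<theta> * (y a * Cform k t Sig q (ellv lam) ell3 (dlt a) \<theta>)))"
    unfolding qf_def ip_def by (intro sum.cong refl) (simp add: mv_Ctilde algebra_simps)
  then show ?thesis
    by (simp only: sum_distrib_left[symmetric] sum_subtractf power2_eq_square mult.assoc
        Cform_expand(1)[of k t Sig q _ _ y y] Cform_expand(1)[of k t Sig q _ _ y \<theta>])
qed

lemma mtrace_Ctilde:
  "mtrace (Ctilde k t Sig lam q \<theta>) = 1 / (1 + 2 * lam)\<^sup>2 * (vform (Vxi k t Sig q) (ellv lam) (ellv lam)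
     - inverse (Cform k t Sig q ell3 ell3 \<theta> \<theta>) * (\<Sum>a<t. (Cform k t Sig q (ellv lam) ell3 (dlt a) \<theta>)\<^sup>2))"
proof -
  have "mtrace (Ctilde k t Sig lam q \<theta>) = (\<Sum>a<t. 1 / (1 + 2 * lam)\<^sup>2 *
      (Cform k t Sig q (ellv lam) (ellv lam) (dlt a) (dlt a)
       - inverse (Cform k t Sig q ell3 ell3 \<theta> \<theta>) * (Cform k t Sig q (ellv lam) ell3 (dlt a) \<theta>)\<^sup>2))"
    unfolding mtrace_def using Ctilde_carrier[OF k Sig, of t lam q \<theta>]
    by (intro sum.cong) (auto simp: Ctilde_entry[OF k Sig] power2_eq_square mult.assoc)
  then show ?thesis
    by (simp only: sum_distrib_left[symmetric] sum_subtractf vform_Vxi_trace[OF k Sig])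
qed

lemma info_like_Ctilde:
  assumes q: "q \<in> measures k t"
  shows "info_like t (Ctilde k t Sig lam q \<theta>)"
  unfolding info_like_def
proof (intro conjI allI impI)
  show "Ctilde k t Sig lam q \<theta> \<in> carrier_mat t t" by (rule Ctilde_carrier[OF k Sig])
  show "0 \<le> qf t (Ctilde k t Sig lam q \<theta>) y" for y
    unfolding qf_Ctilde using Cform_Schur_le[OF k Sig q] by simp
  fix r assume r: "r < t"
  show "Ctilde k t Sig lam q \<theta> $$ (r,c) = Ctilde k t Sig lam q \<theta> $$ (c,r)" if "c < t" for c
    using Cform_commute[OF k Sig, of t q "ellv lam" "ellv lam" "dlt r" "dlt c"] r that
    by (simp add: Ctilde_entry[OF k Sig])
  show "(\<Sum>c<t. Ctilde k t Sig lam q \<theta> $$ (r,c)) = 0"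
    using mv_Ctilde[OF r, of q \<theta> "\<lambda>_. 1"] Cform_one_left[OF k Sig] Cform_one_right[OF k Sig]
    by (simp add: mv_def)
qed

end

section \<open>Sufficiency and the criteria of centred measures\<close>

context
  fixes k t :: nat and Sig :: "real Matrix.mat" and lam :: real
  assumes k: "k > 0" and t: "t \<ge> 2" and Sig: "pos_def k Sig"
begin

text \<open>The lower bound for the subtracted square at a fixed coefficient. The test vector is
  normalised but \<theta> is not, so the coefficient is
  \<open>\<beta> / sqrt (ip t \<theta> \<theta>)\<close>.\<close>

lemma qf_Ctilde_le:
  assumes q: "q \<in> measures k t" and \<theta>: "ip t \<theta> \<theta> > 0"
  shows "qf t (Ctilde k t Sig lam q \<theta>) (\<lambda>i. 1 / sqrt (ip t \<theta> \<theta>) * \<theta> i) \<le> 1 / (1 + 2 * lam)\<^sup>2 *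
    ((Cform k t Sig q (ellv lam) (ellv lam) \<theta> \<theta> - 2 * \<beta> * Cform k t Sig q (ellv lam) ell3 \<theta> \<theta>
      + \<beta>\<^sup>2 * Cform k t Sig q ell3 ell3 \<theta> \<theta>) / ip t \<theta> \<theta>)"
proof -
  let ?\<rho> = "ip t \<theta> \<theta>"
  let ?e = "\<lambda>i. 1 / sqrt ?\<rho> * \<theta> i"
  have sq: "1 / sqrt ?\<rho> * (1 / sqrt ?\<rho>) = 1 / ?\<rho>" using \<theta> by simp
  have "Cform k t Sig q (ellv lam) (ellv lam) ?e ?e
      - inverse (Cform k t Sig q ell3 ell3 \<theta> \<theta>) * (Cform k t Sig q (ellv lam) ell3 ?e \<theta>)\<^sup>2
    \<le> Cform k t Sig q (ellv lam) (ellv lam) ?e ?e - (2 * (\<beta> / sqrt ?\<rho>) * Cform k t Sig q (ellv lam) ell3 ?e \<theta>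
      - (\<beta> / sqrt ?\<rho>)\<^sup>2 * Cform k t Sig q ell3 ell3 \<theta> \<theta>)"
    by (intro diff_left_mono Cform_Schur_ge[OF k Sig q])
  also have "\<dots> = (Cform k t Sig q (ellv lam) (ellv lam) \<theta> \<theta> - 2 * \<beta> * Cform k t Sig q (ellv lam) ell3 \<theta> \<theta>
      + \<beta>\<^sup>2 * Cform k t Sig q ell3 ell3 \<theta> \<theta>) / ?\<rho>"
    using \<theta> unfolding Cform_scale_left Cform_scale_right
    by (simp add: power_divide add_divide_distrib diff_divide_distrib)
  finally show ?thesis unfolding qf_Ctilde[OF k t Sig] by (intro mult_left_mono) auto
qed

text \<open>The same bound in every coordinate \<open>a\<close>, now with coefficient
  \<open>\<beta> * \<theta> a / ip t \<theta> \<theta>\<close>; the coordinates then add up to a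
  bound that involves only forms at \<theta>.\<close>

lemma mtrace_Ctilde_le:
  assumes q: "q \<in> measures k t" and \<theta>: "ip t \<theta> \<theta> > 0"
  shows "mtrace (Ctilde k t Sig lam q \<theta>) \<le> 1 / (1 + 2 * lam)\<^sup>2 *
    (vform (Vxi k t Sig q) (ellv lam) (ellv lam) + (- 2 * \<beta> * Cform k t Sig q (ellv lam) ell3 \<theta> \<theta>
      + \<beta>\<^sup>2 * Cform k t Sig q ell3 ell3 \<theta> \<theta>) / ip t \<theta> \<theta>)"
proof -
  let ?\<rho> = "ip t \<theta> \<theta>" and ?g = "Cform k t Sig q ell3 ell3 \<theta> \<theta>"
  have S: "(\<Sum>a<t. \<theta> a * Cform k t Sig q (ellv lam) ell3 (dlt a) \<theta>) = Cform k t Sig q (ellv lam) ell3 \<theta> \<theta>"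
    "(\<Sum>a<t. \<theta> a * \<theta> a) = ?\<rho>"
    by (rule Cform_expand(1)[symmetric]) (simp add: ip_def)
  have "(2 * \<beta> * Cform k t Sig q (ellv lam) ell3 \<theta> \<theta> - \<beta>\<^sup>2 * ?g) / ?\<rho>
      = (\<Sum>a<t. 2 * (\<beta> / ?\<rho>) * (\<theta> a * Cform k t Sig q (ellv lam) ell3 (dlt a) \<theta>) - (\<beta> / ?\<rho>)\<^sup>2 * ?g * (\<theta> a * \<theta> a))"
    unfolding sum_subtractf sum_distrib_left[symmetric] S
    using \<theta> by (simp add: power2_eq_square field_simps)
  also have "\<dots> \<le> (\<Sum>a<t. inverse ?g * (Cform k t Sig q (ellv lam) ell3 (dlt a) \<theta>)\<^sup>2)"
  proof (intro sum_mono)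
    fix a
    show "2 * (\<beta> / ?\<rho>) * (\<theta> a * Cform k t Sig q (ellv lam) ell3 (dlt a) \<theta>) - (\<beta> / ?\<rho>)\<^sup>2 * ?g * (\<theta> a * \<theta> a)
        \<le> inverse ?g * (Cform k t Sig q (ellv lam) ell3 (dlt a) \<theta>)\<^sup>2"
      using Cform_Schur_ge[OF k Sig q, of "\<beta> / ?\<rho> * \<theta> a" "ellv lam" ell3 "dlt a" \<theta>]
      by (simp add: power_mult_distrib power2_eq_square mult_ac)
  qed
  finally have "vform (Vxi k t Sig q) (ellv lam) (ellv lam)
      - inverse ?g * (\<Sum>a<t. (Cform k t Sig q (ellv lam) ell3 (dlt a) \<theta>)\<^sup>2)
    \<le> vform (Vxi k t Sig q) (ellv lam) (ellv lam) + (- 2 * \<beta> * Cform k t Sig q (ellv lam) ell3 \<theta> \<theta> + \<beta>\<^sup>2 * ?g) / ?\<rho>"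
    by (simp add: sum_distrib_left add_divide_distrib diff_divide_distrib)
  then show ?thesis unfolding mtrace_Ctilde[OF k t Sig] by (intro mult_left_mono) auto
qed

section \<open>Integrating the criteria over \<open>g\<close>\<close>

context
  fixes g :: "(nat \<Rightarrow> real) measure"
  assumes g: "exchangeable t g"
begin

interpretation prob_space g using g by (simp add: exchangeable_def)

lemma Cform_direction:
  shows "integrable g (\<lambda>x. Cform k t Sig q u w x x / ip t x x)"
    and "(\<integral>x. Cform k t Sig q u w x x / ip t x x \<partial>g) = vform (Vxi k t Sig q) u w / (real t - 1)"
proof -
  have rows: "(\<Sum>b<t. Cuw k t Sig q u w $$ (a,b)) = 0" if "a < t" for a
    using that Cform_row_sum[OF k t Sig, of q u w "dlt a"] by (simp add: Cuw_entry[OF k Sig])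
  note dir = quadratic_form_direction[OF t g, of "\<lambda>r c. Cuw k t Sig q u w $$ (r,c)"]
  show "integrable g (\<lambda>x. Cform k t Sig q u w x x / ip t x x)"
    using dir(1) rows by (simp add: ip_mv_Cuw[OF k Sig])
  show "(\<integral>x. Cform k t Sig q u w x x / ip t x x \<partial>g) = vform (Vxi k t Sig q) u w / (real t - 1)"
    using dir(2) rows by (simp add: ip_mv_Cuw[OF k Sig] vform_Vxi_trace[OF k Sig] Cuw_entry[OF k Sig])
qed

text \<open>Regrouping the hypothesis on \<open>Phi\<close> as
  \<open>(xd - xa) * qf + xa * mtrace\<close> gives two nonnegative coefficients, so the upper
  bounds for \<open>qf\<close> and \<open>mtrace\<close> can be inserted. The result is linear in
  quotients whose means over \<open>g\<close> are known.\<close>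

lemma crit_le:
  assumes q: "q \<in> measures k t"
    and Phi: "\<And>C e. info_like t C \<Longrightarrow> ip t e e = 1 \<Longrightarrow> ip t e (\<lambda>_. 1) = 0 \<Longrightarrow>
      Phi C \<le> xd * qf t C e + xa * (mtrace C - qf t C e)"
    and x: "0 \<le> xa" "xa \<le> xd"
  shows "crit k t Sig lam g Phi q \<le> max 0 (1 / (1 + 2 * lam)\<^sup>2 / (real t - 1) *
    (xd * linform lam \<beta> (Vxi k t Sig q) + xa * ((real t - 2) * vform (Vxi k t Sig q) (ellv lam) (ellv lam))))"
proof (cases "integrable g (\<lambda>\<theta>. Phi (Ctilde k t Sig lam q \<theta>))")
  case False
  then show ?thesis by (simp add: crit_def not_integrable_integral_eq)
next
  case True
  let ?\<kappa> = "1 / (1 + 2 * lam)\<^sup>2"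
  define A where "A = vform (Vxi k t Sig q) (ellv lam) (ellv lam)"
  define R where "R u w \<theta> = Cform k t Sig q u w \<theta> \<theta> / ip t \<theta> \<theta>" for u w \<theta>
  define X where "X \<theta> = R (ellv lam) (ellv lam) \<theta> - 2 * \<beta> * R (ellv lam) ell3 \<theta> + \<beta>\<^sup>2 * R ell3 ell3 \<theta>" for \<theta>
  define U where "U \<theta> = ?\<kappa> * (xd * X \<theta> + xa * (A - R (ellv lam) (ellv lam) \<theta>))" for \<theta>
  have R: "integrable g (R u w)" "(\<integral>\<theta>. R u w \<theta> \<partial>g) = vform (Vxi k t Sig q) u w / (real t - 1)" for u w
    unfolding R_def by (rule Cform_direction)+
  have intX: "integrable g X"
    unfolding X_def by (intro Bochner_Integration.integrable_add Bochner_Integration.integrable_diff integrable_mult_right R(1))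
  have EX: "(\<integral>\<theta>. X \<theta> \<partial>g) = linform lam \<beta> (Vxi k t Sig q) / (real t - 1)"
    unfolding X_def linform_def using R
    by (simp add: Bochner_Integration.integral_add Bochner_Integration.integral_diff add_divide_distrib diff_divide_distrib)
  have intU: "integrable g U"
    unfolding U_def by (intro Bochner_Integration.integrable_add Bochner_Integration.integrable_diff integrable_mult_right intX R(1) integrable_const)
  have "Phi (Ctilde k t Sig lam q \<theta>) \<le> U \<theta>" if \<theta>: "ip t \<theta> \<theta> > 0" "ip t \<theta> (\<lambda>_. 1) = 0" for \<theta>
  proof -
    let ?C = "Ctilde k t Sig lam q \<theta>" and ?e = "\<lambda>i. 1 / sqrt (ip t \<theta> \<theta>) * \<theta> i"
    have "ip t ?e ?e = 1 / sqrt (ip t \<theta> \<theta>) * (1 / sqrt (ip t \<theta> \<theta>)) * ip t \<theta> \<theta>"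
      unfolding ip_scale_left ip_scale_right by (simp only: mult.assoc)
    then have e: "ip t ?e ?e = 1" using \<theta>(1) by simp
    have e1: "ip t ?e (\<lambda>_. 1) = 0" unfolding ip_scale_left using \<theta>(2) by simp
    have le1: "qf t ?C ?e \<le> ?\<kappa> * X \<theta>"
      using qf_Ctilde_le[OF q \<theta>(1), of \<beta>] by (simp add: X_def R_def add_divide_distrib diff_divide_distrib)
    have le2: "mtrace ?C \<le> ?\<kappa> * (A + X \<theta> - R (ellv lam) (ellv lam) \<theta>)"
      using mtrace_Ctilde_le[OF q \<theta>(1), of \<beta>] by (simp add: X_def R_def A_def add_divide_distrib diff_divide_distrib)
    have regroup: "(xd - xa) * (c * x) + xa * (c * (A + x - r)) = c * (xd * x + xa * (A - r))" for c x r
      by (simp add: algebra_simps)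
    have "Phi ?C \<le> xd * qf t ?C ?e + xa * (mtrace ?C - qf t ?C ?e)"
      by (rule Phi[OF info_like_Ctilde[OF k t Sig q] e e1])
    also have "\<dots> = (xd - xa) * qf t ?C ?e + xa * mtrace ?C" by (simp add: algebra_simps)
    also have "\<dots> \<le> (xd - xa) * (?\<kappa> * X \<theta>) + xa * (?\<kappa> * (A + X \<theta> - R (ellv lam) (ellv lam) \<theta>))"
      using x le1 le2 by (intro add_mono mult_left_mono) auto
    also have "\<dots> = U \<theta>" unfolding U_def by (rule regroup)
    finally show ?thesis .
  qed
  then have "AE \<theta> in g. Phi (Ctilde k t Sig lam q \<theta>) \<le> U \<theta>"
    by (intro eventually_mono[OF g_Tset[OF t g]]) blast
  then have "crit k t Sig lam g Phi q \<le> (\<integral>\<theta>. U \<theta> \<partial>g)"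
    unfolding crit_def by (intro integral_mono_AE True intU)
  also have "\<dots> = ?\<kappa> * (xd * (\<integral>\<theta>. X \<theta> \<partial>g) + xa * (A - (\<integral>\<theta>. R (ellv lam) (ellv lam) \<theta> \<partial>g)))"
    unfolding U_def using intX R(1)
    by (simp add: Bochner_Integration.integral_add Bochner_Integration.integral_diff prob_space del: times_divide_eq_left)
  also have "\<dots> = ?\<kappa> / (real t - 1) * (xd * linform lam \<beta> (Vxi k t Sig q) + xa * ((real t - 2) * A))"
  proof -
    \<comment> \<open>The direction of \<theta> takes on average a share \<open>1 / (t - 1)\<close>
      of the trace; the rest explains the factor \<open>t - 2\<close>.\<close>
    have "A - A / (real t - 1) = (real t - 2) * A / (real t - 1)" using t by (simp add: field_simps)
    then show ?thesis unfolding EX R(2) A_def[symmetric] by (simp add: add_divide_distrib distrib_left)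
  qed
  finally show ?thesis unfolding A_def by simp
qed

lemma Cform_centred:
  assumes "centred k t Sig q"
  shows "Cform k t Sig q u w y x = vform (Vxi k t Sig q) u w / (real t - 1) *
    (ip t y x - ip t y (\<lambda>_. 1) * ip t x (\<lambda>_. 1) / t)"
proof -
  define v where "v = vform (Vxi k t Sig q) u w / (real t - 1)"
  have "Cform k t Sig q u w y x = (\<Sum>a<t. \<Sum>b<t. v * (y a * (x b * of_bool (b = a))) - v / t * (y a * x b))"
    unfolding Cform_expand(1)[of k t Sig q u w y x]
  proof (intro sum.cong refl)
    fix a assume a: "a \<in> {..<t}"
    have "Cform k t Sig q u w (dlt a) x = (\<Sum>b<t. x b * (v * (of_bool (a = b) - 1 / t)))"
      unfolding Cform_expand(2)[of k t Sig q u w "dlt a" x]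
      using assms a by (intro sum.cong refl) (simp add: centred_def v_def)
    then have "Cform k t Sig q u w (dlt a) x = (\<Sum>b<t. x b * (v * (of_bool (b = a) - 1 / t)))"
      by (simp only: eq_commute[of a])
    then show "y a * Cform k t Sig q u w (dlt a) x = (\<Sum>b<t. v * (y a * (x b * of_bool (b = a))) - v / t * (y a * x b))"
      by (simp add: sum_distrib_left algebra_simps)
  qed
  also have "\<dots> = v * (\<Sum>a<t. y a * x a) - v / t * ((\<Sum>a<t. y a) * (\<Sum>b<t. x b))"
    by (simp add: sum_subtractf sum_distrib_left[symmetric] sum_distrib_right[symmetric] del: times_divide_eq_left)
  finally show ?thesis unfolding v_def[symmetric] by (simp add: ip_def algebra_simps)
qed

text \<open>The unit vector is \<theta> minus its mean, normalised. Covering all nonconstant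
  \<theta>, and not only contrasts, gives a formula valid everywhere up to the constant vectors,
  which the integral below relies on for measurability.\<close>

lemma Ctilde_centred:
  assumes c: "centred k t Sig q" and Q: "vform (Vxi k t Sig q) ell3 ell3 > 0"
    and \<theta>: "\<exists>i<t. \<theta> i \<noteq> \<theta> 0"
  defines "A \<equiv> vform (Vxi k t Sig q) (ellv lam) (ellv lam)"
    and "B \<equiv> vform (Vxi k t Sig q) (ellv lam) ell3"
    and "D \<equiv> vform (Vxi k t Sig q) ell3 ell3"
  shows "\<exists>e. ip t e e = 1 \<and> ip t e (\<lambda>_. 1) = 0 \<and> two_point t (1 / (1 + 2 * lam)\<^sup>2 / (real t - 1) * A)
    (1 / (1 + 2 * lam)\<^sup>2 / (real t - 1) * (A - B\<^sup>2 / D)) e (Ctilde k t Sig lam q \<theta>)"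
proof -
  define m where "m = ip t \<theta> (\<lambda>_. 1) / t"
  define z where "z i = \<theta> i - m" for i
  have t0: "real t > 0" "real t - 1 > 0" using t by auto
  have one: "ip t (\<lambda>_. 1) (\<lambda>_. 1) = t" "ip t \<theta> (\<lambda>_. 1) = m * t" using t0 by (simp_all add: ip_def m_def)
  have z_eq: "z = (\<lambda>i. \<theta> i - m * (\<lambda>_. 1) i)" by (simp add: z_def fun_eq_iff)
  have z1: "ip t z (\<lambda>_. 1) = 0" unfolding z_eq by (simp only: ip_linear one)
  have zz: "ip t z z = ip t \<theta> \<theta> - ip t \<theta> (\<lambda>_. 1) * ip t \<theta> (\<lambda>_. 1) / t"
    unfolding z_eq using t0 by (simp only: ip_linear one ip_commute[of t "\<lambda>_. 1" \<theta>]) (simp add: field_simps)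
  have "ip t z z \<noteq> 0"
  proof
    assume "ip t z z = 0"
    then have "\<forall>i<t. \<theta> i = m" by (simp add: ip_self_eq_0_iff z_def)
    moreover have "0 < t" using t by simp
    ultimately have "\<forall>i<t. \<theta> i = \<theta> 0" by simp
    then show False using \<theta> by blast
  qed
  then have \<rho>: "ip t z z > 0" using ip_self_nonneg[of t z] by simp
  define e where "e i = 1 / sqrt (ip t z z) * z i" for i
  have e_eq: "e = (\<lambda>i. 1 / sqrt (ip t z z) * z i)" by (simp add: e_def fun_eq_iff)
  have ee: "e a * e b = z a * z b / ip t z z" for a b using \<rho> by (simp add: e_def)
  have "ip t e e = (\<Sum>i<t. z i * z i / ip t z z)" by (simp add: ip_def[of t e] ee)
  also have "\<dots> = 1" unfolding sum_divide_distrib[symmetric] ip_def[symmetric] using \<rho> by simp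
  finally have e1: "ip t e e = 1" .
  have e0: "ip t e (\<lambda>_. 1) = 0" unfolding e_eq ip_scale_left z1 by simp
  have dlt1: "ip t (dlt a) (\<lambda>_. 1) = 1" "ip t (dlt a) x = x a" if "a < t" for a x
    using ip_delta[OF that] by (simp_all add: ip_commute[of t "dlt a"])
  have F: "Cform k t Sig q (ellv lam) ell3 (dlt a) \<theta> = B / (real t - 1) * z a" if "a < t" for a
    unfolding Cform_centred[OF c] dlt1[OF that] by (simp add: B_def z_def m_def)
  have G: "Cform k t Sig q ell3 ell3 \<theta> \<theta> = D / (real t - 1) * ip t z z"
    unfolding Cform_centred[OF c] zz D_def ..
  have "Ctilde k t Sig lam q \<theta> $$ (a,b) =
    1 / (1 + 2 * lam)\<^sup>2 / (real t - 1) * A * (of_bool (a = b) - 1 / t)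
    - (1 / (1 + 2 * lam)\<^sup>2 / (real t - 1) * A - 1 / (1 + 2 * lam)\<^sup>2 / (real t - 1) * (A - B\<^sup>2 / D)) * e a * e b"
    if ab: "a < t" "b < t" for a b
  proof -
    have cancel: "inverse (d / N * r) * (B / N * x) * (B / N * y) = B\<^sup>2 / d / N * (x * y / r)"
      if "N > 0" "d > 0" "r > 0" for N d r x y :: real
      using that by (simp add: field_simps power2_eq_square)
    have "Cform k t Sig q (ellv lam) (ellv lam) (dlt a) (dlt b) = A / (real t - 1) * (of_bool (a = b) - 1 / t)"
      using c ab by (simp add: centred_def A_def)
    moreover have "inverse (D / (real t - 1) * ip t z z) * (B / (real t - 1) * z a) * (B / (real t - 1) * z b)
        = B\<^sup>2 / D / (real t - 1) * (e a * e b)"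
      unfolding ee using cancel[of "real t - 1" D "ip t z z"] t0 \<rho> Q by (simp only: D_def)
    ultimately have "Ctilde k t Sig lam q \<theta> $$ (a,b) = 1 / (1 + 2 * lam)\<^sup>2 *
        (A / (real t - 1) * (of_bool (a = b) - 1 / t) - B\<^sup>2 / D / (real t - 1) * (e a * e b))"
      unfolding Ctilde_entry[OF k Sig ab] F[OF ab(1)] F[OF ab(2)] G by simp
    then show ?thesis by (simp add: algebra_simps diff_divide_distrib)
  qed
  then show ?thesis using e1 e0 unfolding two_point_def by blast
qed

text \<open>No measurability of \<open>Phi\<close> is available, so the integrand is identified
  pointwise: it has one value on nonconstant \<theta> and one on constant \<theta>, and the dividing
  condition is a finite disjunction of measurable ones.\<close>

lemma crit_centred:
  assumes q: "q \<in> measures k t" and c: "centred k t Sig q"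
  defines "A \<equiv> vform (Vxi k t Sig q) (ellv lam) (ellv lam)"
    and "B \<equiv> vform (Vxi k t Sig q) (ellv lam) ell3"
    and "Q \<equiv> vform (Vxi k t Sig q) ell3 ell3"
  assumes Q: "Q > 0" and D: "A - B\<^sup>2 / Q > 0" and lam: "1 + 2 * lam \<noteq> 0"
    and Phi: "\<And>C e \<alpha> \<delta>. info_like t C \<Longrightarrow> ip t e e = 1 \<Longrightarrow> ip t e (\<lambda>_. 1) = 0 \<Longrightarrow> 0 < \<delta> \<Longrightarrow> \<delta> \<le> \<alpha> \<Longrightarrow>
      two_point t \<alpha> \<delta> e C \<Longrightarrow> Phi C = Psi \<delta> \<alpha>"
  shows "crit k t Sig lam g Phi q = Psi (1 / (1 + 2 * lam)\<^sup>2 / (real t - 1) * (A - B\<^sup>2 / Q)) (1 / (1 + 2 * lam)\<^sup>2 / (real t - 1) * A)"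
    (is "_ = ?\<Psi>")
proof -
  let ?\<kappa> = "1 / (1 + 2 * lam)\<^sup>2 / (real t - 1)"
  have \<kappa>: "?\<kappa> > 0" using lam t by simp
  have val: "Phi (Ctilde k t Sig lam q \<theta>) = ?\<Psi>" if \<theta>: "\<exists>i<t. \<theta> i \<noteq> \<theta> 0" for \<theta>
  proof -
    obtain e where e: "ip t e e = 1" "ip t e (\<lambda>_. 1) = 0"
      and tp: "two_point t (?\<kappa> * A) (?\<kappa> * (A - B\<^sup>2 / Q)) e (Ctilde k t Sig lam q \<theta>)"
      using Ctilde_centred[OF c Q[unfolded Q_def] \<theta>] unfolding A_def B_def Q_def by (elim exE conjE)
    show ?thesis
    proof (rule Phi[OF info_like_Ctilde[OF k t Sig q] e])
      show "0 < ?\<kappa> * (A - B\<^sup>2 / Q)" using \<kappa> D by (rule mult_pos_pos)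
      have "0 \<le> B\<^sup>2 / Q" using Q by simp
      then show "?\<kappa> * (A - B\<^sup>2 / Q) \<le> ?\<kappa> * A" using \<kappa> by (intro mult_left_mono) linarith+
    qed (fact tp)
  qed
  \<comment> \<open>For constant \<theta> all forms with argument \<theta> vanish, so the
    information matrix coincides with the one at the zero vector.\<close>
  define c0 where "c0 = Phi (Ctilde k t Sig lam q (\<lambda>_. 0))"
  have const: "Phi (Ctilde k t Sig lam q \<theta>) = c0" if \<theta>: "\<not> (\<exists>i<t. \<theta> i \<noteq> \<theta> 0)" for \<theta>
  proof -
    have scale: "ip t \<theta> x = \<theta> 0 * ip t (\<lambda>_. 1) x" for x
      unfolding ip_scale_left[symmetric] mult_1_right by (rule ip_cong[OF _ refl]) (use \<theta> in blast)
    have one: "ip t (\<lambda>_. 1) (\<lambda>_. 1) = t" by (simp add: ip_def)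
    have zero: "Cform k t Sig q u w y \<theta> = 0" for u w y
      unfolding Cform_centred[OF c] ip_commute[of t y \<theta>] scale one
      using t by (simp add: ip_commute[of t "\<lambda>_. 1"])
    have "Cform k t Sig q u w y (\<lambda>_. 0) = 0" for u w y
      using Cform_scale_right[of k t Sig q u w y 0 "\<lambda>_. 0"] by simp
    then have "Ctilde k t Sig lam q \<theta> = Ctilde k t Sig lam q (\<lambda>_. 0)"
      using Ctilde_carrier[OF k Sig, of t lam q \<theta>] Ctilde_carrier[OF k Sig, of t lam q "\<lambda>_. 0"]
      by (intro eq_matI) (auto simp: Ctilde_entry[OF k Sig] zero)
    then show ?thesis by (simp add: c0_def)
  qed
  have eq: "(\<lambda>\<theta>. Phi (Ctilde k t Sig lam q \<theta>)) = (\<lambda>\<theta>. if \<exists>i<t. \<theta> i \<noteq> \<theta> 0 then ?\<Psi> else c0)"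
  proof (rule ext)
    fix \<theta>
    show "Phi (Ctilde k t Sig lam q \<theta>) = (if \<exists>i<t. \<theta> i \<noteq> \<theta> 0 then ?\<Psi> else c0)"
      using val[of \<theta>] const[of \<theta>] by presburger
  qed
  have neq: "Measurable.pred g (\<lambda>\<theta>. \<theta> i \<noteq> \<theta> 0)" for i
    unfolding pred_def by (intro borel_measurable_neq g_measurable[OF t g])
  have pred: "Measurable.pred g (\<lambda>\<theta>. \<exists>i<t. \<theta> i \<noteq> \<theta> 0)"
    unfolding Bex_def[of "{..<t}", unfolded lessThan_iff, symmetric]
    by (rule pred_intros_finite(4)) (simp_all only: neq finite_lessThan)
  have "crit k t Sig lam g Phi q = (\<integral>\<theta>. ?\<Psi> \<partial>g)"
    unfolding crit_def eq
  proof (rule integral_cong_AE)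
    have "(if \<exists>i<t. \<theta> i \<noteq> \<theta> 0 then ?\<Psi> else c0) = ?\<Psi>"
      if "ip t \<theta> \<theta> > 0" "ip t \<theta> (\<lambda>_. 1) = 0" for \<theta>
    proof (rule ccontr)
      assume "\<not> ?thesis"
      then have "\<forall>i<t. \<theta> i = \<theta> 0" by presburger
      then have scale: "ip t \<theta> x = \<theta> 0 * ip t (\<lambda>_. 1) x" for x
        unfolding ip_scale_left[symmetric] mult_1_right by (intro ip_cong[OF _ refl]) blast
      then have "\<theta> 0 * ip t (\<lambda>_. 1) (\<lambda>_. 1) = 0" using that(2) by metis
      then have "\<theta> 0 = 0" using t by (simp add: ip_def)
      then show False using that(1) scale[of \<theta>] by simp
    qed
    then show "AE \<theta> in g. (if \<exists>i<t. \<theta> i \<noteq> \<theta> 0 then ?\<Psi> else c0) = ?\<Psi>"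
      by (intro eventually_mono[OF g_Tset[OF t g]]) blast
    show "(\<lambda>\<theta>. if \<exists>i<t. \<theta> i \<noteq> \<theta> 0 then ?\<Psi> else c0) \<in> borel_measurable g"
      by (rule measurable_If[OF _ _ pred[unfolded pred_def]]; simp only: borel_measurable_const)
  qed (rule borel_measurable_const)
  then show ?thesis by (simp add: prob_space)
qed

end

end

section \<open>Optimality conditions\<close>

text \<open>A weighted mean equal to 1 prevents the maximum from being smaller than 1. If it is
  exactly 1, the nonnegative terms \<open>p s * (1 - f s)\<close> sum to 0 and vanish one by
  one.\<close>

lemma Max_eq_1_iff_weighted:
  fixes f p :: "'a \<Rightarrow> real"
  assumes S: "finite S" and p: "\<And>s. s \<in> S \<Longrightarrow> 0 \<le> p s" "(\<Sum>s\<in>S. p s) = 1" and pf: "(\<Sum>s\<in>S. p s * f s) = 1"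
  shows "Max (f ` S) = 1 \<longleftrightarrow> (\<forall>s\<in>S. f s \<le> 1)"
    and "Max (f ` S) = 1 \<Longrightarrow> s \<in> S \<Longrightarrow> p s > 0 \<Longrightarrow> f s = 1"
proof -
  have ne: "S \<noteq> {}" using p(2) by auto
  have eq: "f s = 1" if le: "\<forall>s\<in>S. f s \<le> 1" and s: "s \<in> S" "p s > 0" for s
  proof -
    have "(\<Sum>s\<in>S. p s * (1 - f s)) = 0" using p(2) pf by (simp add: right_diff_distrib sum_subtractf)
    moreover have "\<forall>s\<in>S. 0 \<le> p s * (1 - f s)" using le p(1) by simp
    ultimately have "\<forall>s\<in>S. p s * (1 - f s) = 0" using sum_nonneg_eq_0_iff[OF S] by meson
    then show ?thesis using s by force
  qed
  show max: "Max (f ` S) = 1 \<longleftrightarrow> (\<forall>s\<in>S. f s \<le> 1)"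
  proof
    assume "Max (f ` S) = 1"
    then show "\<forall>s\<in>S. f s \<le> 1" using S by (metis Max_ge finite_imageI imageI)
  next
    assume le: "\<forall>s\<in>S. f s \<le> 1"
    have "\<exists>s\<in>S. p s > 0"
    proof (rule ccontr)
      assume "\<not> ?thesis"
      then have "\<forall>s\<in>S. p s = 0" using p(1) by force
      then show False using p(2) by simp
    qed
    then obtain s where "s \<in> S" "f s = 1" using eq[OF le] by blast
    then show "Max (f ` S) = 1" using S le by (intro Max_eqI) force+
  qed
  show "f s = 1" if "Max (f ` S) = 1" "s \<in> S" "p s > 0" for s
    using eq that max by blast
qed

section \<open>Two-by-two algebra behind \<open>r3\<close>\<close>

lemma det_2:
  assumes "M \<in> carrier_mat 2 2"
  shows "Determinant.det M = M $$ (0,0) * M $$ (1,1) - M $$ (0,1) * (M $$ (1,0) :: real)"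
proof -
  have md: "mat_delete M 0 0 \<in> carrier_mat 1 1" "mat_delete M 0 1 \<in> carrier_mat 1 1"
    using assms by (auto simp: mat_delete_def)
  have "Determinant.det M = (\<Sum>j<2. M $$ (0,j) * cofactor M 0 j)"
    by (rule laplace_expansion_row[OF assms]) simp
  also have "\<dots> = M $$ (0,0) * Determinant.det (mat_delete M 0 0) - M $$ (0,1) * Determinant.det (mat_delete M 0 1)"
    by (simp add: numeral_2_eq_2 cofactor_def)
  also have "Determinant.det (mat_delete M 0 0) = M $$ (1,1)"
    unfolding det_single[OF md(1)] using assms by (simp add: mat_delete_def)
  also have "Determinant.det (mat_delete M 0 1) = M $$ (1,0)"
    unfolding det_single[OF md(2)] using assms by (simp add: mat_delete_def)
  finally show ?thesis .
qed

lemma quad_vform: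
  assumes "V \<in> carrier_mat 3 3" "dim_vec u = 3"
  shows "quad V u = vform V u u"
  using assms by (simp add: quad_def vform_def scalar_prod_def atLeast0LessThan sum_distrib_left algebra_simps)

lemma L3_congruence:
  fixes lam :: real
  assumes V: "V \<in> carrier_mat 3 3"
  defines "W \<equiv> transpose_mat (L3 lam) * V * L3 lam" and "c \<equiv> \<lambda>a::nat. if a = 0 then ellv lam else ell3"
  shows "W \<in> carrier_mat 2 2" "\<And>a b. a < 2 \<Longrightarrow> b < 2 \<Longrightarrow> W $$ (a,b) = vform V (c a) (c b)"
proof -
  have L: "L3 lam \<in> carrier_mat 3 2" "\<And>i a. i < 3 \<Longrightarrow> a < 2 \<Longrightarrow> L3 lam $$ (i,a) = c a $ i"
    by (auto simp: L3_def c_def)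
  show "W \<in> carrier_mat 2 2" using L V by (simp add: W_def)
  fix a b :: nat assume ab: "a < 2" "b < 2"
  have "(transpose_mat (L3 lam) * V) $$ (a,j) = (\<Sum>i<3. c a $ i * V $$ (i,j))" if "j < 3" for j
    using that ab L V by (simp add: scalar_prod_def atLeast0LessThan)
  then have "W $$ (a,b) = (\<Sum>j<3. (\<Sum>i<3. c a $ i * V $$ (i,j)) * c b $ j)"
    unfolding W_def using ab L V by (subst index_mult_mat(1)) (auto simp: scalar_prod_def atLeast0LessThan)
  also have "\<dots> = vform V (c a) (c b)"
    unfolding vform_def sum_distrib_right by (subst sum.swap) (simp add: mult_ac)
  finally show "W $$ (a,b) = vform V (c a) (c b)" .
qed

lemma det_L3_congruence:
  assumes "V \<in> carrier_mat 3 3" "vform V ell3 (ellv lam) = vform V (ellv lam) ell3"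
  shows "Determinant.det (transpose_mat (L3 lam) * V * L3 lam)
    = vform V (ellv lam) (ellv lam) * vform V ell3 ell3 - (vform V (ellv lam) ell3)\<^sup>2"
  using L3_congruence[OF assms(1), where lam = lam] assms(2) by (simp add: det_2 power2_eq_square)

lemma minv_2:
  assumes M: "M \<in> carrier_mat 2 2" and det: "Determinant.det M \<noteq> 0"
  shows "minv M = Matrix.mat 2 2 (\<lambda>(i,j). (if i = j then M $$ (1 - i, 1 - i) else - M $$ (i,j)) / Determinant.det M)"
    (is "_ = ?W")
proof -
  obtain N where N: "mat_inverse M = Some N" "N \<in> carrier_mat 2 2" "N * M = 1\<^sub>m 2"
    using mat_inverse_exists[OF M det] by metis
  have W: "?W \<in> carrier_mat 2 2" by simp
  have "M * ?W = 1\<^sub>m 2"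
  proof (rule eq_matI)
    fix i j assume "i < dim_row (1\<^sub>m 2 :: real mat)" "j < dim_col (1\<^sub>m 2 :: real mat)"
    then have "i = 0 \<or> i = 1" "j = 0 \<or> j = 1" by auto
    then show "(M * ?W) $$ (i,j) = 1\<^sub>m 2 $$ (i,j)"
      using M det unfolding det_2[OF M]
      by (auto simp: scalar_prod_def numeral_2_eq_2 divide_simps)
  qed (use M in auto)
  then have "N = N * (M * ?W)" using N by simp
  also have "\<dots> = ?W" using assoc_mult_mat[OF N(2) M W] N(3) W by simp
  finally show ?thesis using N(1) by (simp add: minv_def)
qed

lemma mtrace_mult_2:
  assumes "M \<in> carrier_mat 2 2" "N \<in> carrier_mat 2 2"
  shows "mtrace (M * N) = M $$ (0,0) * N $$ (0,0) + M $$ (0,1) * N $$ (1,0)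
    + (M $$ (1,0) * N $$ (0,1) + M $$ (1,1) * N $$ (1,1))"
  using assms by (simp add: mtrace_def scalar_prod_def numeral_2_eq_2)

text \<open>Inverting the partitioned matrix and removing the inverse \<open>1 / Q\<close> of its
  corner leaves a rank-one matrix: the square of \<open>(1, - B / Q)\<close> divided by the Schur
  complement. The trace against it is \<open>linform\<close> at \<open>B / Q\<close>.\<close>

lemma r3_eq:
  assumes V: "V \<in> carrier_mat 3 3" "vform V ell3 (ellv lam) = vform V (ellv lam) ell3"
    and X: "X \<in> carrier_mat 3 3" "vform X ell3 (ellv lam) = vform X (ellv lam) ell3"
  defines "A \<equiv> vform X (ellv lam) (ellv lam)" and "B \<equiv> vform X (ellv lam) ell3" and "Q \<equiv> vform X ell3 ell3"
  assumes Q: "Q > 0" and D: "A - B\<^sup>2 / Q > 0"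
  shows "r3 lam V X = linform lam (B / Q) V / (A - B\<^sup>2 / Q)"
proof -
  let ?W = "\<lambda>V. transpose_mat (L3 lam) * V * L3 lam"
  have det: "Determinant.det (?W X) = A * Q - B\<^sup>2"
    unfolding det_L3_congruence[OF X] A_def B_def Q_def ..
  have det0: "A * Q - B\<^sup>2 > 0" using D Q by (simp add: field_simps)
  note WV = L3_congruence[OF V(1), where lam = lam] and WX = L3_congruence[OF X(1), where lam = lam]
  have inv: "minv (?W X) = Matrix.mat 2 2 (\<lambda>(i,j). (if i = j then ?W X $$ (1 - i, 1 - i) else - ?W X $$ (i,j)) / (A * Q - B\<^sup>2))"
    using minv_2[OF WX(1)] det det0 by simp
  have "mtrace (?W V * minv (?W X)) = (vform V (ellv lam) (ellv lam) * Q - 2 * vform V (ellv lam) ell3 * B + vform V ell3 ell3 * A) / (A * Q - B\<^sup>2)"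
    unfolding inv by (subst mtrace_mult_2[OF WV(1)])
      (simp_all add: WV(2) WX(2) V(2) X(2) A_def[symmetric] B_def[symmetric] Q_def[symmetric] add_divide_distrib diff_divide_distrib)
  moreover have "quad V ell3 / quad X ell3 = vform V ell3 ell3 / Q"
    using V(1) X(1) by (simp add: quad_vform Q_def)
  ultimately have "r3 lam V X = (vform V (ellv lam) (ellv lam) * Q - 2 * vform V (ellv lam) ell3 * B + vform V ell3 ell3 * A) / (A * Q - B\<^sup>2)
      - vform V ell3 ell3 / Q"
    by (simp add: r3_def Let_def)
  also have "\<dots> = linform lam (B / Q) V / (A - B\<^sup>2 / Q)"
  proof -
    have frac: "(a * Q - 2 * b * B + q * A) / (A * Q - B\<^sup>2) - q / Q = (a - 2 * (B / Q) * b + (B / Q)\<^sup>2 * q) / (A - B\<^sup>2 / Q)" for a b q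
    proof -
      have "A - B\<^sup>2 / Q = (A * Q - B\<^sup>2) / Q" using Q by (simp add: field_simps)
      moreover have "a - 2 * (B / Q) * b + (B / Q)\<^sup>2 * q = (a * Q\<^sup>2 - 2 * B * Q * b + B\<^sup>2 * q) / Q\<^sup>2"
        using Q by (simp add: field_simps power2_eq_square)
      moreover have "(a * Q - 2 * b * B + q * A) / (A * Q - B\<^sup>2) - q / Q
          = (a * Q\<^sup>2 - 2 * B * Q * b + B\<^sup>2 * q) / (Q * (A * Q - B\<^sup>2))"
        using Q det0 by (simp add: divide_simps) (simp add: algebra_simps power2_eq_square)
      ultimately show ?thesis using Q det0 by (simp add: power2_eq_square)
    qed
    show ?thesis unfolding linform_def frac ..
  qed
  finally show ?thesis .
qed

section \<open>The tangent test for a general criterion\<close>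

context
  fixes k t :: nat and Sig :: "real Matrix.mat" and lam :: real and g :: "(nat \<Rightarrow> real) measure"
    and p :: "nat list \<Rightarrow> real" and A B Q D \<kappa> :: real
  assumes k: "k > 0" and t: "t \<ge> 2" and Sig: "pos_def k Sig"
    and g: "exchangeable t g" and p: "p \<in> measures k t" and cp: "centred k t Sig p"
    and lam: "1 + 2 * lam \<noteq> 0"
    and A: "A = vform (Vxi k t Sig p) (ellv lam) (ellv lam)"
    and B: "B = vform (Vxi k t Sig p) (ellv lam) ell3"
    and Q: "Q = vform (Vxi k t Sig p) ell3 ell3" and Q_pos: "Q > 0"
    and D: "D = A - B\<^sup>2 / Q" and D_pos: "D > 0"
    and \<kappa>: "\<kappa> = 1 / (1 + 2 * lam)\<^sup>2 / (real t - 1)"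
begin

abbreviation "lin s \<equiv> linform lam (B / Q) (Vs k t Sig s)"
abbreviation "diag s \<equiv> vform (Vs k t Sig s) (ellv lam) (ellv lam)"

lemma \<kappa>_pos: "\<kappa> > 0"
  using lam t by (simp add: \<kappa>)

lemma D_le_A: "D \<le> A"
  using Q_pos by (simp add: D)

lemma linform_Vxi: "linform lam \<beta> (Vxi k t Sig q) = (\<Sum>s\<in>Seqs k t. q s * linform lam \<beta> (Vs k t Sig s))"
  unfolding linform_def vform_Vxi[OF k Sig]
  by (simp add: algebra_simps sum.distrib sum_subtractf sum_distrib_left)

lemma linform_p: "linform lam (B / Q) (Vxi k t Sig p) = D"
  unfolding linform_def A[symmetric] B[symmetric] Q[symmetric] D
  using Q_pos by (simp add: field_simps power2_eq_square)

text \<open>The criterion itself need not be smooth at \<open>p\<close> (\<open>PhiE\<close> when \<open>D = A\<close>); only \<open>Psi\<close> along the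
  segment towards an orbit measure has to be differentiable.\<close>

lemma optimal_for_iff:
  assumes x: "0 \<le> xa" "xa \<le> xd"
    and Phi_le: "\<And>C e. info_like t C \<Longrightarrow> ip t e e = 1 \<Longrightarrow> ip t e (\<lambda>_. 1) = 0 \<Longrightarrow>
      Phi C \<le> xd * qf t C e + xa * (mtrace C - qf t C e)"
    and Phi_eq: "\<And>C e \<alpha> \<delta>. info_like t C \<Longrightarrow> ip t e e = 1 \<Longrightarrow> ip t e (\<lambda>_. 1) = 0 \<Longrightarrow> 0 < \<delta> \<Longrightarrow> \<delta> \<le> \<alpha> \<Longrightarrow>
      two_point t \<alpha> \<delta> e C \<Longrightarrow> Phi C = Psi \<delta> \<alpha>"
    and val: "Psi (\<kappa> * D) (\<kappa> * A) = xd * (\<kappa> * D) + xa * ((real t - 2) * (\<kappa> * A))"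
    and deriv: "\<And>f h f' h'. f 0 = \<kappa> * D \<Longrightarrow> h 0 = \<kappa> * A \<Longrightarrow>
      (f has_real_derivative f') (at 0) \<Longrightarrow> (h has_real_derivative h') (at 0) \<Longrightarrow>
      ((\<lambda>\<epsilon>. Psi (f \<epsilon>) (h \<epsilon>)) has_real_derivative xd * f' + xa * ((real t - 2) * h')) (at 0)"
  shows "optimal_for k t Sig lam g Phi p \<longleftrightarrow>
    (\<forall>s\<in>Seqs k t. xd * lin s + xa * ((real t - 2) * diag s) \<le> xd * D + xa * ((real t - 2) * A))"
proof
  have crit_centred_eq: "crit k t Sig lam g Phi q = Psi (\<kappa> * (a - b\<^sup>2 / c)) (\<kappa> * a)"
    if q: "q \<in> measures k t" "centred k t Sig q"
      and eqs: "vform (Vxi k t Sig q) (ellv lam) (ellv lam) = a" "vform (Vxi k t Sig q) (ellv lam) ell3 = b"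
        "vform (Vxi k t Sig q) ell3 ell3 = c"
      and pos: "c > 0" "a - b\<^sup>2 / c > 0" for q a b c
    unfolding \<kappa> eqs[symmetric]
  proof (rule crit_centred[OF k t Sig g q _ _ lam], goal_cases)
    case (3 C e \<alpha> \<delta>)
    then show ?case by (rule Phi_eq)
  qed (use pos eqs in simp_all)
  have crit_p: "crit k t Sig lam g Phi p = Psi (\<kappa> * D) (\<kappa> * A)"
    unfolding D by (rule crit_centred_eq[OF p cp]) (use Q_pos D_pos in \<open>simp_all add: A B Q D\<close>)
  {
    assume le: "\<forall>s\<in>Seqs k t. xd * lin s + xa * ((real t - 2) * diag s) \<le> xd * D + xa * ((real t - 2) * A)"
    show "optimal_for k t Sig lam g Phi p"
      unfolding optimal_for_def
    proof (intro conjI ballI p)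
      fix q assume q: "q \<in> measures k t"
      let ?X = "xd * linform lam (B / Q) (Vxi k t Sig q) + xa * ((real t - 2) * vform (Vxi k t Sig q) (ellv lam) (ellv lam))"
      let ?Y = "xd * D + xa * ((real t - 2) * A)"
      have "?X = (\<Sum>s\<in>Seqs k t. q s * (xd * lin s + xa * ((real t - 2) * diag s)))"
        unfolding linform_Vxi vform_Vxi[OF k Sig] by (simp add: algebra_simps sum.distrib sum_subtractf sum_distrib_left)
      also have "\<dots> \<le> (\<Sum>s\<in>Seqs k t. q s * ?Y)"
        using le q by (intro sum_mono mult_left_mono) (auto simp: measures_def)
      also have "\<dots> = ?Y"
        using q by (simp add: measures_def sum_distrib_right[symmetric])
      finally have "\<kappa> * ?X \<le> \<kappa> * ?Y" using \<kappa>_pos by (intro mult_left_mono) auto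
      \<comment> \<open>Disposes of the maximum with 0 in the bound for the competitor.\<close>
      moreover have "0 \<le> \<kappa> * ?Y"
        using x D_pos D_le_A t \<kappa>_pos by (intro add_nonneg_nonneg mult_nonneg_nonneg) auto
      moreover have "crit k t Sig lam g Phi p = \<kappa> * ?Y"
        unfolding crit_p val by (simp add: algebra_simps)
      moreover have "crit k t Sig lam g Phi q \<le> max 0 (\<kappa> * ?X)"
        unfolding \<kappa> by (rule crit_le[OF k t Sig g q Phi_le x])
      ultimately show "crit k t Sig lam g Phi q \<le> crit k t Sig lam g Phi p" by linarith
    qed
  }
  assume opt: "optimal_for k t Sig lam g Phi p"
  show "\<forall>s\<in>Seqs k t. xd * lin s + xa * ((real t - 2) * diag s) \<le> xd * D + xa * ((real t - 2) * A)"
  proof (rule ccontr)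
    assume "\<not> ?thesis"
    then obtain s where s: "s \<in> Seqs k t"
      and gt: "xd * lin s + xa * ((real t - 2) * diag s) > xd * D + xa * ((real t - 2) * A)" by force
    define q where "q \<epsilon> = mix \<epsilon> p (orbit_measure t s)" for \<epsilon>
    let ?B = "vform (Vs k t Sig s) (ellv lam) ell3" and ?Q = "vform (Vs k t Sig s) ell3 ell3"
    define a where "a \<epsilon> = (1 - \<epsilon>) * A + \<epsilon> * diag s" for \<epsilon>
    define b where "b \<epsilon> = (1 - \<epsilon>) * B + \<epsilon> * ?B" for \<epsilon>
    define c where "c \<epsilon> = (1 - \<epsilon>) * Q + \<epsilon> * ?Q" for \<epsilon>
    define d where "d \<epsilon> = a \<epsilon> - (b \<epsilon>)\<^sup>2 / c \<epsilon>" for \<epsilon>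
    have da: "(a has_real_derivative diag s - A) (at 0)"
      unfolding a_def by (auto intro!: derivative_eq_intros)
    have db: "(b has_real_derivative ?B - B) (at 0)"
      unfolding b_def by (auto intro!: derivative_eq_intros)
    have dc: "(c has_real_derivative ?Q - Q) (at 0)"
      unfolding c_def by (auto intro!: derivative_eq_intros)
    have at0: "a 0 = A" "b 0 = B" "c 0 = Q" "d 0 = D" by (simp_all add: a_def b_def c_def d_def D)
    \<comment> \<open>Differentiating the Schur complement gives the same result as freezing its
      coefficient at the optimal value \<open>B / Q\<close>, as in an envelope theorem; this is why
      \<open>lin s\<close> reappears as a derivative.\<close>
    have dd: "(d has_real_derivative lin s - D) (at 0)"
    proof -
      have "(d has_real_derivative (diag s - A) - (2 * B * (?B - B) * Q - B\<^sup>2 * (?Q - Q)) / Q\<^sup>2) (at 0)"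
        unfolding d_def using Q_pos at0
        by (auto intro!: derivative_eq_intros da db dc simp: power2_eq_square)
      also have "(diag s - A) - (2 * B * (?B - B) * Q - B\<^sup>2 * (?Q - Q)) / Q\<^sup>2 = lin s - D"
        using Q_pos by (simp add: linform_def D field_simps power2_eq_square)
      finally show ?thesis .
    qed
    have psi: "((\<lambda>\<epsilon>. Psi (\<kappa> * d \<epsilon>) (\<kappa> * a \<epsilon>)) has_real_derivative
        xd * (\<kappa> * (lin s - D)) + xa * ((real t - 2) * (\<kappa> * (diag s - A)))) (at 0)"
      by (rule deriv) (simp_all add: at0 DERIV_cmult[OF da] DERIV_cmult[OF dd])
    have "xd * (\<kappa> * (lin s - D)) + xa * ((real t - 2) * (\<kappa> * (diag s - A)))
        = \<kappa> * (xd * lin s + xa * ((real t - 2) * diag s) - (xd * D + xa * ((real t - 2) * A)))"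
      by (simp add: algebra_simps)
    also have "\<dots> > 0" using gt \<kappa>_pos by simp
    finally obtain r1 where r1: "r1 > 0"
      "\<And>\<epsilon>. 0 < \<epsilon> \<Longrightarrow> \<epsilon> < r1 \<Longrightarrow> Psi (\<kappa> * d 0) (\<kappa> * a 0) < Psi (\<kappa> * d (0 + \<epsilon>)) (\<kappa> * a (0 + \<epsilon>))"
      using DERIV_pos_inc_right[OF psi] by blast
    \<comment> \<open>The explicit value of the criterion is available only for a positive smallest
      eigenvalue, so the step length must also keep \<open>d\<close> positive.\<close>
    have "d \<midarrow>0\<rightarrow> D" using DERIV_isCont[OF dd] unfolding isCont_def at0 .
    from LIM_fun_gt_zero[OF this D_pos] obtain r2 where r2: "r2 > 0"
      "\<And>\<epsilon>. \<epsilon> \<noteq> 0 \<Longrightarrow> \<bar>0 - \<epsilon>\<bar> < r2 \<Longrightarrow> 0 < d \<epsilon>" by blast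
    define \<epsilon> where "\<epsilon> = min (1/2) (min (r1/2) (r2/2))"
    have \<epsilon>: "0 < \<epsilon>" "\<epsilon> < 1" "\<epsilon> < r1" "\<epsilon> < r2" using r1(1) r2(1) by (auto simp: \<epsilon>_def min_def)
    have q: "q \<epsilon> \<in> measures k t"
      unfolding q_def using \<epsilon> by (intro mix_measures p orbit_measure_measures s) auto
    have cq: "centred k t Sig (q \<epsilon>)"
      unfolding q_def by (intro centred_mix[OF k t Sig] cp centred_orbit_measure[OF k t Sig s])
    have vq: "vform (Vxi k t Sig (q \<epsilon>)) u w = (1 - \<epsilon>) * vform (Vxi k t Sig p) u w + \<epsilon> * vform (Vs k t Sig s) u w" for u w
      unfolding q_def vform_Vxi_mix[OF k t Sig] vform_orbit_measure[OF k t Sig s] ..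
    have "0 \<le> ?Q" by (rule vform_Vs_self_nonneg[OF k t Sig])
    then have c_pos: "c \<epsilon> > 0" unfolding c_def using \<epsilon> Q_pos by (intro add_pos_nonneg) auto
    have d_pos: "d \<epsilon> > 0" using r2(2)[of \<epsilon>] \<epsilon> by simp
    have "crit k t Sig lam g Phi (q \<epsilon>) = Psi (\<kappa> * d \<epsilon>) (\<kappa> * a \<epsilon>)"
      unfolding d_def
      by (rule crit_centred_eq[OF q cq])
        (use c_pos d_pos in \<open>simp_all add: vq A[symmetric] B[symmetric] Q[symmetric] a_def b_def c_def d_def\<close>)
    also have "\<dots> > Psi (\<kappa> * D) (\<kappa> * A)" using r1(2)[of \<epsilon>] \<epsilon> at0 by simp
    finally show False using opt q crit_p by (auto simp: optimal_for_def not_less[symmetric])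
  qed
qed

text \<open>The weights \<open>yd\<close> and \<open>ya\<close> are those of the stated ratio, and
  \<open>c\<close> rescales them to the true derivatives of the criterion. This positive factor
  cancels in the comparison; the ratio has \<open>p\<close>-mean 1 because \<open>linform\<close> at
  the given measure equals \<open>D\<close>.\<close>

lemma optimal_for_Max_iff:
  assumes "c > 0" "0 \<le> ya" "ya \<le> yd" and den: "yd * D + ya * ((real t - 2) * A) > 0"
    and f: "\<And>s. f s = (yd * lin s + ya * ((real t - 2) * diag s)) / (yd * D + ya * ((real t - 2) * A))"
    and Phi_le: "\<And>C e. info_like t C \<Longrightarrow> ip t e e = 1 \<Longrightarrow> ip t e (\<lambda>_. 1) = 0 \<Longrightarrow>
      Phi C \<le> c * yd * qf t C e + c * ya * (mtrace C - qf t C e)"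
    and Phi_eq: "\<And>C e \<alpha> \<delta>. info_like t C \<Longrightarrow> ip t e e = 1 \<Longrightarrow> ip t e (\<lambda>_. 1) = 0 \<Longrightarrow> 0 < \<delta> \<Longrightarrow> \<delta> \<le> \<alpha> \<Longrightarrow>
      two_point t \<alpha> \<delta> e C \<Longrightarrow> Phi C = Psi \<delta> \<alpha>"
    and val: "Psi (\<kappa> * D) (\<kappa> * A) = c * yd * (\<kappa> * D) + c * ya * ((real t - 2) * (\<kappa> * A))"
    and deriv: "\<And>f h f' h'. f 0 = \<kappa> * D \<Longrightarrow> h 0 = \<kappa> * A \<Longrightarrow>
      (f has_real_derivative f') (at 0) \<Longrightarrow> (h has_real_derivative h') (at 0) \<Longrightarrow>
      ((\<lambda>\<epsilon>. Psi (f \<epsilon>) (h \<epsilon>)) has_real_derivative c * yd * f' + c * ya * ((real t - 2) * h')) (at 0)"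
  shows "(optimal_for k t Sig lam g Phi p \<longleftrightarrow> Max (f ` Seqs k t) = 1) \<and>
    (Max (f ` Seqs k t) = 1 \<longrightarrow> (\<forall>s\<in>Seqs k t. p s > 0 \<longrightarrow> f s = 1))"
proof -
  let ?den = "yd * D + ya * ((real t - 2) * A)"
  have "(\<Sum>s\<in>Seqs k t. p s * f s) = (yd * linform lam (B / Q) (Vxi k t Sig p) + ya * ((real t - 2) * A)) / ?den"
    unfolding linform_Vxi A vform_Vxi[OF k Sig] f
    by (simp add: sum_divide_distrib[symmetric] sum_distrib_left sum.distrib[symmetric] algebra_simps)
  then have pf: "(\<Sum>s\<in>Seqs k t. p s * f s) = 1" unfolding linform_p using den by simp
  have p': "\<And>s. s \<in> Seqs k t \<Longrightarrow> 0 \<le> p s" "(\<Sum>s\<in>Seqs k t. p s) = 1" using p by (auto simp: measures_def)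
  have "optimal_for k t Sig lam g Phi p \<longleftrightarrow>
    (\<forall>s\<in>Seqs k t. c * yd * lin s + c * ya * ((real t - 2) * diag s) \<le> c * yd * D + c * ya * ((real t - 2) * A))"
  proof (rule optimal_for_iff[where Psi = Psi], goal_cases)
    case (3 C e)
    then show ?case by (rule Phi_le)
  next
    case (4 C e \<alpha> \<delta>)
    then show ?case by (rule Phi_eq)
  next
    case 5
    show ?case by (rule val)
  next
    case (6 f h f' h')
    then show ?case by (rule deriv)
  qed (use assms(1-3) in \<open>simp_all add: mult_left_mono\<close>)
  also have "\<dots> \<longleftrightarrow> (\<forall>s\<in>Seqs k t. f s \<le> 1)"
  proof (intro ball_cong refl)
    fix s
    have "c * yd * lin s + c * ya * ((real t - 2) * diag s) = c * (yd * lin s + ya * ((real t - 2) * diag s))"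
      "c * yd * D + c * ya * ((real t - 2) * A) = c * ?den" by (simp_all add: algebra_simps)
    then show "(c * yd * lin s + c * ya * ((real t - 2) * diag s) \<le> c * yd * D + c * ya * ((real t - 2) * A)) \<longleftrightarrow> f s \<le> 1"
      unfolding f using assms(1) den by (simp add: divide_le_eq_1)
  qed
  also have "\<dots> \<longleftrightarrow> Max (f ` Seqs k t) = 1"
    by (rule Max_eq_1_iff_weighted(1)[OF finite_Seqs p' pf, symmetric])
  finally show ?thesis using Max_eq_1_iff_weighted(2)[OF finite_Seqs p' pf] by blast
qed

section \<open>The four criteria\<close>

lemma A_pos: "A > 0" and tt: "real t - 2 \<ge> 0" "real t - 1 > 0"
  using D_le_A D_pos t by auto

text \<open>The smallest eigenvalue is bounded by the quadratic form alone, so the trace enters with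
  weight \<open>ya = 0\<close>.\<close>

lemma optimal_E:
  assumes f: "\<And>s. f s = lin s / D"
  shows "(optimal_for k t Sig lam g (PhiE t) p \<longleftrightarrow> Max (f ` Seqs k t) = 1) \<and>
    (Max (f ` Seqs k t) = 1 \<longrightarrow> (\<forall>s\<in>Seqs k t. p s > 0 \<longrightarrow> f s = 1))"
proof (rule optimal_for_Max_iff[where c = 1 and yd = 1 and ya = 0 and Psi = "\<lambda>\<delta> \<alpha>. \<delta>"], goal_cases)
  case (6 C e)
  then show ?case using PhiE_le[OF t 6] by simp
next
  case (7 C e \<alpha> \<delta>)
  then show ?case by (intro PhiE_eq[OF t])
qed (use D_pos f in simp_all)

text \<open>The criterion is a multiple of the trace, so the tangent bound is an identity with equal
  weights.\<close>

lemma optimal_T: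
  assumes f: "\<And>s. f s = (lin s + (real t - 2) * diag s) / (D + (real t - 2) * A)"
  shows "(optimal_for k t Sig lam g (PhiT t) p \<longleftrightarrow> Max (f ` Seqs k t) = 1) \<and>
    (Max (f ` Seqs k t) = 1 \<longrightarrow> (\<forall>s\<in>Seqs k t. p s > 0 \<longrightarrow> f s = 1))"
proof (rule optimal_for_Max_iff[where c = "1 / (real t - 1)" and yd = 1 and ya = 1
      and Psi = "\<lambda>\<delta> \<alpha>. (\<delta> + (real t - 2) * \<alpha>) / (real t - 1)"], goal_cases)
  case 4
  then show ?case using D_pos A_pos tt by (intro add_pos_nonneg) auto
next
  case (6 C e)
  then show ?case using PhiT_eq[OF t 6] by (simp add: diff_divide_distrib)
next
  case (7 C e \<alpha> \<delta>)
  then show ?case by (intro PhiT_two_point[OF t])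
next
  case 8
  then show ?case by (simp add: add_divide_distrib)
next
  case (9 f h f' h')
  then show ?case using tt by (auto intro!: derivative_eq_intros simp: add_divide_distrib)
qed (use tt f in simp_all)

text \<open>At \<open>(\<kappa> D, \<kappa> A)\<close> the harmonic mean has weights
  \<open>(t - 1) / (\<kappa> D)\<^sup>2 / W\<^sup>2\<close> and
  \<open>(t - 1) / (\<kappa> A)\<^sup>2 / W\<^sup>2\<close>. The common factor goes into
  \<open>c\<close>, which leaves \<open>1 / D\<^sup>2\<close> and
  \<open>1 / A\<^sup>2\<close>.\<close>

lemma optimal_A:
  assumes f: "\<And>s. f s = (lin s / D\<^sup>2 + (real t - 2) * diag s / A\<^sup>2) / (1 / D + (real t - 2) / A)"
  shows "(optimal_for k t Sig lam g (PhiA t) p \<longleftrightarrow> Max (f ` Seqs k t) = 1) \<and>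
    (Max (f ` Seqs k t) = 1 \<longrightarrow> (\<forall>s\<in>Seqs k t. p s > 0 \<longrightarrow> f s = 1))"
proof -
  let ?N = "real t - 1"
  define W where "W = 1 / (\<kappa> * D) + (real t - 2) / (\<kappa> * A)"
  have W: "W > 0" unfolding W_def using \<kappa>_pos D_pos A_pos tt by (intro add_pos_nonneg) auto
  have kD: "\<kappa> * D > 0" "\<kappa> * A > 0" using \<kappa>_pos D_pos A_pos by auto
  have cd: "?N / (\<kappa>\<^sup>2 * W\<^sup>2) * (1 / D\<^sup>2) = ?N / (\<kappa> * D)\<^sup>2 / W\<^sup>2" "?N / (\<kappa>\<^sup>2 * W\<^sup>2) * (1 / A\<^sup>2) = ?N / (\<kappa> * A)\<^sup>2 / W\<^sup>2"
    by (simp_all add: power_mult_distrib)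
  have den: "1 / D\<^sup>2 * D + 1 / A\<^sup>2 * ((real t - 2) * A) = 1 / D + (real t - 2) / A"
    using D_pos A_pos by (simp add: power2_eq_square)
  show ?thesis
  proof (rule optimal_for_Max_iff[where c = "?N / (\<kappa>\<^sup>2 * W\<^sup>2)" and yd = "1 / D\<^sup>2" and ya = "1 / A\<^sup>2"
        and Psi = "\<lambda>\<delta> \<alpha>. ?N / (1 / \<delta> + (real t - 2) / \<alpha>)"], goal_cases)
    case 1
    then show ?case using tt \<kappa>_pos W by simp
  next
    case 3
    then show ?case using D_pos D_le_A by (intro divide_left_mono power_mono) auto
  next
    case 4
    then show ?case unfolding den using D_pos A_pos tt by (intro add_pos_nonneg) auto
  next
    case (5 s)
    then show ?case unfolding den f by simp
  next
    case (6 C e)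
    have "PhiA t C \<le> ?N * (qf t C e / (\<kappa> * D)\<^sup>2 + (mtrace C - qf t C e) / (\<kappa> * A)\<^sup>2) / W\<^sup>2"
      unfolding W_def by (rule PhiA_le[OF t 6 kD])
    also have "\<dots> = ?N / (\<kappa> * D)\<^sup>2 / W\<^sup>2 * qf t C e + ?N / (\<kappa> * A)\<^sup>2 / W\<^sup>2 * (mtrace C - qf t C e)"
      by (simp add: add_divide_distrib distrib_left)
    finally show ?case unfolding cd .
  next
    case (7 C e \<alpha> \<delta>)
    then show ?case by (intro PhiA_eq[OF t])
  next
    case 8
    have "?N / (\<kappa> * D)\<^sup>2 / W\<^sup>2 * (\<kappa> * D) + ?N / (\<kappa> * A)\<^sup>2 / W\<^sup>2 * ((real t - 2) * (\<kappa> * A))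
        = ?N / W\<^sup>2 * (1 / (\<kappa> * D)) + ?N / W\<^sup>2 * ((real t - 2) / (\<kappa> * A))"
      using kD by (simp add: power2_eq_square mult_ac)
    also have "\<dots> = ?N / W\<^sup>2 * W" unfolding W_def[symmetric] distrib_left[symmetric] ..
    also have "\<dots> = ?N / W" using W by (simp add: power2_eq_square)
    finally show ?case unfolding cd W_def[symmetric] by (rule sym)
  next
    case (9 f h f' h')
    have regroup: "- (n * (- x / u - y / v) / w) = n / u / w * x + n / v / w * y" for n x y u v w :: real
      by (simp add: divide_inverse algebra_simps)
    define w where "w \<epsilon> = 1 / f \<epsilon> + (real t - 2) / h \<epsilon>" for \<epsilon>
    have w0: "w 0 = W" using 9(1,2) by (simp add: w_def W_def)
    have dw: "(w has_real_derivative - f' / (\<kappa> * D)\<^sup>2 - (real t - 2) * h' / (\<kappa> * A)\<^sup>2) (at 0)"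
      unfolding w_def using 9 kD by (auto intro!: derivative_eq_intros simp: power2_eq_square)
    have "((\<lambda>\<epsilon>. ?N / (1 / f \<epsilon> + (real t - 2) / h \<epsilon>)) has_real_derivative
        - (?N * (- f' / (\<kappa> * D)\<^sup>2 - (real t - 2) * h' / (\<kappa> * A)\<^sup>2) / W\<^sup>2)) (at 0)"
      unfolding w_def[symmetric] using W
      by (auto intro!: derivative_eq_intros dw simp: w0 power2_eq_square)
    also have "- (?N * (- f' / (\<kappa> * D)\<^sup>2 - (real t - 2) * h' / (\<kappa> * A)\<^sup>2) / W\<^sup>2)
        = ?N / (\<kappa> * D)\<^sup>2 / W\<^sup>2 * f' + ?N / (\<kappa> * A)\<^sup>2 / W\<^sup>2 * ((real t - 2) * h')"
      by (rule regroup)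
    finally show ?case unfolding cd .
  qed simp_all
qed

text \<open>The geometric mean has logarithmic derivatives proportional to \<open>1 / D\<close> and
  \<open>(t - 2) / A\<close>; its value \<open>P\<close> and the factor \<open>\<kappa>\<close> go
  into \<open>c\<close>. The normalising denominator is \<open>1 + (t - 2)\<close>.\<close>

lemma optimal_D:
  assumes f: "\<And>s. f s = (lin s / D + (real t - 2) * diag s / A) / (real t - 1)"
  shows "(optimal_for k t Sig lam g (PhiD t) p \<longleftrightarrow> Max (f ` Seqs k t) = 1) \<and>
    (Max (f ` Seqs k t) = 1 \<longrightarrow> (\<forall>s\<in>Seqs k t. p s > 0 \<longrightarrow> f s = 1))"
proof -
  let ?N = "real t - 1"
  define P where "P = (\<kappa> * D * (\<kappa> * A) ^ (t - 2)) powr (1 / ?N)"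
  have kD: "\<kappa> * D > 0" "\<kappa> * A > 0" using \<kappa>_pos D_pos A_pos by auto
  have base: "\<kappa> * D * (\<kappa> * A) ^ (t - 2) > 0" using kD by simp
  have P: "P > 0" unfolding P_def powr_gt_zero using base by linarith
  have cd: "P / (?N * \<kappa>) * (1 / D) = P / (?N * (\<kappa> * D))" "P / (?N * \<kappa>) * (1 / A) = P / (?N * (\<kappa> * A))"
    by simp_all
  have den: "1 / D * D + 1 / A * ((real t - 2) * A) = real t - 1" using D_pos A_pos by simp
  show ?thesis
  proof (rule optimal_for_Max_iff[where c = "P / (?N * \<kappa>)" and yd = "1 / D" and ya = "1 / A"
        and Psi = "\<lambda>\<delta> \<alpha>. (\<delta> * \<alpha> ^ (t - 2)) powr (1 / ?N)"], goal_cases)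
    case 1
    then show ?case using tt \<kappa>_pos P by simp
  next
    case 3
    then show ?case using D_pos D_le_A by (intro divide_left_mono) auto
  next
    case 4
    then show ?case unfolding den using tt by simp
  next
    case (5 s)
    then show ?case unfolding den f by simp
  next
    case (6 C e)
    have "PhiD t C \<le> (qf t C e / (\<kappa> * D) + (mtrace C - qf t C e) / (\<kappa> * A)) / ?N * P"
      unfolding P_def by (rule PhiD_le[OF t 6 kD])
    also have "\<dots> = P / (?N * (\<kappa> * D)) * qf t C e + P / (?N * (\<kappa> * A)) * (mtrace C - qf t C e)"
      by (simp add: add_divide_distrib distrib_left mult_ac)
    finally show ?case unfolding cd .
  next
    case (7 C e \<alpha> \<delta>)
    then show ?case by (intro PhiD_eq[OF t])
  next
    case 8
    have "P / (?N * (\<kappa> * D)) * (\<kappa> * D) + P / (?N * (\<kappa> * A)) * ((real t - 2) * (\<kappa> * A))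
        = P / ?N + P / ?N * (real t - 2)"
      using \<kappa>_pos D_pos A_pos by simp
    also have "\<dots> = P / ?N * ?N" by (simp add: right_diff_distrib)
    also have "\<dots> = P" using tt by simp
    finally show ?case unfolding cd P_def[symmetric] by (rule sym)
  next
    case (9 f h f' h')
    define m where "m = f' * (\<kappa> * A) ^ (t - 2) + \<kappa> * D * (real (t - 2) * (\<kappa> * A) ^ (t - 2 - 1) * h')"
    \<comment> \<open>For \<open>t = 2\<close> the exponent \<open>t - 2 - 1\<close> is truncated to
      0, but the factor \<open>t - 2\<close> makes both sides 0.\<close>
    have pw: "real (t - 2) * (\<kappa> * A) ^ (t - 2 - 1) = (real t - 2) * (\<kappa> * A) ^ (t - 2) / (\<kappa> * A)"
    proof (cases "t = 2")
      case False
      then have "t - 2 = Suc (t - 2 - 1)" using t by simp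
      then have "(\<kappa> * A) ^ (t - 2) = (\<kappa> * A) * (\<kappa> * A) ^ (t - 2 - 1)" by (metis power_Suc)
      then show ?thesis using \<kappa>_pos A_pos t by simp
    qed simp
    have dm: "((\<lambda>\<epsilon>. f \<epsilon> * h \<epsilon> ^ (t - 2)) has_real_derivative m) (at 0)"
      using 9 by (auto intro!: derivative_eq_intros simp: m_def)
    have "((\<lambda>\<epsilon>. (f \<epsilon> * h \<epsilon> ^ (t - 2)) powr (1 / ?N)) has_real_derivative
        1 / ?N * (f 0 * h 0 ^ (t - 2)) powr (1 / ?N - of_nat 1) * m) (at 0)"
      using base unfolding 9(1,2)[symmetric] by (rule DERIV_fun_powr[OF dm])
    also have "1 / ?N * (f 0 * h 0 ^ (t - 2)) powr (1 / ?N - of_nat 1) * m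
        = 1 / ?N * (P / (\<kappa> * D * (\<kappa> * A) ^ (t - 2))) * m"
      unfolding 9(1,2) using base by (simp add: powr_diff P_def)
    also have "m = \<kappa> * D * (\<kappa> * A) ^ (t - 2) * (f' / (\<kappa> * D) + (real t - 2) * h' / (\<kappa> * A))"
      unfolding m_def pw using \<kappa>_pos D_pos A_pos by (simp add: field_simps)
    also have "1 / ?N * (P / (\<kappa> * D * (\<kappa> * A) ^ (t - 2))) * \<dots>
        = P / (?N * (\<kappa> * D)) * f' + P / (?N * (\<kappa> * A)) * ((real t - 2) * h')"
      using \<kappa>_pos D_pos A_pos by (simp add: add_divide_distrib distrib_left)
    finally show ?case unfolding cd .
  qed (use D_pos A_pos in simp_all)
qed

end

lemma vform_Vs_commute:
  assumes "k > 0" "pos_def k Sig"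
  shows "vform (Vs k t Sig s) u w = vform (Vs k t Sig s) w u"
  unfolding vform_Vs[OF assms] cross_def
  by (intro sum.cong refl bform_Btilde_commute[OF assms])

lemma vform_Vxi_commute:
  assumes "k > 0" "pos_def k Sig"
  shows "vform (Vxi k t Sig q) u w = vform (Vxi k t Sig q) w u"
  unfolding vform_Vxi[OF assms] using vform_Vs_commute[OF assms] by metis

theorem theorem4:
  fixes k t :: nat and Sig :: "real Matrix.mat" and lam :: real
    and g :: "(nat \<Rightarrow> real) measure" and p :: "nat list \<Rightarrow> real"
  assumes k2: "k \<ge> 2" and t2: "t \<ge> 2"
    and Sig: "pos_def k Sig"
    and lam: "1 + 2 * lam \<noteq> 0"
    and g: "exchangeable t g"
    and p: "p \<in> measures k t"
    and nondeg: "nondegenerate k t p"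
    and psym: "pseudo_symmetric k t Sig p"
  defines "ell \<equiv> ellv lam"
    and "VX \<equiv> Vxi k t Sig p"
    and "V3 \<equiv> transpose_mat (L3 lam) * Vxi k t Sig p * L3 lam"
    and "Q3 \<equiv> quad (Vxi k t Sig p) ell3"
    and "r \<equiv> (\<lambda>s. r3 lam (Vs k t Sig s) (Vxi k t Sig p))"
  shows
   "(Q3 = 0 \<longrightarrow>
      ((universally_optimal k t Sig lam g p \<longleftrightarrow>
          Max ((\<lambda>s. mtrace (Cs k t Sig s 0 0) / mtrace (Cxi k t Sig p 0 0)) ` Seqs k t) = 1) \<and>
       (Max ((\<lambda>s. mtrace (Cs k t Sig s 0 0) / mtrace (Cxi k t Sig p 0 0)) ` Seqs k t) = 1 \<longrightarrow>
          (\<forall>s \<in> Seqs k t. p s > 0 \<longrightarrow>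
             mtrace (Cs k t Sig s 0 0) / mtrace (Cxi k t Sig p 0 0) = 1)))) \<and>
    (Determinant.det V3 > 0 \<longrightarrow>
      (let fA = (\<lambda>s. (r s * Q3 / Determinant.det V3 + (real t - 2) * inverse ((quad VX ell)^2) * quad (Vs k t Sig s) ell)
                     / (Q3 / Determinant.det V3 + (real t - 2) * inverse (quad VX ell)));
           fD = (\<lambda>s. r s / (real t - 1) + (real t - 2) / (real t - 1) * (quad (Vs k t Sig s) ell / quad VX ell));
           fE = r;
           fT = (\<lambda>s. (r s * Determinant.det V3 / Q3 + (real t - 2) * quad (Vs k t Sig s) ell)
                     / (Determinant.det V3 / Q3 + (real t - 2) * quad VX ell))
       in
       ((optimal_for k t Sig lam g (PhiA t) p \<longleftrightarrow> Max (fA ` Seqs k t) = 1) \<and>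
        (Max (fA ` Seqs k t) = 1 \<longrightarrow> (\<forall>s \<in> Seqs k t. p s > 0 \<longrightarrow> fA s = 1))) \<and>
       ((optimal_for k t Sig lam g (PhiD t) p \<longleftrightarrow> Max (fD ` Seqs k t) = 1) \<and>
        (Max (fD ` Seqs k t) = 1 \<longrightarrow> (\<forall>s \<in> Seqs k t. p s > 0 \<longrightarrow> fD s = 1))) \<and>
       ((optimal_for k t Sig lam g (PhiE t) p \<longleftrightarrow> Max (fE ` Seqs k t) = 1) \<and>
        (Max (fE ` Seqs k t) = 1 \<longrightarrow> (\<forall>s \<in> Seqs k t. p s > 0 \<longrightarrow> fE s = 1))) \<and>
       ((optimal_for k t Sig lam g (PhiT t) p \<longleftrightarrow> Max (fT ` Seqs k t) = 1) \<and>
        (Max (fT ` Seqs k t) = 1 \<longrightarrow> (\<forall>s \<in> Seqs k t. p s > 0 \<longrightarrow> fT s = 1)))))"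
proof -
  have k: "k > 0" using k2 by simp
  have cp: "centred k t Sig p" by (rule centred_pseudo_symmetric[OF k t2 Sig psym])
  define A where "A = vform (Vxi k t Sig p) (ellv lam) (ellv lam)"
  define B where "B = vform (Vxi k t Sig p) (ellv lam) ell3"
  define Q where "Q = vform (Vxi k t Sig p) ell3 ell3"
  have Q_pos: "Q > 0" unfolding Q_def by (rule vform_ell3_pos[OF k t2 Sig p nondeg])
  have cX: "Vxi k t Sig p \<in> carrier_mat 3 3" and cs: "Vs k t Sig s \<in> carrier_mat 3 3" for s
    by (simp_all add: Vxi_def Vs_def)
  note comm = vform_Vxi_commute[OF k Sig] vform_Vs_commute[OF k Sig]
  have Q3: "Q3 = Q" and qX: "quad VX ell = A" and qs: "quad (Vs k t Sig s) ell = vform (Vs k t Sig s) (ellv lam) (ellv lam)" for s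
    by (simp_all add: Q3_def VX_def ell_def A_def Q_def quad_vform cX cs)
  have det: "Determinant.det V3 = A * Q - B\<^sup>2"
    unfolding V3_def A_def B_def Q_def by (rule det_L3_congruence[OF cX comm(1)])
  show ?thesis
  proof (rule conjI, goal_cases)
    case 1
    then show ?case using Q3 Q_pos by simp
  next
    case 2
    show ?case
      unfolding Let_def
    proof (rule impI, goal_cases)
      case 1
      define D where "D = A - B\<^sup>2 / Q"
      \<comment> \<open>As \<open>Q\<close> is positive, the determinant hypothesis amounts to
        \<open>D > 0\<close>, a positive Schur complement.\<close>
      have detD: "Determinant.det V3 = D * Q" using Q_pos by (simp add: det D_def field_simps)
      then have D: "D > 0" using 1 Q_pos by (simp add: zero_less_mult_iff)
      have r: "r s = linform lam (B / Q) (Vs k t Sig s) / D" for s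
        unfolding r_def B_def Q_def D_def A_def
        by (rule r3_eq[OF cs comm(2) cX comm(1)]) (use Q_pos D in \<open>simp_all add: A_def B_def Q_def D_def\<close>)
      note opt = optimal_A optimal_D optimal_E optimal_T
      note opt = opt[OF k t2 Sig g p cp lam A_def B_def Q_def Q_pos D_def D refl]
      have scale: "Q / (D * Q) = 1 / D" "x * Q / (D * Q) = x / D" "D * Q / Q = D" "x * (D * Q) / Q = x * D" for x
        using Q_pos by simp_all
      show ?case
        unfolding Q3 detD qX qs r scale
      proof (rule conjI[OF opt(1) conjI[OF opt(2) conjI[OF opt(3) opt(4)]]], goal_cases)
        case (1 s)
        then show ?case by (simp add: power2_eq_square divide_inverse mult_ac)
      next
        case (2 s)
        then show ?case by (simp add: add_divide_distrib)
      next
        case (3 s)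
        then show ?case by simp
      next
        case (4 s)
        then show ?case using D by simp
      qed
    qed
  qed
qed

end
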